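(* Let $H(K)$ be a separable reproducing kernel Hilbert space of complex-valued functions on a subset $D\subset\mathbb{R}^d$ with positive definite Hermitian kernel $K$, and let $\varrho_D$ be a measure on $D$ such that $\int_D K(\mathbf{x},\mathbf{x})\,d\varrho_D(\mathbf{x})<\infty$. Let $r>1$, $n\in\mathbb{N}$, $n\ge 3$, and $$m:=\Big\lfloor\frac{n}{14\,r\log n}\Big\rfloor,\qquad m\ge 2.$$ Then $$\mathbb{P}\Big(\sup_{\|f\|_{H(K)}\le1}\|f-\widetilde S^m_{\mathbf{X}}f\|^2_{L_2(D,\varrho_D)}\le\frac{15}{m}\sum_{j=\lfloor m/2\rfloor}^\infty\sigma_j^2\Big)\ge 1-3n^{1-r},$$ where $\mathbf{X}=(\mathbf{x}^1,\dots,\mathbf{x}^n)$ is sampled according to the product measure $(\varrho_m(\mathbf{x})\,d\varrho_D(\mathbf{x}))^n$ with $$\varrho_m(\mathbf{x})=\frac12\bigg(\frac1{m-1}\sum_{j=1}^{m-1}|\eta_j(\mathbf{x})|^2+\frac{K(\mathbf{x},\mathbf{x})-\sum_{j=1}^{m-1}|e_j(\mathbf{x})|^2}{\int_D K(\mathbf{x},\mathbf{x})\,d\varrho_D(\mathbf{x})-\sum_{j=1}^{m-1}\lambda_j}\bigg),$$ and $\widetilde S^m_{\mathbf{X}}$ is the weighted least squares operator built with this density $\varrho_m$.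
   Context: $L_2(D,\varrho_D)$ is the space of complex-valued square-integrable functions; $\log$ is the natural logarithm. The finite trace condition implies that the embedding $\mathrm{Id}:H(K)\to L_2(D,\varrho_D)$ is Hilbert–Schmidt (it need not be injective). $H(K)$ is infinite-dimensional, and the strictly positive eigenvalues of $\mathrm{Id}^*\circ\mathrm{Id}:H(K)\to H(K)$, counted with multiplicity, form a sequence $\lambda_1\ge\lambda_2\ge\cdots>0$, $(\lambda_j)_{j\in\mathbb{N}}$. Put $\sigma_j:=\sqrt{\lambda_j}$ (singular numbers of $\mathrm{Id}$). Let $(e_j)_{j}\subset H(K)$ be a corresponding orthonormal system (in $H(K)$) of eigenvectors, and $\eta_j:=\sigma_j^{-1}e_j$ (defined pointwise on $D$), which is an orthonormal system in $L_2(D,\varrho_D)$. Weighted least squares operator $\widetilde S^m_{\mathbf{X}}$ for a density $\varrho_m$ and nodes $\mathbf{X}=(\mathbf{x}^1,\dots,\mathbf{x}^n)\in D^n$: given $f$, put $g_j:=f(\mathbf{x}^j)/\sqrt{\varrho_m(\mathbf{x}^j)}$ if $\varrho_m(\mathbf{x}^j)\ne0$ and $g_j:=0$ otherwise, $\mathbf{g}=(g_j)_{j=1}^n$; let $\widetilde{\mathbf{L}}_m=(l_{j,k})\in\mathbb{C}^{n\times(m-1)}$ with $l_{j,k}:=\eta_k(\mathbf{x}^j)/\sqrt{\varrho_m(\mathbf{x}^j)}$ if $\varrho_m(\mathbf{x}^j)\neq0$ and $l_{j,k}:=0$ otherwise. If $\widetilde{\mathbf{L}}_m$ has full column rank, put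 $(\tilde c_1,\dots,\tilde c_{m-1})^\top:=(\widetilde{\mathbf{L}}_m^*\widetilde{\mathbf{L}}_m)^{-1}\widetilde{\mathbf{L}}_m^*\mathbf{g}$ and $\widetilde S^m_{\mathbf{X}}f:=\sum_{k=1}^{m-1}\tilde c_k\eta_k$. The probability statement refers to the event that $\widetilde S^m_{\mathbf{X}}$ is defined and the inequality holds. *)

theory Defs
  imports
    "HOL-Probability.Probability"
    "HOL-Library.Function_Algebras"
    "HOL-Library.Nonpos_Ints"
    "Jordan_Normal_Form.DL_Rank"
    "Jordan_Normal_Form.Schur_Decomposition"
    "Jordan_Normal_Form.Gauss_Jordan_Elimination"
begin

(* Complex-valued functions on D are represented by the functions on the whole ambient type
   that vanish outside D; they form a complex vector space under the pointwise operations. *)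

definition fscale :: "complex \<Rightarrow> ('a \<Rightarrow> complex) \<Rightarrow> 'a \<Rightarrow> complex" where
  "fscale c f = (\<lambda>x. c * f x)"

global_interpretation cfun: vector_space "fscale :: complex \<Rightarrow> ('a \<Rightarrow> complex) \<Rightarrow> 'a \<Rightarrow> complex"
  by unfold_locales (auto simp: fscale_def fun_eq_iff algebra_simps)

definition kernel_section ::
    "'a set \<Rightarrow> ('a \<Rightarrow> 'a \<Rightarrow> complex) \<Rightarrow> 'a \<Rightarrow> 'a \<Rightarrow> complex" where
  "kernel_section D K y = (\<lambda>x. if x \<in> D then K x y else 0)"

(* Positive definite in Aronszajn's sense: the quadratic forms are only required to be >= 0. *)
definition pos_def_kernel :: "'a set \<Rightarrow> ('a \<Rightarrow> 'a \<Rightarrow> complex) \<Rightarrow> bool" where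
  "pos_def_kernel D K \<longleftrightarrow>
     (\<forall>x\<in>D. \<forall>y\<in>D. K y x = cnj (K x y)) \<and>
     (\<forall>A c. finite A \<longrightarrow> A \<subseteq> D \<longrightarrow>
        (\<Sum>x\<in>A. \<Sum>y\<in>A. cnj (c x) * c y * K x y) \<in> \<real>\<^sub>\<ge>\<^sub>0)"

definition hnorm :: "(('a \<Rightarrow> complex) \<Rightarrow> ('a \<Rightarrow> complex) \<Rightarrow> complex) \<Rightarrow> ('a \<Rightarrow> complex) \<Rightarrow> real" where
  "hnorm ip f = sqrt (Re (ip f f))"

(* H with the inner product ip (linear in the first argument) is the Hilbert space H(K); by the
   Moore-Aronszajn theorem it is determined by D and K. *)
locale rkhs =
  fixes D :: "'a set"
    and K :: "'a \<Rightarrow> 'a \<Rightarrow> complex"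
    and H :: "('a \<Rightarrow> complex) set"
    and ip :: "('a \<Rightarrow> complex) \<Rightarrow> ('a \<Rightarrow> complex) \<Rightarrow> complex"
  assumes subspace_H: "cfun.subspace H"
    and supported: "\<And>f x. f \<in> H \<Longrightarrow> x \<notin> D \<Longrightarrow> f x = 0"
    and ip_add: "\<And>f g h. f \<in> H \<Longrightarrow> g \<in> H \<Longrightarrow> h \<in> H \<Longrightarrow> ip (f + g) h = ip f h + ip g h"
    and ip_scale: "\<And>c f g. f \<in> H \<Longrightarrow> g \<in> H \<Longrightarrow> ip (fscale c f) g = c * ip f g"
    and ip_cnj: "\<And>f g. f \<in> H \<Longrightarrow> g \<in> H \<Longrightarrow> ip g f = cnj (ip f g)"
    and ip_nonneg: "\<And>f. f \<in> H \<Longrightarrow> 0 \<le> Re (ip f f)"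
    and ip_definite: "\<And>f. f \<in> H \<Longrightarrow> ip f f = 0 \<Longrightarrow> f = 0"
    and complete: "\<And>F :: nat \<Rightarrow> 'a \<Rightarrow> complex. (\<And>n. F n \<in> H) \<Longrightarrow>
          (\<And>\<epsilon>. \<epsilon> > 0 \<Longrightarrow> \<exists>N. \<forall>i\<ge>N. \<forall>j\<ge>N. hnorm ip (F i - F j) < \<epsilon>) \<Longrightarrow>
          \<exists>f\<in>H. (\<lambda>n. hnorm ip (F n - f)) \<longlonglongrightarrow> 0"
    and section_in: "\<And>y. y \<in> D \<Longrightarrow> kernel_section D K y \<in> H"
    and reproducing: "\<And>f y. f \<in> H \<Longrightarrow> y \<in> D \<Longrightarrow> f y = ip f (kernel_section D K y)"

definition separable_hilbert ::
    "('a \<Rightarrow> complex) set \<Rightarrow> (('a \<Rightarrow> complex) \<Rightarrow> ('a \<Rightarrow> complex) \<Rightarrow> complex) \<Rightarrow> bool" where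
  "separable_hilbert H ip \<longleftrightarrow>
     (\<exists>S. countable S \<and> S \<subseteq> H \<and> (\<forall>f\<in>H. \<forall>\<epsilon>>0. \<exists>g\<in>S. hnorm ip (f - g) < \<epsilon>))"

definition infinite_dimensional :: "('a \<Rightarrow> complex) set \<Rightarrow> bool" where
  "infinite_dimensional H \<longleftrightarrow> \<not> (\<exists>B. finite B \<and> H \<subseteq> cfun.span B)"

definition l2_inner :: "'a measure \<Rightarrow> ('a \<Rightarrow> complex) \<Rightarrow> ('a \<Rightarrow> complex) \<Rightarrow> complex" where
  "l2_inner M f g = (LINT x|M. f x * cnj (g x))"

definition l2_norm_sq :: "'a measure \<Rightarrow> ('a \<Rightarrow> complex) \<Rightarrow> ennreal" where
  "l2_norm_sq M f = (\<integral>\<^sup>+x. ennreal ((cmod (f x))\<^sup>2) \<partial>M)"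

(* The Hilbert space adjoint Id* : L_2(M) -> H of the embedding Id : H -> L_2(M). Elements of
   L_2 are given by representatives, so Id itself acts as the identity on functions. *)
definition embedding_adjoint ::
    "('a \<Rightarrow> complex) set \<Rightarrow> (('a \<Rightarrow> complex) \<Rightarrow> ('a \<Rightarrow> complex) \<Rightarrow> complex) \<Rightarrow> 'a measure \<Rightarrow>
     ('a \<Rightarrow> complex) \<Rightarrow> 'a \<Rightarrow> complex" where
  "embedding_adjoint H ip M g = (THE h. h \<in> H \<and> (\<forall>f\<in>H. ip f h = l2_inner M f g))"

definition embedding_gram ::
    "('a \<Rightarrow> complex) set \<Rightarrow> (('a \<Rightarrow> complex) \<Rightarrow> ('a \<Rightarrow> complex) \<Rightarrow> complex) \<Rightarrow> 'a measure \<Rightarrow>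
     ('a \<Rightarrow> complex) \<Rightarrow> 'a \<Rightarrow> complex" where
  "embedding_gram H ip M = embedding_adjoint H ip M \<circ> id"

definition eigenspace ::
    "('a \<Rightarrow> complex) set \<Rightarrow> (('a \<Rightarrow> complex) \<Rightarrow> 'a \<Rightarrow> complex) \<Rightarrow> real \<Rightarrow> ('a \<Rightarrow> complex) set" where
  "eigenspace H T \<mu> = {f \<in> H. T f = fscale (complex_of_real \<mu>) f}"

(* Sequences are indexed from 1; their values at 0 are irrelevant. As Id* o Id is compact, the
   eigenspaces for positive eigenvalues are finite-dimensional, so that cfun.dim (which is 0 on
   infinite-dimensional spaces) is the true multiplicity. *)
definition positive_eigenvalue_sequence ::
    "('a \<Rightarrow> complex) set \<Rightarrow> (('a \<Rightarrow> complex) \<Rightarrow> 'a \<Rightarrow> complex) \<Rightarrow> (nat \<Rightarrow> real) \<Rightarrow> bool" where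
  "positive_eigenvalue_sequence H T lam \<longleftrightarrow>
     (\<forall>j\<ge>1. lam j > 0) \<and>
     (\<forall>i j. 1 \<le> i \<longrightarrow> i \<le> j \<longrightarrow> lam j \<le> lam i) \<and>
     (\<forall>\<mu>>0. card {j. 1 \<le> j \<and> lam j = \<mu>} = cfun.dim (eigenspace H T \<mu>))"

definition orthonormal_eigenvectors ::
    "('a \<Rightarrow> complex) set \<Rightarrow> (('a \<Rightarrow> complex) \<Rightarrow> ('a \<Rightarrow> complex) \<Rightarrow> complex) \<Rightarrow>
     (('a \<Rightarrow> complex) \<Rightarrow> 'a \<Rightarrow> complex) \<Rightarrow> (nat \<Rightarrow> real) \<Rightarrow> (nat \<Rightarrow> 'a \<Rightarrow> complex) \<Rightarrow> bool" where
  "orthonormal_eigenvectors H ip T lam e \<longleftrightarrow>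
     (\<forall>j\<ge>1. e j \<in> eigenspace H T (lam j)) \<and>
     (\<forall>i\<ge>1. \<forall>j\<ge>1. ip (e i) (e j) = (if i = j then 1 else 0))"

definition sampling_density ::
    "'a measure \<Rightarrow> ('a \<Rightarrow> 'a \<Rightarrow> complex) \<Rightarrow> (nat \<Rightarrow> real) \<Rightarrow> (nat \<Rightarrow> 'a \<Rightarrow> complex) \<Rightarrow>
     (nat \<Rightarrow> 'a \<Rightarrow> complex) \<Rightarrow> nat \<Rightarrow> 'a \<Rightarrow> real" where
  "sampling_density M K lam e \<eta> m x =
     1 / 2 * (1 / real (m - 1) * (\<Sum>j = 1..m - 1. (cmod (\<eta> j x))\<^sup>2) +
              (Re (K x x) - (\<Sum>j = 1..m - 1. (cmod (e j x))\<^sup>2)) /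
              ((LINT y|M. Re (K y y)) - (\<Sum>j = 1..m - 1. lam j)))"

(* Nodes X 1, ..., X n and functions \<eta> 1, ..., \<eta> (m - 1); matrices and vectors are indexed
   from 0, hence the shifts by Suc. *)
definition wls_matrix ::
    "(nat \<Rightarrow> 'a \<Rightarrow> complex) \<Rightarrow> ('a \<Rightarrow> real) \<Rightarrow> nat \<Rightarrow> nat \<Rightarrow> (nat \<Rightarrow> 'a) \<Rightarrow> complex mat" where
  "wls_matrix \<eta> \<rho> n m X = mat n (m - 1) (\<lambda>(j, k).
     if \<rho> (X (Suc j)) \<noteq> 0
     then \<eta> (Suc k) (X (Suc j)) / complex_of_real (sqrt (\<rho> (X (Suc j)))) else 0)"

definition wls_data ::
    "('a \<Rightarrow> real) \<Rightarrow> nat \<Rightarrow> (nat \<Rightarrow> 'a) \<Rightarrow> ('a \<Rightarrow> complex) \<Rightarrow> complex vec" where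
  "wls_data \<rho> n X f = vec n (\<lambda>j.
     if \<rho> (X (Suc j)) \<noteq> 0 then f (X (Suc j)) / complex_of_real (sqrt (\<rho> (X (Suc j)))) else 0)"

definition wls_defined ::
    "(nat \<Rightarrow> 'a \<Rightarrow> complex) \<Rightarrow> ('a \<Rightarrow> real) \<Rightarrow> nat \<Rightarrow> nat \<Rightarrow> (nat \<Rightarrow> 'a) \<Rightarrow> bool" where
  "wls_defined \<eta> \<rho> n m X \<longleftrightarrow> vec_space.rank n (wls_matrix \<eta> \<rho> n m X) = m - 1"

definition wls_coeffs ::
    "(nat \<Rightarrow> 'a \<Rightarrow> complex) \<Rightarrow> ('a \<Rightarrow> real) \<Rightarrow> nat \<Rightarrow> nat \<Rightarrow> (nat \<Rightarrow> 'a) \<Rightarrow> ('a \<Rightarrow> complex) \<Rightarrow>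
     complex vec" where
  "wls_coeffs \<eta> \<rho> n m X f =
     (let L = wls_matrix \<eta> \<rho> n m X
      in (the (mat_inverse (mat_adjoint L * L)) * mat_adjoint L) *\<^sub>v wls_data \<rho> n X f)"

definition wls_operator ::
    "(nat \<Rightarrow> 'a \<Rightarrow> complex) \<Rightarrow> ('a \<Rightarrow> real) \<Rightarrow> nat \<Rightarrow> nat \<Rightarrow> (nat \<Rightarrow> 'a) \<Rightarrow> ('a \<Rightarrow> complex) \<Rightarrow>
     'a \<Rightarrow> complex" where
  "wls_operator \<eta> \<rho> n m X f =
     (\<Sum>k = 1..m - 1. fscale (vec_index (wls_coeffs \<eta> \<rho> n m X f) (k - 1)) (\<eta> k))"

end

theory Submission
  imports Defs "HOL-Complex_Analysis.Great_Picard"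
begin

text \<open>The error of the least squares operator on the unit ball splits into the projection error, at
  most \<open>\<lambda>\<^sub>m\<close>, and the operator applied to the projection residual. The latter is controlled by the
  smallest eigenvalue of the Gram matrix of the sampled \<open>\<eta>\<^sub>1, \<dots>, \<eta>\<^sub>m\<^sub>-\<^sub>1\<close> and by the largest eigenvalue of
  the Gram matrix of the sampled tail \<open>e\<^sub>m, e\<^sub>m\<^sub>+\<^sub>1, \<dots>\<close>; the density makes both kinds of weighted
  vectors bounded.

  Both eigenvalues are controlled by the exponential moment method for the trace of truncated
  exponential series. For one rank-one summand \<open>u u\<^sup>*\<close> and positive semidefinite \<open>A\<close>, the sequence
  \<open>f k = \<langle>A\<^sup>k u, u\<rangle>\<close> is log-convex, so \<open>f a * f c \<le> f 0 * f (a + c)\<close>. Expanding powers of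
  \<open>A + u u\<^sup>*\<close> then gives \<open>\<langle>exp (t (A + u u\<^sup>*)) u, u\<rangle> \<le> exp (t \<parallel>u\<parallel>\<^sup>2) \<langle>exp (t A) u, u\<rangle>\<close>, which
  replaces the Golden-Thompson inequality. In the upper bound the zeroth
  term of the series, whose trace is the dimension, is replaced by the number of nodes.

  The tail beyond \<open>N\<close>, including the kernel of the embedding, is removed by Markov's inequality,
  since \<open>K(x,x) - \<Sum>\<^sub>j\<^sub>\<le>\<^sub>N |e\<^sub>j(x)|\<^sup>2\<close> has integral tending to 0. This trace formula is
  the spectral theorem for the compact operator \<open>Id\<^sup>* Id\<close> in the form needed here.\<close>

section \<open>Powers of positive semidefinite matrices under rank-one updates\<close>

text \<open>The exponential series are truncated so that every tracked quantity is a polynomial in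
  the sampled values and their conjugates: measurability is then immediate, and a high truncation
  degree costs only constant factors. A prefactor equal to the dimension would be useless for the
  tail, since the cut-off \<open>N\<close> that makes the far remainder small is not bounded in
  terms of \<open>n\<close>.

  The series in the bound starts at \<open>m div 2\<close> because the projection error
  \<open>lam m\<close> is not controlled by \<open>tail / m\<close>. The at least
  \<open>m / 2\<close> eigenvalues from \<open>m div 2\<close> to \<open>m - 1\<close> are each at
  least \<open>lam m\<close>, so their sum pays for it. The error comes out as
  \<open>7 * lam m + 104 / 7 * tail / m\<close>; the first term costs \<open>14 / m\<close> times
  that sum, and 15 exceeds both 14 and 104 / 7.

  The success event involves a supremum over an uncountable ball and a matrix inverse. It is
  measurable because the error is continuous in the function, so a countable dense subset suffices,
  and because Cramer's rule expresses the coefficients rationally in the sampled values and their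
  conjugates.\<close>

lemma quadratic_nonneg_discrim:
  fixes a b c :: real
  assumes nn: "\<And>x. 0 \<le> a * x\<^sup>2 + 2 * b * x + c"
  shows "b\<^sup>2 \<le> a * c"
proof (cases "a = 0")
  case True
  have "b = 0"
  proof (rule ccontr)
    assume ne: "b \<noteq> 0"
    from nn[of "- (c + 1) / (2 * b)"] show False
      using True ne by (simp add: field_simps)
  qed
  then show ?thesis using True by simp
next
  case False
  have "a > 0"
  proof (rule ccontr)
    assume "\<not> a > 0"
    then have "a < 0" using False by simp
    \<comment> \<open>For a negative leading coefficient this point gives a x^2 + c <= a x + c = a -
      |c| + c < 0. Evaluating at x and at -x removes the linear term.\<close>
    define x where "x = 1 + \<bar>c\<bar> / - a"
    have "1 \<le> x" using \<open>a < 0\<close> by (simp add: x_def divide_nonneg_neg)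
    have "0 \<le> a * x\<^sup>2 + c" using nn[of x] nn[of "- x"] by simp
    also have "a * x\<^sup>2 \<le> a * x"
      using \<open>1 \<le> x\<close> \<open>a < 0\<close> by (intro mult_left_mono_neg) (auto simp: power2_eq_square)
    also have "a * x = a - \<bar>c\<bar>" using \<open>a < 0\<close> by (simp add: x_def field_simps)
    finally show False using \<open>a < 0\<close> by linarith
  qed
  have "0 \<le> a * (a * (- b / a)\<^sup>2 + 2 * b * (- b / a) + c)"
    by (rule mult_nonneg_nonneg[OF less_imp_le[OF \<open>a > 0\<close>] nn])
  also have "\<dots> = a * c - b\<^sup>2"
    using False by (simp add: field_simps power2_eq_square)
  finally show ?thesis by simp
qed

text \<open>Monotonicity of the ratios \<open>f (Suc k) / f k\<close>, cross-multiplied so that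
  zeros are allowed; log-convexity passes a zero on to the next index.\<close>

lemma log_convex_ratio_mono:
  fixes f :: "nat \<Rightarrow> real"
  assumes pos: "\<And>k. 0 \<le> f k" and lc: "\<And>k. (f (Suc k))\<^sup>2 \<le> f k * f (Suc (Suc k))" and "k \<le> j"
  shows "f (Suc k) * f j \<le> f k * f (Suc j)"
  using \<open>k \<le> j\<close>
proof (induction j rule: dec_induct)
  case base
  then show ?case by (simp add: mult.commute)
next
  case (step j)
  show ?case
  proof (cases "f j = 0")
    case True
    then have "f (Suc j) = 0" using lc[of j] by simp
    then show ?thesis using pos by simp
  next
    case False
    then have j: "0 < f j" using pos[of j] by simp
    have "f j * (f (Suc k) * f (Suc j)) = (f (Suc k) * f j) * f (Suc j)" by simp
    also have "\<dots> \<le> (f k * f (Suc j)) * f (Suc j)"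
      by (rule mult_right_mono[OF step.IH pos])
    also have "\<dots> = f k * (f (Suc j))\<^sup>2" by (simp add: power2_eq_square)
    also have "\<dots> \<le> f k * (f j * f (Suc (Suc j)))"
      by (rule mult_left_mono[OF lc pos])
    also have "\<dots> = f j * (f k * f (Suc (Suc j)))" by simp
    finally show ?thesis using j by (simp only: mult_le_cancel_left_pos)
  qed
qed

text \<open>Moving one unit from the smaller index to the larger one increases the product;
  repeating this until the smaller index is 0 gives the claim.\<close>

lemma log_convex_supermult:
  fixes f :: "nat \<Rightarrow> real"
  assumes pos: "\<And>k. 0 \<le> f k" and lc: "\<And>k. (f (Suc k))\<^sup>2 \<le> f k * f (Suc (Suc k))"
  shows "f a * f c \<le> f 0 * f (a + c)"
proof -
  have *: "f a * f c \<le> f 0 * f (a + c)" if "a \<le> c" for a c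
    using that
  proof (induction a arbitrary: c)
    case (Suc a)
    have "f (Suc a) * f c \<le> f a * f (Suc c)"
      using log_convex_ratio_mono[of f a c, OF pos lc] Suc.prems by simp
    also have "\<dots> \<le> f 0 * f (a + Suc c)" using Suc.IH[of "Suc c"] Suc.prems by simp
    finally show ?case by simp
  qed simp
  show ?thesis
    using *[of a c] *[of c a] by (cases "a \<le> c") (auto simp: mult.commute add.commute)
qed

lemma log_convex_power:
  fixes f :: "nat \<Rightarrow> real"
  assumes pos: "\<And>k. 0 \<le> f k" and lc: "\<And>k. (f (Suc k))\<^sup>2 \<le> f k * f (Suc (Suc k))"
    and "f 0 = 1"
  shows "f 1 ^ p \<le> f p"
proof (induction p)
  case (Suc p)
  have "f 1 ^ Suc p \<le> f 1 * f p" using Suc pos[of 1] by (simp add: mult_left_mono)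
  also have "\<dots> \<le> f (Suc p)" using log_convex_supermult[of f 1 p, OF pos lc] assms(3) by simp
  finally show ?case .
qed (simp add: assms)

section \<open>Positive semidefinite forms over a finite index set\<close>

definition inner_on :: "'i set \<Rightarrow> ('i \<Rightarrow> complex) \<Rightarrow> ('i \<Rightarrow> complex) \<Rightarrow> complex" where
  "inner_on I v w = (\<Sum>i\<in>I. v i * cnj (w i))"

definition app_on :: "'i set \<Rightarrow> ('i \<Rightarrow> 'i \<Rightarrow> complex) \<Rightarrow> ('i \<Rightarrow> complex) \<Rightarrow> 'i \<Rightarrow> complex" where
  "app_on I a v = (\<lambda>i. \<Sum>k\<in>I. a i k * v k)"

definition psd_on :: "'i set \<Rightarrow> ('i \<Rightarrow> 'i \<Rightarrow> complex) \<Rightarrow> bool" where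
  "psd_on I a \<longleftrightarrow> (\<forall>i\<in>I. \<forall>k\<in>I. a k i = cnj (a i k)) \<and> (\<forall>v. 0 \<le> Re (inner_on I (app_on I a v) v))"

definition unit_at :: "'i \<Rightarrow> 'i \<Rightarrow> complex" where
  "unit_at k = (\<lambda>i. if i = k then 1 else 0)"

definition qpow :: "'i set \<Rightarrow> ('i \<Rightarrow> 'i \<Rightarrow> complex) \<Rightarrow> nat \<Rightarrow> ('i \<Rightarrow> complex) \<Rightarrow> real" where
  "qpow I a p v = Re (inner_on I ((app_on I a ^^ p) v) v)"

text \<open>The trace of the \<open>p\<close>-th power, kept as a sum of quadratic forms so that
  their positivity carries over.\<close>

definition trpow :: "'i set \<Rightarrow> ('i \<Rightarrow> 'i \<Rightarrow> complex) \<Rightarrow> nat \<Rightarrow> real" where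
  "trpow I a p = (\<Sum>k\<in>I. qpow I a p (unit_at k))"

definition rank_one_update ::
    "('i \<Rightarrow> 'i \<Rightarrow> complex) \<Rightarrow> ('i \<Rightarrow> complex) \<Rightarrow> 'i \<Rightarrow> 'i \<Rightarrow> complex" where
  "rank_one_update a u = (\<lambda>i k. a i k + u i * cnj (u k))"

lemma inner_on_add_left: "inner_on I (\<lambda>i. v i + w i) z = inner_on I v z + inner_on I w z"
  and inner_on_add_right: "inner_on I z (\<lambda>i. v i + w i) = inner_on I z v + inner_on I z w"
  and inner_on_scale_left: "inner_on I (\<lambda>i. c * v i) z = c * inner_on I v z"
  and inner_on_scale_right: "inner_on I z (\<lambda>i. c * v i) = cnj c * inner_on I z v"
  and inner_on_diff_left: "inner_on I (\<lambda>i. v i - w i) z = inner_on I v z - inner_on I w z"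
  and inner_on_diff_right: "inner_on I z (\<lambda>i. v i - w i) = inner_on I z v - inner_on I z w"
  by (simp_all add: inner_on_def sum.distrib algebra_simps sum_distrib_left sum_subtractf)

lemma inner_on_cnj: "inner_on I w v = cnj (inner_on I v w)"
  by (simp add: inner_on_def mult.commute)

lemma inner_on_self: "inner_on I v v = of_real (\<Sum>i\<in>I. (cmod (v i))\<^sup>2)"
  by (simp add: inner_on_def complex_norm_square del: of_real_power)

lemma inner_on_unit_left: "finite I \<Longrightarrow> k \<in> I \<Longrightarrow> inner_on I (unit_at k) v = cnj (v k)"
  and inner_on_unit_right: "finite I \<Longrightarrow> k \<in> I \<Longrightarrow> inner_on I v (unit_at k) = v k"
  by (simp_all add: inner_on_def unit_at_def if_distrib if_distribR cong: if_cong)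

lemma app_on_add: "app_on I a (\<lambda>i. v i + w i) = (\<lambda>i. app_on I a v i + app_on I a w i)"
  and app_on_scale: "app_on I a (\<lambda>i. c * v i) = (\<lambda>i. c * app_on I a v i)"
  by (auto simp: app_on_def sum.distrib algebra_simps sum_distrib_left)

lemma app_on_pow_add:
  "(app_on I a ^^ p) (\<lambda>i. v i + w i) = (\<lambda>i. (app_on I a ^^ p) v i + (app_on I a ^^ p) w i)"
  by (induction p) (simp_all add: app_on_add)

lemma app_on_pow_scale:
  "(app_on I a ^^ p) (\<lambda>i. c * v i) = (\<lambda>i. c * (app_on I a ^^ p) v i)"
  by (induction p) (simp_all add: app_on_scale)

lemma app_on_pow_diff:
  "(app_on I a ^^ p) (\<lambda>i. v i - w i) = (\<lambda>i. (app_on I a ^^ p) v i - (app_on I a ^^ p) w i)"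
  using app_on_pow_add[of p I a v "\<lambda>i. - 1 * w i"] app_on_pow_scale[of p I a "-1" w] by simp

lemma app_on_rank_one_update:
  "app_on I (rank_one_update a u) v = (\<lambda>i. app_on I a v i + inner_on I v u * u i)"
  by (auto simp: app_on_def rank_one_update_def inner_on_def sum.distrib algebra_simps
      sum_distrib_left)

lemma psd_on_hermitian: "psd_on I a \<Longrightarrow> i \<in> I \<Longrightarrow> k \<in> I \<Longrightarrow> cnj (a i k) = a k i"
  unfolding psd_on_def by metis

lemma psd_on_form_nonneg: "psd_on I a \<Longrightarrow> 0 \<le> Re (inner_on I (app_on I a v) v)"
  unfolding psd_on_def by metis

lemma inner_app_on:
  assumes "psd_on I a"
  shows "inner_on I (app_on I a v) w = inner_on I v (app_on I a w)"
proof -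
  have "inner_on I (app_on I a v) w = (\<Sum>i\<in>I. \<Sum>k\<in>I. a i k * v k * cnj (w i))"
    by (simp add: inner_on_def app_on_def sum_distrib_right)
  also have "\<dots> = (\<Sum>k\<in>I. \<Sum>i\<in>I. a i k * v k * cnj (w i))"
    by (rule sum.swap)
  also have "\<dots> = (\<Sum>k\<in>I. \<Sum>i\<in>I. v k * cnj (a k i * w i))"
    using psd_on_hermitian[OF assms] by (intro sum.cong refl) simp
  also have "\<dots> = inner_on I v (app_on I a w)"
    by (simp add: inner_on_def app_on_def sum_distrib_left)
  finally show ?thesis .
qed

lemma inner_app_on_pow:
  assumes "psd_on I a"
  shows "inner_on I ((app_on I a ^^ p) v) w = inner_on I v ((app_on I a ^^ p) w)"
proof (induction p arbitrary: w)
  case (Suc p)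
  then show ?case by (simp add: inner_app_on[OF assms] flip: funpow_swap1)
qed simp

lemma inner_app_on_pow_real:
  assumes "psd_on I a"
  shows "inner_on I ((app_on I a ^^ p) v) v = of_real (qpow I a p v)"
proof -
  have "cnj (inner_on I ((app_on I a ^^ p) v) v) = inner_on I ((app_on I a ^^ p) v) v"
    using inner_on_cnj[of I v] inner_app_on_pow[OF assms] by metis
  then show ?thesis unfolding qpow_def
    by (metis Reals_cnj_iff of_real_Re)
qed

lemma qpow_add:
  assumes "psd_on I a"
  shows "Re (inner_on I ((app_on I a ^^ p) v) ((app_on I a ^^ q) v)) = qpow I a (p + q) v"
proof -
  have "inner_on I ((app_on I a ^^ q) ((app_on I a ^^ p) v)) v =
        inner_on I ((app_on I a ^^ p) v) ((app_on I a ^^ q) v)"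
    by (rule inner_app_on_pow[OF assms])
  then show ?thesis by (simp add: qpow_def add.commute[of p] funpow_add)
qed

text \<open>For p = 2h the value is the squared norm of A^h v, for p = 2h + 1 it is the form of A at
  A^h v; this avoids a square root of A.\<close>

lemma qpow_nonneg:
  assumes "psd_on I a"
  shows "0 \<le> qpow I a p v"
proof -
  obtain h where h: "p = h + h \<or> p = Suc h + h"
    by (metis add_Suc even_Suc mult_2 evenE odd_two_times_div_two_nat Suc_pred odd_pos
        add.commute plus_1_eq_Suc oddE)
  then show ?thesis
  proof
    assume "p = h + h"
    then have "qpow I a p v = Re (inner_on I ((app_on I a ^^ h) v) ((app_on I a ^^ h) v))"
      by (simp add: qpow_add[OF assms])
    then show ?thesis by (simp add: inner_on_self sum_nonneg)
  next
    assume "p = Suc h + h"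
    then have "qpow I a p v = Re (inner_on I ((app_on I a ^^ Suc h) v) ((app_on I a ^^ h) v))"
      using qpow_add[OF assms] by metis
    then show ?thesis using psd_on_form_nonneg[OF assms] by simp
  qed
qed

text \<open>Cauchy-Schwarz for the semi-inner product given by A^k, applied to v and A v and proved
  by the discriminant of the form along x v + A v.\<close>

lemma qpow_log_convex:
  assumes "psd_on I a"
  shows "(qpow I a (Suc k) v)\<^sup>2 \<le> qpow I a k v * qpow I a (Suc (Suc k)) v"
proof -
  have quad: "qpow I a k (\<lambda>i. of_real x * v i + app_on I a v i) =
      qpow I a k v * x\<^sup>2 + 2 * qpow I a (Suc k) v * x + qpow I a (Suc (Suc k)) v" for x :: real
  proof -
    let ?p = "app_on I a ^^ k"
    have "inner_on I (?p (\<lambda>i. of_real x * v i + app_on I a v i)) (\<lambda>i. of_real x * v i + app_on I a v i) =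
       of_real x * (of_real x * inner_on I (?p v) v) + of_real x * inner_on I (?p v) (app_on I a v)
       + of_real x * inner_on I (?p (app_on I a v)) v + inner_on I (?p (app_on I a v)) (app_on I a v)"
      by (simp add: app_on_pow_add app_on_pow_scale inner_on_add_left inner_on_add_right
          inner_on_scale_left inner_on_scale_right algebra_simps)
    moreover have "Re (inner_on I (?p v) (app_on I a v)) = qpow I a (Suc k) v"
      using qpow_add[OF assms, of k v 1] by simp
    moreover have "Re (inner_on I (?p (app_on I a v)) v) = qpow I a (Suc k) v"
      by (simp add: qpow_def funpow_swap1)
    moreover have "Re (inner_on I (?p (app_on I a v)) (app_on I a v)) = qpow I a (Suc (Suc k)) v"
      using qpow_add[OF assms, of "Suc k" v 1] by (simp add: funpow_swap1)
    ultimately show ?thesis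
      by (simp add: qpow_def[of I a k] power2_eq_square algebra_simps)
  qed
  have nn: "0 \<le> qpow I a k v * x\<^sup>2 + 2 * qpow I a (Suc k) v * x + qpow I a (Suc (Suc k)) v" for x
    using quad[of x] qpow_nonneg[OF assms, of k] by metis
  show ?thesis using quadratic_nonneg_discrim[OF nn] .
qed

text \<open>Jensen's inequality for the spectral measure of A at the unit vector \<open>v\<close>,
  obtained from log-convexity in place of a spectral decomposition.\<close>

lemma qpow_one_power:
  assumes "psd_on I a" and "(\<Sum>i\<in>I. (cmod (v i))\<^sup>2) = 1"
  shows "qpow I a 1 v ^ p \<le> qpow I a p v"
proof -
  have "qpow I a 0 v = 1" using assms(2) by (simp add: qpow_def inner_on_self)
  then show ?thesis
    using log_convex_power[of "\<lambda>k. qpow I a k v" p] qpow_nonneg[OF assms(1)]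
      qpow_log_convex[OF assms(1)] by simp
qed

(* The trace minus the quadratic form at c is the sum of the nonnegative quadratic forms at
   the projections of the unit vectors onto the complement of c. *)
lemma qpow_le_trpow:
  assumes "finite I" "psd_on I a" and c: "(\<Sum>i\<in>I. (cmod (c i))\<^sup>2) = 1"
  shows "qpow I a p c \<le> trpow I a p"
proof -
  let ?p = "app_on I a ^^ p"
  let ?w = "\<lambda>k i. unit_at k i - cnj (c k) * c i"
  have *: "qpow I a p (?w k) = qpow I a p (unit_at k) - 2 * Re (cnj (c k) * ?p c k)
      + (cmod (c k))\<^sup>2 * qpow I a p c" if "k \<in> I" for k
  proof -
    have "inner_on I (?p (?w k)) (?w k) = inner_on I (?p (unit_at k)) (unit_at k)
      - cnj (c k) * inner_on I (?p c) (unit_at k) - c k * inner_on I (?p (unit_at k)) c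
      + (c k * cnj (c k)) * inner_on I (?p c) c"
      unfolding app_on_pow_diff app_on_pow_scale inner_on_diff_left inner_on_diff_right
          inner_on_scale_left inner_on_scale_right by (simp add: algebra_simps)
    moreover have "inner_on I (?p c) (unit_at k) = ?p c k"
      using assms that by (simp add: inner_on_unit_right)
    moreover have "inner_on I (?p (unit_at k)) c = cnj (?p c k)"
      using assms that by (simp add: inner_app_on_pow inner_on_unit_left)
    moreover have "c k * cnj (c k) = of_real ((cmod (c k))\<^sup>2)"
      by (simp add: complex_norm_square del: of_real_power)
    ultimately show ?thesis
      by (simp add: qpow_def del: of_real_power)
  qed
  have sumc: "(\<Sum>k\<in>I. Re (cnj (c k) * ?p c k)) = qpow I a p c"
    by (simp add: qpow_def inner_on_def mult.commute)
  have "0 \<le> (\<Sum>k\<in>I. qpow I a p (?w k))"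
    by (intro sum_nonneg qpow_nonneg assms)
  also have "\<dots> = (\<Sum>k\<in>I. qpow I a p (unit_at k) - 2 * Re (cnj (c k) * ?p c k)
      + (cmod (c k))\<^sup>2 * qpow I a p c)"
    by (intro sum.cong refl *)
  also have "\<dots> = trpow I a p - 2 * qpow I a p c + 1 * qpow I a p c"
    by (simp only: sum.distrib sum_subtractf sum_distrib_left[symmetric]
        sum_distrib_right[symmetric] sumc c trpow_def)
  finally show ?thesis by simp
qed

lemma trpow_nonneg: "psd_on I a \<Longrightarrow> 0 \<le> trpow I a p"
  by (simp add: trpow_def sum_nonneg qpow_nonneg)

section \<open>Rank-one updates: mixed moments and traces\<close>

lemma psd_on_rank_one_update:
  assumes "psd_on I a"
  shows "psd_on I (rank_one_update a u)"
  unfolding psd_on_def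
proof (intro conjI allI ballI)
  fix v
  have "inner_on I v u * inner_on I u v = of_real ((cmod (inner_on I v u))\<^sup>2)"
    using inner_on_cnj[of I u v] by (simp add: complex_norm_square del: of_real_power)
  then show "0 \<le> Re (inner_on I (app_on I (rank_one_update a u) v) v)"
    using psd_on_form_nonneg[OF assms]
    by (simp add: app_on_rank_one_update inner_on_add_left inner_on_scale_left del: of_real_power)
qed (simp add: rank_one_update_def psd_on_hermitian[OF assms])

text \<open>The old matrix A and the new matrix G do not commute. Exchanging the factors one at a
  time from the left produces only words A^j G^i; \<open>w\<close> is the form of such a word at
  \<open>u\<close>, and \<open>tau\<close> its trace, both by real parts.\<close>

context
  fixes I :: "'i set" and a u g w tau
  assumes I: "finite I" and psd: "psd_on I a"
  defines "g \<equiv> rank_one_update a u"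
  defines "w \<equiv> \<lambda>j i. Re (inner_on I ((app_on I a ^^ j) ((app_on I g ^^ i) u)) u)"
  defines "tau \<equiv> \<lambda>j p. (\<Sum>k\<in>I. Re ((app_on I a ^^ j) ((app_on I g ^^ p) (unit_at k)) k))"
begin

lemma w_0: "w j 0 = qpow I a j u" and w_qpow: "w 0 i = qpow I g i u"
  by (simp_all add: w_def qpow_def)

text \<open>Splits the leftmost factor G into A and the rank-one term. The real parts multiply
  because the moment of A^j at \<open>u\<close> is real.\<close>

lemma w_Suc: "w j (Suc i) = w (Suc j) i + qpow I a j u * w 0 i"
proof -
  have "inner_on I ((app_on I a ^^ j) ((app_on I g ^^ Suc i) u)) u =
      inner_on I ((app_on I a ^^ Suc j) ((app_on I g ^^ i) u)) u
      + inner_on I ((app_on I g ^^ i) u) u * inner_on I ((app_on I a ^^ j) u) u"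
    by (simp add: g_def app_on_rank_one_update app_on_pow_add app_on_pow_scale inner_on_add_left
        inner_on_scale_left flip: funpow_swap1)
  then show ?thesis
    by (simp add: w_def inner_app_on_pow_real[OF psd])
qed

lemma w_nonneg: "0 \<le> w j i"
  by (induction i arbitrary: j)
    (simp_all add: w_0 qpow_nonneg psd w_Suc)

lemma qpow_le_w: "qpow I a (j + i) u \<le> w j i"
proof (induction i arbitrary: j)
  case (Suc i)
  have "0 \<le> qpow I a j u * w 0 i" by (simp add: w_nonneg qpow_nonneg psd)
  then show ?case using Suc[of "Suc j"] by (simp add: w_Suc)
qed (simp add: w_0)

lemma w_le_qpow: "w j i \<le> qpow I g (j + i) u"
proof (induction j arbitrary: i)
  case (Suc j)
  have "0 \<le> qpow I a j u * w 0 i" by (simp add: w_nonneg qpow_nonneg psd)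
  then have "w (Suc j) i \<le> w j (Suc i)" by (simp add: w_Suc)
  then show ?case using Suc[of "Suc i"] by simp
qed (simp add: w_qpow)

text \<open>By \<open>w_Suc\<close>, \<open>w j i\<close> is a combination of moments of
  \<open>a\<close> at indices from \<open>j\<close> on, with nonnegative coefficients that do not
  depend on \<open>j\<close>. Supermultiplicativity of the moments therefore lifts term by
  term.\<close>

lemma qpow_times_w_le: "qpow I a c u * w j i \<le> qpow I a 0 u * w (j + c) i"
proof (induction i arbitrary: j)
  case 0
  show ?case using log_convex_supermult[of "\<lambda>k. qpow I a k u" c j]
    by (simp add: w_0 qpow_nonneg psd qpow_log_convex add.commute)
next
  case (Suc i)
  have "qpow I a c u * qpow I a j u \<le> qpow I a 0 u * qpow I a (j + c) u"
    using log_convex_supermult[of "\<lambda>k. qpow I a k u" c j]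
    by (simp add: qpow_nonneg psd qpow_log_convex add.commute)
  then have "qpow I a c u * qpow I a j u * w 0 i \<le> qpow I a 0 u * qpow I a (j + c) u * w 0 i"
    by (rule mult_right_mono) (rule w_nonneg)
  with Suc[of "Suc j"] show ?case by (simp add: w_Suc algebra_simps)
qed

text \<open>A binomial theorem in which the rank-one term acts like the scalar \<open>b\<close>, as
  if it commuted with A. \<open>qpow_times_w_le\<close> turns \<open>w_Suc\<close> into the
  recursion \<open>w j (Suc i) \<le> w (Suc j) i + b * w j i\<close>, and Pascal's rule solves
  it.\<close>

lemma w_le_binomial:
  assumes "qpow I a 0 u \<le> b"
  shows "w j i \<le> (\<Sum>k\<le>i. real (i choose k) * b ^ (i - k) * qpow I a (j + k) u)"
proof (induction i arbitrary: j)
  case (Suc i)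
  have b: "0 \<le> b" using assms qpow_nonneg[OF psd] by (meson order_trans)
  let ?f = "\<lambda>k. qpow I a (j + k) u"
  have "w j (Suc i) \<le> w (Suc j) i + b * w j i"
  proof -
    have "qpow I a j u * w 0 i \<le> qpow I a 0 u * w j i" using qpow_times_w_le[of j 0 i] by simp
    also have "\<dots> \<le> b * w j i" using assms w_nonneg by (rule mult_right_mono)
    finally show ?thesis by (simp add: w_Suc)
  qed
  also have "\<dots> \<le> (\<Sum>k\<le>i. real (i choose k) * b ^ (i - k) * ?f (Suc k))
      + b * (\<Sum>k\<le>i. real (i choose k) * b ^ (i - k) * ?f k)"
    using Suc[of "Suc j"] Suc[of j] b by (intro add_mono mult_left_mono) auto
  also have "\<dots> = (\<Sum>k\<le>Suc i. real (Suc i choose k) * b ^ (Suc i - k) * ?f k)"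
  proof -
    have "(\<Sum>k\<le>Suc i. real (Suc i choose k) * b ^ (Suc i - k) * ?f k)
      = b ^ Suc i * ?f 0 + (\<Sum>k\<le>i. real ((i choose k) + (i choose Suc k)) * b ^ (i - k) * ?f (Suc k))"
      by (subst sum.atMost_Suc_shift) (simp only: binomial_Suc_Suc diff_Suc_Suc binomial_n_0
          of_nat_1 mult_1 diff_zero)
    also have "\<dots> = (\<Sum>k\<le>i. real (i choose k) * b ^ (i - k) * ?f (Suc k))
       + (b ^ Suc i * ?f 0 + (\<Sum>k\<le>i. real (i choose Suc k) * b ^ (i - k) * ?f (Suc k)))"
      by (simp add: algebra_simps sum.distrib)
    also have "b ^ Suc i * ?f 0 + (\<Sum>k\<le>i. real (i choose Suc k) * b ^ (i - k) * ?f (Suc k))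
       = (\<Sum>k\<le>Suc i. real (i choose k) * b ^ (Suc i - k) * ?f k)"
      by (subst sum.atMost_Suc_shift) simp
    also have "\<dots> = b * (\<Sum>k\<le>i. real (i choose k) * b ^ (i - k) * ?f k)"
      by (simp add: sum_distrib_left Suc_diff_le algebra_simps)
    finally show ?thesis by simp
  qed
  finally show ?case .
qed (simp add: w_0)

text \<open>The rank-one part of the leftmost G contributes the inner product of A^j u with G^p u,
  whose real part is \<open>w j p\<close> because A^j is self-adjoint.\<close>

lemma tau_Suc: "tau j (Suc p) = tau (Suc j) p + w j p"
proof -
  let ?A = "app_on I a" and ?G = "app_on I g"
  have psdg: "psd_on I g" unfolding g_def by (rule psd_on_rank_one_update[OF psd])
  have "(?A ^^ j) ((?G ^^ Suc p) (unit_at k)) k =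
      (?A ^^ Suc j) ((?G ^^ p) (unit_at k)) k + cnj ((?G ^^ p) u k) * (?A ^^ j) u k" if "k \<in> I" for k
  proof -
    have "inner_on I ((?G ^^ p) (unit_at k)) u = cnj ((?G ^^ p) u k)"
      using I that by (simp add: inner_app_on_pow[OF psdg] inner_on_unit_left)
    then show ?thesis
      by (simp add: g_def app_on_rank_one_update app_on_pow_add app_on_pow_scale flip: funpow_swap1)
  qed
  then have "tau j (Suc p) = tau (Suc j) p + (\<Sum>k\<in>I. Re (cnj ((?G ^^ p) u k) * (?A ^^ j) u k))"
    by (simp add: tau_def sum.distrib)
  also have "(\<Sum>k\<in>I. Re (cnj ((?G ^^ p) u k) * (?A ^^ j) u k)) = Re (inner_on I ((?A ^^ j) u) ((?G ^^ p) u))"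
    by (simp add: inner_on_def mult.commute)
  also have "\<dots> = w j p"
    using inner_on_cnj[of I "(?G ^^ p) u" "(?A ^^ j) u"] inner_app_on_pow[OF psd, of j "(?G ^^ p) u" u]
    by (simp add: w_def)
  finally show ?thesis .
qed

text \<open>Telescopes \<open>tau_Suc\<close>: each of the \<open>p\<close> exchanges adds a mixed
  moment of total degree \<open>j + p - 1\<close>, which lies between the pure moments of
  \<open>a\<close> and of \<open>g\<close> of that degree. For \<open>p = 0\<close> the truncated
  subtraction is multiplied by 0.\<close>

lemma tau_lower: "tau (j + p) 0 + real p * qpow I a (j + p - 1) u \<le> tau j p"
proof (induction p arbitrary: j)
  case (Suc p)
  show ?case using Suc[of "Suc j"] qpow_le_w[of j p]
    by (simp add: tau_Suc distrib_right)
qed simp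

lemma tau_upper: "tau j p \<le> tau (j + p) 0 + real p * qpow I g (j + p - 1) u"
proof (induction p arbitrary: j)
  case (Suc p)
  show ?case using Suc[of "Suc j"] w_le_qpow[of j p]
    by (simp add: tau_Suc distrib_right)
qed simp

lemma trpow_rank_one_update_bounds:
  "trpow I a p + real p * qpow I a (p - 1) u \<le> trpow I (rank_one_update a u) p"
  "trpow I (rank_one_update a u) p \<le> trpow I a p + real p * qpow I (rank_one_update a u) (p - 1) u"
proof -
  have "tau p 0 = trpow I a p" "tau 0 p = trpow I g p"
    using I by (simp_all add: tau_def trpow_def qpow_def inner_on_unit_right)
  then show "trpow I a p + real p * qpow I a (p - 1) u \<le> trpow I (rank_one_update a u) p"
    "trpow I (rank_one_update a u) p \<le> trpow I a p + real p * qpow I (rank_one_update a u) (p - 1) u"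
    using tau_lower[of 0 p] tau_upper[of 0 p] by (simp_all add: g_def)
qed

lemma qpow_rank_one_update_le:
  assumes "qpow I a 0 u \<le> b"
  shows "qpow I (rank_one_update a u) p u
    \<le> (\<Sum>k\<le>p. real (p choose k) * b ^ (p - k) * qpow I a k u)"
  using w_le_binomial[OF assms, of 0 p] by (simp add: w_qpow g_def)

end

section \<open>Truncated exponential moments\<close>

definition exp_qpow :: "'i set \<Rightarrow> real \<Rightarrow> nat \<Rightarrow> ('i \<Rightarrow> 'i \<Rightarrow> complex) \<Rightarrow> ('i \<Rightarrow> complex) \<Rightarrow> real" where
  "exp_qpow I t q a u = (\<Sum>p\<le>q. t ^ p / fact p * qpow I a p u)"

definition exp_tr :: "'i set \<Rightarrow> real \<Rightarrow> nat \<Rightarrow> ('i \<Rightarrow> 'i \<Rightarrow> complex) \<Rightarrow> real" where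
  "exp_tr I t q a = (\<Sum>p\<le>q. t ^ p / fact p * trpow I a p)"

lemma exp_partial_sum_le:
  fixes x :: real
  assumes "0 \<le> x"
  shows "(\<Sum>l\<le>n. x ^ l / fact l) \<le> exp x"
proof -
  have "(\<lambda>n. x ^ n / fact n) sums exp x"
    using exp_converges[of x] by (simp add: divide_inverse mult.commute)
  then show ?thesis
    using assms by (metis (no_types, lifting) sums_summable sums_unique sum_le_suminf finite_atMost
        divide_nonneg_pos fact_gt_zero zero_le_power)
qed

text \<open>The binomial bound makes the double sum a Cauchy product of the truncated series of A
  with that of \<open>exp (t * b)\<close>. The truncation p = k + l <= q only drops nonnegative
  terms.\<close>

lemma exp_qpow_rank_one_update_le:
  assumes I: "finite I" "psd_on I a" and t: "0 \<le> t" and b: "qpow I a 0 u \<le> b"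
  shows "exp_qpow I t q (rank_one_update a u) u \<le> exp (t * b) * exp_qpow I t q a u"
proof -
  have b0: "0 \<le> b" using b qpow_nonneg[OF I(2)] by (meson order_trans)
  let ?f = "\<lambda>k. qpow I a k u"
  have "exp_qpow I t q (rank_one_update a u) u
      \<le> (\<Sum>p\<le>q. t ^ p / fact p * (\<Sum>k\<le>p. real (p choose k) * b ^ (p - k) * ?f k))"
    unfolding exp_qpow_def using t
    by (intro sum_mono mult_left_mono qpow_rank_one_update_le I b) auto
  also have "\<dots> = (\<Sum>p\<le>q. \<Sum>k\<le>p. (t ^ k / fact k * ?f k) * ((t * b) ^ (p - k) / fact (p - k)))"
    by (auto simp: sum_distrib_left binomial_fact power_mult_distrib power_add[symmetric]
        intro!: sum.cong)
  also have "\<dots> = (\<Sum>(p,k)\<in>(SIGMA p:{..q}. {..p}). (t ^ k / fact k * ?f k) * ((t * b) ^ (p - k) / fact (p - k)))"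
    by (simp add: sum.Sigma)
  also have "\<dots> = (\<Sum>(k,l)\<in>(SIGMA k:{..q}. {..q-k}). (t ^ k / fact k * ?f k) * ((t * b) ^ l / fact l))"
    by (rule sum.reindex_bij_witness[of _ "\<lambda>(k,l). (k+l,k)" "\<lambda>(p,k). (k,p-k)"]) auto
  also have "\<dots> = (\<Sum>k\<le>q. (t ^ k / fact k * ?f k) * (\<Sum>l\<le>q-k. (t * b) ^ l / fact l))"
    by (simp add: sum.Sigma sum_distrib_left)
  also have "\<dots> \<le> (\<Sum>k\<le>q. (t ^ k / fact k * ?f k) * exp (t * b))"
    using t b0 by (intro sum_mono mult_left_mono exp_partial_sum_le mult_nonneg_nonneg qpow_nonneg I) auto
  also have "\<dots> = exp (t * b) * exp_qpow I t q a u"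
    by (simp add: exp_qpow_def sum_distrib_left mult.commute)
  finally show ?thesis .
qed

text \<open>The factor \<open>p\<close> from differentiating the trace of a \<open>p\<close>-th
  power lowers the factorial. This is why traces truncated at \<open>Suc q\<close> are paired with
  forms truncated at \<open>q\<close>.\<close>

lemma exp_tr_shift: "(\<Sum>p\<le>Suc q. t ^ p / fact p * (real p * f (p - 1))) =
   t * (\<Sum>p\<le>q. t ^ p / fact p * (f p :: real))" for t :: real
proof -
  have "(\<Sum>p\<le>Suc q. t ^ p / fact p * (real p * f (p - 1))) =
     (\<Sum>p\<le>q. t ^ Suc p / fact (Suc p) * (real (Suc p) * f p))"
    by (subst sum.atMost_Suc_shift) simp
  also have "\<dots> = (\<Sum>p\<le>q. t * (t ^ p / fact p * f p))"
  proof (intro sum.cong refl)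
    fix p
    have "real (Suc p) \<noteq> 0" by simp
    then show "t ^ Suc p / fact (Suc p) * (real (Suc p) * f p) = t * (t ^ p / fact p * f p)"
      unfolding fact_Suc of_nat_mult power_Suc by (simp add: field_simps del: of_nat_Suc)
  qed
  finally show ?thesis by (simp add: sum_distrib_left)
qed

text \<open>The form on the right is taken at the old matrix, so that it can be averaged over an
  independent new vector \<open>u\<close>.\<close>

lemma exp_tr_rank_one_update_upper:
  assumes I: "finite I" "psd_on I a" and t: "0 \<le> t" and b: "(\<Sum>i\<in>I. (cmod (u i))\<^sup>2) \<le> b"
  shows "exp_tr I t (Suc q) (rank_one_update a u)
    \<le> exp_tr I t (Suc q) a + t * exp (t * b) * exp_qpow I t q a u"
proof -
  let ?g = "rank_one_update a u"
  have "exp_tr I t (Suc q) ?g \<le> (\<Sum>p\<le>Suc q. t ^ p / fact p * (trpow I a p + real p * qpow I ?g (p - 1) u))"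
    unfolding exp_tr_def using t
    by (intro sum_mono mult_left_mono trpow_rank_one_update_bounds I) auto
  also have "\<dots> = exp_tr I t (Suc q) a + (\<Sum>p\<le>Suc q. t ^ p / fact p * (real p * qpow I ?g (p - 1) u))"
    unfolding exp_tr_def distrib_left sum.distrib by simp
  also have "\<dots> = exp_tr I t (Suc q) a + t * exp_qpow I t q ?g u"
    unfolding exp_qpow_def by (subst exp_tr_shift) simp
  also have "\<dots> \<le> exp_tr I t (Suc q) a + t * (exp (t * b) * exp_qpow I t q a u)"
    using t b by (intro add_left_mono mult_left_mono exp_qpow_rank_one_update_le I)
      (auto simp: qpow_def inner_on_self)
  finally show ?thesis by simp
qed

text \<open>Here the form is taken at the updated matrix. In the lower tail bound \<open>a\<close>
  is the matrix after a new sample and \<open>rank_one_update a u\<close> the one before it, so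
  again the form is at a matrix independent of \<open>u\<close>.\<close>

lemma exp_tr_rank_one_update_lower:
  assumes I: "finite I" "psd_on I a" and t: "0 \<le> t" and b: "(\<Sum>i\<in>I. (cmod (u i))\<^sup>2) \<le> b"
  shows "exp_tr I t (Suc q) a + t * exp (- (t * b)) * exp_qpow I t q (rank_one_update a u) u
    \<le> exp_tr I t (Suc q) (rank_one_update a u)"
proof -
  let ?g = "rank_one_update a u"
  have "exp (- (t * b)) * exp_qpow I t q ?g u \<le> exp (- (t * b)) * (exp (t * b) * exp_qpow I t q a u)"
    using t b by (intro mult_left_mono exp_qpow_rank_one_update_le I)
      (auto simp: qpow_def inner_on_self)
  also have "\<dots> = exp_qpow I t q a u" by (simp add: exp_minus)
  finally have "exp_tr I t (Suc q) a + t * (exp (- (t * b)) * exp_qpow I t q ?g u)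
      \<le> exp_tr I t (Suc q) a + t * exp_qpow I t q a u"
    using t by (intro add_left_mono mult_left_mono)
  also have "\<dots> = (\<Sum>p\<le>Suc q. t ^ p / fact p * (trpow I a p + real p * qpow I a (p - 1) u))"
    unfolding exp_tr_def exp_qpow_def distrib_left sum.distrib by (subst exp_tr_shift) simp
  also have "\<dots> \<le> exp_tr I t (Suc q) ?g"
    unfolding exp_tr_def using t
    by (intro sum_mono mult_left_mono trpow_rank_one_update_bounds I) auto
  finally show ?thesis by simp
qed

text \<open>Kept termwise because the lower tail sums all degrees, while the upper tail leaves out
  degree 0.\<close>

lemma exp_tr_term_ge:
  assumes I: "finite I" "psd_on I a" and t: "0 \<le> t" and c: "(\<Sum>i\<in>I. (cmod (c i))\<^sup>2) = 1"
    and s: "0 \<le> s" "s \<le> qpow I a 1 c"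
  shows "(t * s) ^ p / fact p \<le> t ^ p / fact p * trpow I a p"
proof -
  have "s ^ p \<le> qpow I a 1 c ^ p" using s by (intro power_mono)
  also have "\<dots> \<le> qpow I a p c" by (rule qpow_one_power[OF I(2) c])
  also have "\<dots> \<le> trpow I a p" by (rule qpow_le_trpow[OF I c])
  finally have "t ^ p / fact p * s ^ p \<le> t ^ p / fact p * trpow I a p"
    using t by (intro mult_left_mono) auto
  then show ?thesis by (simp add: power_mult_distrib)
qed

lemma exp_tr_ge:
  assumes "finite I" "psd_on I a" "0 \<le> t" "(\<Sum>i\<in>I. (cmod (c i))\<^sup>2) = 1" "0 \<le> s" "s \<le> qpow I a 1 c"
  shows "(\<Sum>p\<le>q. (t * s) ^ p / fact p) \<le> exp_tr I t q a"
  unfolding exp_tr_def by (intro sum_mono exp_tr_term_ge[OF assms])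

section \<open>Hilbert space geometry and the Riesz representation\<close>

text \<open>Three forms use this: the inner product of \<open>H\<close>, the possibly degenerate L2
  form on \<open>H\<close>, and the difference of a multiple of the former and the latter on the
  complement of the eigenvectors.\<close>

lemma psd_form_cauchy_schwarz:
  fixes B :: "('a \<Rightarrow> complex) \<Rightarrow> ('a \<Rightarrow> complex) \<Rightarrow> complex"
  assumes V: "cfun.subspace V"
    and add: "\<And>f g h. f \<in> V \<Longrightarrow> g \<in> V \<Longrightarrow> h \<in> V \<Longrightarrow> B (f + g) h = B f h + B g h"
    and scale: "\<And>c f g. f \<in> V \<Longrightarrow> g \<in> V \<Longrightarrow> B (fscale c f) g = c * B f g"
    and herm: "\<And>f g. f \<in> V \<Longrightarrow> g \<in> V \<Longrightarrow> B g f = cnj (B f g)"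
    and nonneg: "\<And>f. f \<in> V \<Longrightarrow> 0 \<le> Re (B f f)"
    and f: "f \<in> V" and g: "g \<in> V"
  shows "(cmod (B f g))\<^sup>2 \<le> Re (B f f) * Re (B g g)"
proof -
  \<comment> \<open>Scaling \<open>f\<close> by the conjugate of \<open>B f g\<close> makes the
    cross term real. It also puts an extra factor \<open>?s\<close> on both sides of the
    discriminant inequality, which is cancelled at the end.\<close>
  let ?s = "(cmod (B f g))\<^sup>2" and ?c = "cnj (B f g)"
  have mem: "fscale c f \<in> V" for c using V f by (rule cfun.subspace_scale)
  have expand: "0 \<le> (?s * Re (B f f)) * x\<^sup>2 + 2 * ?s * x + Re (B g g)" for x :: real
  proof -
    let ?w = "fscale (of_real x * ?c) f"
    have w: "?w \<in> V" by (rule mem)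
    have wg: "?w + g \<in> V" using V w g by (rule cfun.subspace_add)
    have 1: "B ?w h = of_real x * ?c * B f h" if "h \<in> V" for h using scale[OF f that] by simp
    have 2: "B f ?w = cnj (of_real x * ?c * B f f)" using herm[OF w f] 1[OF f] by simp
    have 3: "B g ?w = cnj (of_real x * ?c * B f g)" using herm[OF w g] 1[OF g] by simp
    have ff: "B f f = of_real (Re (B f f))" using herm[OF f f]
      by (metis Reals_cnj_iff of_real_Re)
    have s: "?c * B f g = of_real ?s"
      by (subst complex_norm_square) (simp add: mult.commute)
    have "B ?w (?w + g) = cnj (B ?w ?w + B g ?w)" "B g (?w + g) = cnj (B ?w g + B g g)"
      using herm[OF wg w] herm[OF wg g] add[OF w g w] add[OF w g g] by auto
    then have "B (?w + g) (?w + g) = cnj (B ?w ?w + B g ?w) + cnj (B ?w g + B g g)"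
      using add[OF w g wg] by simp
    moreover have "B ?w ?w = of_real (x\<^sup>2 * Re (B f f)) * (?c * B f g)"
      unfolding 1[OF w] 2 by (subst ff) (simp add: power2_eq_square)
    moreover have "B g ?w = cnj (of_real x * (?c * B f g))" using 3 by (simp add: mult.assoc)
    moreover have "B ?w g = of_real x * (?c * B f g)" using 1[OF g] by (simp add: mult.assoc)
    ultimately have "Re (B (?w + g) (?w + g)) = (?s * Re (B f f)) * x\<^sup>2 + 2 * ?s * x + Re (B g g)"
      unfolding s by (simp add: algebra_simps del: of_real_power)
    then show ?thesis using nonneg[OF wg] by simp
  qed
  have "?s * ?s \<le> ?s * (Re (B f f) * Re (B g g))"
    using quadratic_nonneg_discrim[OF expand] by (simp add: power2_eq_square mult.assoc)
  then show ?thesis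
  proof (cases "?s = 0")
    case True
    then show ?thesis using nonneg[OF f] nonneg[OF g] by (simp only: mult_nonneg_nonneg)
  next
    case False
    then have "?s > 0" by simp
    then show ?thesis using \<open>?s * ?s \<le> _\<close> by (simp only: mult_le_cancel_left_pos)
  qed
qed

lemma sum_fscale_apply: "(\<Sum>i\<in>J. fscale (c i) (g i)) x = (\<Sum>i\<in>J. c i * g i x)"
  by (induction J rule: infinite_finite_induct) (simp_all add: fscale_def)

context rkhs
begin

abbreviation nsq :: "('a \<Rightarrow> complex) \<Rightarrow> real" where "nsq f \<equiv> Re (ip f f)"

lemma H_zero [simp]: "0 \<in> H" using subspace_H by (rule cfun.subspace_0)
lemma H_add [simp]: "f \<in> H \<Longrightarrow> g \<in> H \<Longrightarrow> f + g \<in> H" using subspace_H by (rule cfun.subspace_add)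
lemma H_diff [simp]: "f \<in> H \<Longrightarrow> g \<in> H \<Longrightarrow> f - g \<in> H" using subspace_H by (rule cfun.subspace_diff)
lemma H_scale [simp]: "f \<in> H \<Longrightarrow> fscale c f \<in> H" using subspace_H by (rule cfun.subspace_scale)
lemma H_sum [simp]: "(\<And>i. i \<in> A \<Longrightarrow> F i \<in> H) \<Longrightarrow> sum F A \<in> H"
  using subspace_H by (rule cfun.subspace_sum)

lemma ip_zero_left [simp]: "g \<in> H \<Longrightarrow> ip 0 g = 0"
  using ip_add[of 0 0 g] by simp

lemma ip_diff: "f \<in> H \<Longrightarrow> g \<in> H \<Longrightarrow> h \<in> H \<Longrightarrow> ip (f - g) h = ip f h - ip g h"
  using ip_add[of "f - g" g h] by simp

lemma ip_sum: "(\<And>i. i \<in> A \<Longrightarrow> F i \<in> H) \<Longrightarrow> h \<in> H \<Longrightarrow> ip (sum F A) h = (\<Sum>i\<in>A. ip (F i) h)"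
  by (induction A rule: infinite_finite_induct) (simp_all add: ip_add)

lemma ip_add_right: "f \<in> H \<Longrightarrow> g \<in> H \<Longrightarrow> h \<in> H \<Longrightarrow> ip h (f + g) = ip h f + ip h g"
  using ip_add[of f g h] by (simp add: ip_cnj[of _ h])

lemma ip_diff_right: "f \<in> H \<Longrightarrow> g \<in> H \<Longrightarrow> h \<in> H \<Longrightarrow> ip h (f - g) = ip h f - ip h g"
  using ip_diff[of f g h] by (simp add: ip_cnj[of _ h])

lemma ip_scale_right: "f \<in> H \<Longrightarrow> h \<in> H \<Longrightarrow> ip h (fscale c f) = cnj c * ip h f"
  using ip_scale[of f h c] by (simp add: ip_cnj[of _ h])

lemma ip_sum_right: "(\<And>i. i \<in> A \<Longrightarrow> F i \<in> H) \<Longrightarrow> h \<in> H \<Longrightarrow> ip h (sum F A) = (\<Sum>i\<in>A. ip h (F i))"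
  using ip_sum[of A F h] by (simp add: ip_cnj[of _ h])

lemma ip_self: "f \<in> H \<Longrightarrow> ip f f = of_real (nsq f)"
  using ip_cnj[of f f] by (metis Reals_cnj_iff of_real_Re)

lemma nsq_eq_0_iff: "f \<in> H \<Longrightarrow> nsq f = 0 \<longleftrightarrow> f = 0"
  using ip_self[of f] ip_definite[of f] by auto

lemma nsq_add: "f \<in> H \<Longrightarrow> g \<in> H \<Longrightarrow> nsq (f + g) = nsq f + 2 * Re (ip f g) + nsq g"
  using ip_cnj[of f g] by (simp add: ip_add ip_add_right)

lemma nsq_diff: "f \<in> H \<Longrightarrow> g \<in> H \<Longrightarrow> nsq (f - g) = nsq f - 2 * Re (ip f g) + nsq g"
  using ip_cnj[of f g] by (simp add: ip_diff ip_diff_right)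

lemma nsq_scale: "f \<in> H \<Longrightarrow> nsq (fscale c f) = (cmod c)\<^sup>2 * nsq f"
proof -
  assume f: "f \<in> H"
  have "ip (fscale c f) (fscale c f) = (c * cnj c) * ip f f"
    using f by (simp add: ip_scale ip_scale_right)
  also have "\<dots> = of_real ((cmod c)\<^sup>2 * nsq f)"
    using ip_self[OF f] by (simp only: complex_norm_square of_real_mult)
  finally show ?thesis by simp
qed

lemma hnorm_sq: "f \<in> H \<Longrightarrow> (hnorm ip f)\<^sup>2 = nsq f"
  by (simp add: hnorm_def ip_nonneg)

lemma hnorm_nonneg: "f \<in> H \<Longrightarrow> 0 \<le> hnorm ip f"
  by (simp add: hnorm_def ip_nonneg)

lemma hnorm_le_1_iff: "hnorm ip f \<le> 1 \<longleftrightarrow> nsq f \<le> 1"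
  by (simp add: hnorm_def real_sqrt_le_1_iff)

lemma hnorm_minus_commute: "f \<in> H \<Longrightarrow> g \<in> H \<Longrightarrow> hnorm ip (f - g) = hnorm ip (g - f)"
  using nsq_diff[of f g] nsq_diff[of g f] ip_cnj[of f g] by (simp add: hnorm_def)

lemma nsq_normalize:
  assumes "f \<in> H" "0 < nsq f"
  shows "nsq (fscale (of_real (1 / sqrt (nsq f))) f) = 1"
proof -
  have "nsq (fscale (of_real (1 / sqrt (nsq f))) f) = (1 / sqrt (nsq f))\<^sup>2 * nsq f"
    by (subst nsq_scale[OF assms(1)]) (simp only: norm_of_real power2_abs)
  then show ?thesis using assms(2) by (simp add: power_divide)
qed

lemma ip_cauchy_schwarz: "f \<in> H \<Longrightarrow> g \<in> H \<Longrightarrow> (cmod (ip f g))\<^sup>2 \<le> nsq f * nsq g"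
  by (rule psd_form_cauchy_schwarz[OF subspace_H ip_add ip_scale ip_cnj ip_nonneg])

lemma cmod_ip_le: "f \<in> H \<Longrightarrow> g \<in> H \<Longrightarrow> cmod (ip f g) \<le> hnorm ip f * hnorm ip g"
proof -
  assume fg: "f \<in> H" "g \<in> H"
  have "(cmod (ip f g))\<^sup>2 \<le> (hnorm ip f * hnorm ip g)\<^sup>2"
    unfolding power_mult_distrib hnorm_sq[OF fg(1)] hnorm_sq[OF fg(2)] by (rule ip_cauchy_schwarz[OF fg])
  then show ?thesis by (rule power2_le_imp_le) (simp add: fg hnorm_nonneg)
qed

lemma hnorm_triangle: "f \<in> H \<Longrightarrow> g \<in> H \<Longrightarrow> hnorm ip (f + g) \<le> hnorm ip f + hnorm ip g"
proof -
  assume fg: "f \<in> H" "g \<in> H"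
  have "(hnorm ip (f + g))\<^sup>2 \<le> (hnorm ip f + hnorm ip g)\<^sup>2"
    using fg cmod_ip_le[of f g] complex_Re_le_cmod[of "ip f g"]
    by (simp add: hnorm_sq nsq_add power2_sum)
  then show ?thesis
    using fg hnorm_nonneg by (meson add_nonneg_nonneg power2_le_imp_le)
qed

lemma section_mem [simp]: "x \<in> D \<Longrightarrow> kernel_section D K x \<in> H"
  by (rule section_in)

lemma nsq_section: "x \<in> D \<Longrightarrow> nsq (kernel_section D K x) = Re (K x x)"
proof -
  assume "x \<in> D"
  then have "ip (kernel_section D K x) (kernel_section D K x) = kernel_section D K x x"
    by (simp add: reproducing)
  then show ?thesis using \<open>x \<in> D\<close> by (simp add: kernel_section_def)
qed

lemma kernel_diag_nonneg: "x \<in> D \<Longrightarrow> 0 \<le> Re (K x x)"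
  using nsq_section ip_nonneg section_mem by metis

lemma eval_bound: "f \<in> H \<Longrightarrow> x \<in> D \<Longrightarrow> (cmod (f x))\<^sup>2 \<le> nsq f * Re (K x x)"
  using ip_cauchy_schwarz[of f "kernel_section D K x"] by (simp add: reproducing nsq_section)

lemma convergent_seq_ip:
  assumes "\<And>n. F n \<in> H" "f \<in> H" "(\<lambda>n. hnorm ip (F n - f)) \<longlonglongrightarrow> 0" "g \<in> H"
  shows "(\<lambda>n. ip g (F n)) \<longlonglongrightarrow> ip g f"
proof -
  have "(\<lambda>n. ip g (F n) - ip g f) \<longlonglongrightarrow> 0"
  proof (rule tendsto_0_le[OF assms(3)])
    show "\<forall>\<^sub>F n in sequentially. norm (ip g (F n) - ip g f) \<le> norm (hnorm ip (F n - f)) * hnorm ip g"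
      using cmod_ip_le[of g "F _ - f"] assms hnorm_nonneg
      by (intro always_eventually allI) (simp add: ip_diff_right[symmetric] mult.commute)
  qed
  then show ?thesis by (rule LIM_zero_cancel)
qed

lemma convergent_seq_ip_left:
  assumes "\<And>n. F n \<in> H" "f \<in> H" "(\<lambda>n. hnorm ip (F n - f)) \<longlonglongrightarrow> 0" "g \<in> H"
  shows "(\<lambda>n. ip (F n) g) \<longlonglongrightarrow> ip f g"
  using tendsto_cnj[OF convergent_seq_ip[OF assms]] assms by (simp flip: ip_cnj)

text \<open>Minimizes \<open>nsq f - 2 * Re (\<phi> f)\<close>. The parallelogram law makes a
  minimizing sequence Cauchy, and the first variation at its limit \<open>h\<close> is the
  representation formula.\<close>

theorem riesz_representation:
  assumes add: "\<And>f g. f \<in> H \<Longrightarrow> g \<in> H \<Longrightarrow> \<phi> (f + g) = \<phi> f + \<phi> g"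
    and scale: "\<And>c f. f \<in> H \<Longrightarrow> \<phi> (fscale c f) = c * \<phi> f"
    and bound: "\<And>f. f \<in> H \<Longrightarrow> (cmod (\<phi> f))\<^sup>2 \<le> C * nsq f"
  shows "\<exists>h\<in>H. \<forall>g\<in>H. ip g h = \<phi> g"
proof -
  define J where "J f = nsq f - 2 * Re (\<phi> f)" for f
  have C0: "0 \<le> C * nsq f" if "f \<in> H" for f using bound[OF that] by (meson order_trans zero_le_power2)
  have lower: "- \<bar>C\<bar> \<le> J f" if f: "f \<in> H" for f
  proof -
    have "(Re (\<phi> f))\<^sup>2 \<le> C * nsq f"
      using bound[OF f] zero_le_power2[of "Im (\<phi> f)"] unfolding cmod_power2 by linarith
    also have "\<dots> \<le> \<bar>C\<bar> * nsq f" using ip_nonneg[OF f] by (intro mult_right_mono) auto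
    also have "\<dots> \<le> ((\<bar>C\<bar> + nsq f) / 2)\<^sup>2"
    proof -
      have "4 * (\<bar>C\<bar> * nsq f) \<le> (\<bar>C\<bar> + nsq f)\<^sup>2"
        using zero_le_power2[of "\<bar>C\<bar> - nsq f"] unfolding power2_sum power2_diff by linarith
      then show ?thesis by (simp add: power_divide)
    qed
    finally have "\<bar>Re (\<phi> f)\<bar> \<le> (\<bar>C\<bar> + nsq f) / 2"
      using ip_nonneg[OF f] by (metis abs_le_square_iff abs_of_nonneg abs_ge_zero add_nonneg_nonneg
          divide_nonneg_nonneg zero_le_numeral)
    then have "Re (\<phi> f) \<le> (\<bar>C\<bar> + nsq f) / 2" by (rule abs_le_D1)
    then show ?thesis unfolding J_def by (simp add: field_simps)
  qed
  define d where "d = Inf (J ` H)"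
  have bdd: "bdd_below (J ` H)" using lower by (auto intro!: bdd_belowI)
  have dle: "d \<le> J f" if "f \<in> H" for f unfolding d_def using that bdd by (auto intro: cInf_lower)
  have "\<exists>f\<in>H. J f < d + 1 / real (Suc n)" for n
  proof (rule ccontr)
    assume "\<not> ?thesis"
    then have "d + 1 / real (Suc n) \<le> Inf (J ` H)" using H_zero by (intro cInf_greatest) force+
    then show False unfolding d_def[symmetric] by (simp add: divide_simps)
  qed
  then obtain F where F: "\<And>n. F n \<in> H" and Fd: "\<And>n. J (F n) < d + 1 / real (Suc n)" by metis
  have par: "nsq (f - g) \<le> 2 * (J f - d) + 2 * (J g - d)" if fg: "f \<in> H" "g \<in> H" for f g
  proof -
    let ?h = "fscale (1/2) (f + g)"
    have "Re (\<phi> ?h) = (Re (\<phi> f) + Re (\<phi> g)) / 2"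
    proof -
      have "\<phi> ?h = (\<phi> f + \<phi> g) / 2" using scale[of "f + g" "1/2"] add[OF fg] fg by simp
      then show ?thesis by (simp only: Re_divide_numeral plus_complex.sel)
    qed
    moreover have "nsq ?h = nsq (f + g) / 4" using fg by (simp only: nsq_scale H_add) (simp add: power2_eq_square)
    ultimately show ?thesis
      using dle[of ?h] fg nsq_add[OF fg] nsq_diff[OF fg] by (simp add: J_def)
  qed
  have "\<exists>f\<in>H. (\<lambda>n. hnorm ip (F n - f)) \<longlonglongrightarrow> 0"
  proof (rule complete[OF F])
    fix \<epsilon> :: real assume e: "\<epsilon> > 0"
    obtain N where N: "1 / real (Suc N) < \<epsilon>\<^sup>2 / 4"
      using e by (metis nat_approx_posE divide_pos_pos zero_less_numeral zero_less_power)
    have "hnorm ip (F i - F j) < \<epsilon>" if "i \<ge> N" "j \<ge> N" for i j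
    proof -
      have "1 / real (Suc i) \<le> 1 / real (Suc N)" "1 / real (Suc j) \<le> 1 / real (Suc N)"
        using that by (simp_all add: frac_le)
      then have "nsq (F i - F j) < \<epsilon>\<^sup>2"
        using par[OF F[of i] F[of j]] Fd[of i] Fd[of j] N by argo
      then show ?thesis using e unfolding hnorm_def by (simp add: real_less_lsqrt)
    qed
    then show "\<exists>N. \<forall>i\<ge>N. \<forall>j\<ge>N. hnorm ip (F i - F j) < \<epsilon>" by blast
  qed
  then obtain h where h: "h \<in> H" "(\<lambda>n. hnorm ip (F n - h)) \<longlonglongrightarrow> 0" by blast
  have "ip g h = \<phi> g" if g: "g \<in> H" for g
  proof -
    \<comment> \<open>This factor turns the first variation in direction \<open>g\<close> into a
      squared modulus. The variation is carried out along \<open>F n\<close>, where the infimum is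
      missed by less than \<open>1 / Suc n\<close>, and only inner products pass to the
      limit.\<close>
    define c where "c = cnj (ip g h - \<phi> g)"
    let ?w = "\<lambda>x::real. fscale (of_real x * c) g"
    have step: "0 \<le> (nsq (fscale c g)) * x\<^sup>2 + 2 * Re (c * (ip g h - \<phi> g)) * x + 0" for x :: real
    proof -
      have *: "J (F n + ?w x) = J (F n) + nsq (fscale c g) * x\<^sup>2 + 2 * Re (c * (ip g (F n) - \<phi> g)) * x" for n
      proof -
        have "Re (ip (F n) (?w x)) = x * Re (c * ip g (F n))"
        proof -
          have "ip (F n) (?w x) = cnj (ip (?w x) (F n))" using F g by (intro ip_cnj) auto
          then show ?thesis using F g by (simp add: ip_scale algebra_simps)
        qed
        moreover have "Re (\<phi> (?w x)) = x * Re (c * \<phi> g)" using g by (simp add: scale algebra_simps)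
        moreover have "nsq (?w x) = x\<^sup>2 * nsq (fscale c g)"
          using g by (simp only: nsq_scale norm_mult norm_of_real power_mult_distrib power2_abs mult.assoc)
        ultimately show ?thesis
          using F g by (simp add: J_def nsq_add add algebra_simps del: times_complex.sel)
      qed
      have "- inverse (real (Suc n)) \<le> nsq (fscale c g) * x\<^sup>2 + 2 * Re (c * (ip g (F n) - \<phi> g)) * x" for n
        using dle[of "F n + ?w x"] Fd[of n] *[of n] F g by (simp add: inverse_eq_divide)
      moreover have "(\<lambda>n. nsq (fscale c g) * x\<^sup>2 + 2 * Re (c * (ip g (F n) - \<phi> g)) * x) \<longlonglongrightarrow>
          nsq (fscale c g) * x\<^sup>2 + 2 * Re (c * (ip g h - \<phi> g)) * x"
        by (intro tendsto_intros convergent_seq_ip F h g)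
      moreover have "(\<lambda>n. - inverse (real (Suc n))) \<longlonglongrightarrow> - 0"
        by (rule tendsto_minus[OF LIMSEQ_inverse_real_of_nat])
      ultimately have "- 0 \<le> nsq (fscale c g) * x\<^sup>2 + 2 * Re (c * (ip g h - \<phi> g)) * x"
        by (intro LIMSEQ_le) auto
      then show ?thesis by linarith
    qed
    have "(Re (c * (ip g h - \<phi> g)))\<^sup>2 \<le> nsq (fscale c g) * 0"
      by (rule quadratic_nonneg_discrim) (rule step)
    then have "Re (c * (ip g h - \<phi> g)) = 0" by simp
    moreover have "c * (ip g h - \<phi> g) = of_real ((cmod (ip g h - \<phi> g))\<^sup>2)"
      unfolding complex_norm_square c_def by (rule mult.commute)
    ultimately have "(cmod (ip g h - \<phi> g))\<^sup>2 = 0" by (simp only: Re_complex_of_real)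
    then show ?thesis by simp
  qed
  then show ?thesis using h by blast
qed

lemma ip_ext: "f \<in> H \<Longrightarrow> g \<in> H \<Longrightarrow> (\<And>h. h \<in> H \<Longrightarrow> ip h f = ip h g) \<Longrightarrow> f = g"
  using ip_definite[of "f - g"] by (simp add: ip_diff_right)

end

section \<open>Orthonormal systems and weak compactness\<close>

context rkhs
begin

definition orthonormal :: "'i set \<Rightarrow> ('i \<Rightarrow> 'a \<Rightarrow> complex) \<Rightarrow> bool" where
  "orthonormal J b \<longleftrightarrow> (\<forall>i\<in>J. b i \<in> H) \<and> (\<forall>i\<in>J. \<forall>j\<in>J. ip (b i) (b j) = (if i = j then 1 else 0))"

definition proj :: "'i set \<Rightarrow> ('i \<Rightarrow> 'a \<Rightarrow> complex) \<Rightarrow> ('a \<Rightarrow> complex) \<Rightarrow> 'a \<Rightarrow> complex" where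
  "proj J b f = (\<Sum>i\<in>J. fscale (ip f (b i)) (b i))"

lemma orthonormal_mem: "orthonormal J b \<Longrightarrow> i \<in> J \<Longrightarrow> b i \<in> H"
  by (simp add: orthonormal_def)

lemma orthonormal_ip:
  "orthonormal J b \<Longrightarrow> i \<in> J \<Longrightarrow> j \<in> J \<Longrightarrow> ip (b i) (b j) = (if i = j then 1 else 0)"
  by (simp add: orthonormal_def)

lemma orthonormal_subset: "orthonormal J b \<Longrightarrow> J' \<subseteq> J \<Longrightarrow> orthonormal J' b"
  unfolding orthonormal_def by blast

lemma proj_mem [simp]: "orthonormal J b \<Longrightarrow> proj J b f \<in> H"
  by (simp add: proj_def orthonormal_mem)

lemma ip_comb_basis:
  assumes "orthonormal J b" "finite J" "j \<in> J"
  shows "ip (\<Sum>i\<in>J. fscale (c i) (b i)) (b j) = c j"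
proof -
  have "ip (\<Sum>i\<in>J. fscale (c i) (b i)) (b j) = (\<Sum>i\<in>J. c i * ip (b i) (b j))"
    using assms by (simp add: ip_sum ip_scale orthonormal_mem)
  also have "\<dots> = (\<Sum>i\<in>J. c i * (if i = j then 1 else 0))"
    using assms by (intro sum.cong refl) (simp add: orthonormal_ip)
  finally show ?thesis using assms by (simp add: if_distrib cong: if_cong)
qed

lemma ip_proj_basis: "orthonormal J b \<Longrightarrow> finite J \<Longrightarrow> j \<in> J \<Longrightarrow> ip (proj J b f) (b j) = ip f (b j)"
  unfolding proj_def by (rule ip_comb_basis)

lemma nsq_comb:
  assumes "orthonormal J b" "finite J"
  shows "nsq (\<Sum>i\<in>J. fscale (c i) (b i)) = (\<Sum>i\<in>J. (cmod (c i))\<^sup>2)"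
proof -
  let ?f = "\<Sum>i\<in>J. fscale (c i) (b i)"
  have f: "?f \<in> H" using assms by (simp add: orthonormal_mem)
  have "ip ?f ?f = (\<Sum>i\<in>J. ip ?f (fscale (c i) (b i)))"
    using assms f by (intro ip_sum_right) (auto simp: orthonormal_mem)
  also have "\<dots> = (\<Sum>i\<in>J. c i * cnj (c i))"
    using assms f by (intro sum.cong refl) (simp add: ip_scale_right orthonormal_mem ip_comb_basis)
  also have "\<dots> = of_real (\<Sum>i\<in>J. (cmod (c i))\<^sup>2)"
    unfolding of_real_sum complex_norm_square ..
  finally show ?thesis by (simp only: Re_complex_of_real)
qed

lemma ip_proj_right:
  assumes "orthonormal J b" "finite J" "f \<in> H" "g \<in> H" "\<And>j. j \<in> J \<Longrightarrow> ip g (b j) = 0"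
  shows "ip g (proj J b f) = 0"
  unfolding proj_def using assms
  by (subst ip_sum_right) (auto simp: orthonormal_mem ip_scale_right intro!: sum.neutral)

lemma ip_diff_proj_basis:
  assumes "orthonormal J b" "finite J" "f \<in> H" "j \<in> J"
  shows "ip (f - proj J b f) (b j) = 0"
  using assms by (simp add: ip_diff ip_proj_basis orthonormal_mem)

lemma nsq_diff_proj:
  assumes "orthonormal J b" "finite J" "f \<in> H"
  shows "nsq (f - proj J b f) = nsq f - (\<Sum>i\<in>J. (cmod (ip f (b i)))\<^sup>2)"
proof -
  let ?r = "f - proj J b f"
  have "ip ?r (proj J b f) = 0"
    using assms by (intro ip_proj_right) (auto simp: ip_diff_proj_basis)
  then have "nsq (?r + proj J b f) = nsq ?r + nsq (proj J b f)"
    using assms by (subst nsq_add) auto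
  then show ?thesis using nsq_comb[OF assms(1,2)] by (simp add: proj_def)
qed

lemma bessel:
  assumes "orthonormal J b" "finite J" "f \<in> H"
  shows "(\<Sum>i\<in>J. (cmod (ip f (b i)))\<^sup>2) \<le> nsq f"
  using nsq_diff_proj[OF assms] ip_nonneg[of "f - proj J b f"] assms by simp

text \<open>The diagonal of the reproducing kernel of the orthogonal complement of the
  \<open>b i\<close>, that is, the squared norm of point evaluation on that complement.\<close>

definition residual_kernel :: "'i set \<Rightarrow> ('i \<Rightarrow> 'a \<Rightarrow> complex) \<Rightarrow> 'a \<Rightarrow> real" where
  "residual_kernel J b x = Re (K x x) - (\<Sum>i\<in>J. (cmod (b i x))\<^sup>2)"

lemma ip_section: "f \<in> H \<Longrightarrow> x \<in> D \<Longrightarrow> ip (kernel_section D K x) f = cnj (f x)"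
  using ip_cnj[of f "kernel_section D K x"] by (simp add: reproducing)

lemma nsq_section_diff_proj:
  assumes "orthonormal J b" "finite J" "x \<in> D"
  shows "nsq (kernel_section D K x - proj J b (kernel_section D K x)) = residual_kernel J b x"
proof -
  have "(cmod (ip (kernel_section D K x) (b i)))\<^sup>2 = (cmod (b i x))\<^sup>2" if "i \<in> J" for i
    using that assms by (simp add: ip_section orthonormal_mem)
  then show ?thesis
    using nsq_diff_proj[OF assms(1,2) section_mem[OF assms(3)]]
    by (simp only: residual_kernel_def nsq_section[OF assms(3)] cong: sum.cong)
qed

lemma residual_kernel_nonneg:
  "orthonormal J b \<Longrightarrow> finite J \<Longrightarrow> x \<in> D \<Longrightarrow> 0 \<le> residual_kernel J b x"
  using nsq_section_diff_proj[of J b x] ip_nonneg by (metis H_diff proj_mem section_mem)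

lemma residual_eval_bound:
  assumes "orthonormal J b" "finite J" "x \<in> D" "g \<in> H" "\<And>j. j \<in> J \<Longrightarrow> ip g (b j) = 0"
  shows "(cmod (g x))\<^sup>2 \<le> nsq g * residual_kernel J b x"
proof -
  let ?k = "kernel_section D K x"
  have "g x = ip g (?k - proj J b ?k)"
    using assms by (simp add: ip_diff_right ip_proj_right reproducing)
  then show ?thesis
    using ip_cauchy_schwarz[of g "?k - proj J b ?k"] nsq_section_diff_proj[OF assms(1-3)] assms by simp
qed

text \<open>A countable dense set of \<open>H\<close> may miss \<open>V\<close> altogether. For each
  of its points and each radius \<open>1 / Suc n\<close> an element of \<open>V\<close> within that
  radius is picked, if there is one. Used for the unit ball and for the complement of the
  eigenvectors.\<close>

lemma separable_subset:
  assumes "separable_hilbert H ip" "V \<subseteq> H"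
  obtains S where "countable S" "S \<subseteq> V" "\<And>f \<epsilon>. f \<in> V \<Longrightarrow> \<epsilon> > 0 \<Longrightarrow> \<exists>g\<in>S. hnorm ip (f - g) < \<epsilon>"
proof -
  obtain S0 where S0: "countable S0" "S0 \<subseteq> H" "\<And>f \<epsilon>. f \<in> H \<Longrightarrow> \<epsilon> > 0 \<Longrightarrow> \<exists>g\<in>S0. hnorm ip (f - g) < \<epsilon>"
    using assms(1) unfolding separable_hilbert_def by metis
  define Q where "Q = (\<lambda>(s, n) g. g \<in> V \<and> hnorm ip (g - s) < 1 / real (Suc n))"
  define A where "A = {p \<in> S0 \<times> (UNIV :: nat set). \<exists>g. Q p g}"
  define S where "S = (\<lambda>p. SOME g. Q p g) ` A"
  have Q: "Q p (SOME g. Q p g)" if "p \<in> A" for p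
  proof -
    from that have "\<exists>g. Q p g" unfolding A_def by blast
    then show ?thesis by (rule someI_ex)
  qed
  have "countable A" unfolding A_def
    by (rule countable_subset[of _ "S0 \<times> UNIV"]) (use S0(1) in auto)
  then have "countable S" unfolding S_def by simp
  moreover have "S \<subseteq> V" unfolding S_def using Q by (auto simp: Q_def split: prod.splits)
  moreover have "\<exists>g\<in>S. hnorm ip (f - g) < \<epsilon>" if f: "f \<in> V" and e: "\<epsilon> > 0" for f \<epsilon>
  proof -
    obtain n where n: "1 / real (Suc n) < \<epsilon> / 2"
      using e by (metis nat_approx_posE half_gt_zero)
    obtain s where s: "s \<in> S0" "hnorm ip (f - s) < 1 / real (Suc n)"
      using S0(3)[of f "1 / real (Suc n)"] f assms(2) by auto
    have "(s, n) \<in> A" using s f by (auto simp: A_def Q_def)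
    define g where "g = (SOME g. Q (s, n) g)"
    have "Q (s, n) g" unfolding g_def by (rule Q) fact
    then have g: "g \<in> V" "hnorm ip (g - s) < 1 / real (Suc n)" by (simp_all add: Q_def)
    have "g \<in> S" unfolding g_def S_def by (rule imageI) fact
    have mem: "f \<in> H" "g \<in> H" "s \<in> H" using f g s S0(2) assms(2) by auto
    have "hnorm ip (f - g) \<le> hnorm ip (f - s) + hnorm ip (g - s)"
      using hnorm_triangle[of "f - s" "s - g"] hnorm_minus_commute[of s g] mem by simp
    then show ?thesis using g \<open>g \<in> S\<close> s n by (intro bexI[of _ g]) auto
  qed
  ultimately show ?thesis using that by blast
qed

text \<open>A diagonal subsequence converges when tested against a countable dense set. Density
  extends this to all of \<open>H\<close>, and the Riesz representation turns the limit functional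
  into a vector.\<close>

lemma weak_sequential_compactness:
  assumes sep: "separable_hilbert H ip" and F: "\<And>k. F k \<in> H" "\<And>k. nsq (F k) \<le> 1"
  obtains r f where "strict_mono (r :: nat \<Rightarrow> nat)" "f \<in> H"
    "\<And>g. g \<in> H \<Longrightarrow> (\<lambda>k. ip g (F (r k))) \<longlonglongrightarrow> ip g f"
proof -
  obtain S where S: "countable S" "S \<subseteq> H" "\<And>f \<epsilon>. f \<in> H \<Longrightarrow> \<epsilon> > 0 \<Longrightarrow> \<exists>g\<in>S. hnorm ip (f - g) < \<epsilon>"
    using separable_subset[OF sep subset_refl] by metis
  have bound: "cmod (ip g (F k)) \<le> hnorm ip g" if "g \<in> H" for g k
  proof -
    have "hnorm ip (F k) \<le> 1" using F by (simp add: hnorm_le_1_iff)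
    then have "hnorm ip g * hnorm ip (F k) \<le> hnorm ip g"
      using mult_left_mono[of "hnorm ip (F k)" 1 "hnorm ip g"] that by (simp add: hnorm_nonneg)
    then show ?thesis using cmod_ip_le[OF that F(1)] by (meson order_trans)
  qed
  \<comment> \<open>The subsequence theorem asks for one bound for all test vectors, hence the
    normalization; the summand 1 keeps the denominator positive.\<close>
  have "norm (ip g (F k) / of_real (1 + hnorm ip g)) \<le> 1" if "g \<in> S" for g k
  proof -
    have g: "g \<in> H" using that S by auto
    then show ?thesis using bound[OF g, of k] hnorm_nonneg[OF g]
      by (simp only: norm_divide norm_of_real) (simp add: divide_le_eq)
  qed
  then obtain r where r: "strict_mono (r :: nat \<Rightarrow> nat)"
    "\<And>g. g \<in> S \<Longrightarrow> \<exists>l. (\<lambda>n. ip g (F (r n)) / of_real (1 + hnorm ip g)) \<longlonglongrightarrow> l"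
    using function_convergent_subsequence[OF S(1), of "\<lambda>n g. ip g (F n) / of_real (1 + hnorm ip g)" 1]
    by metis
  have convS: "Cauchy (\<lambda>n. ip g (F (r n)))" if g: "g \<in> S" for g
  proof -
    obtain l where "(\<lambda>n. ip g (F (r n)) / of_real (1 + hnorm ip g)) \<longlonglongrightarrow> l" using r(2)[OF g] by blast
    then have "(\<lambda>n. ip g (F (r n)) / of_real (1 + hnorm ip g) * of_real (1 + hnorm ip g))
        \<longlonglongrightarrow> l * of_real (1 + hnorm ip g)" by (intro tendsto_intros)
    moreover have "complex_of_real (1 + hnorm ip g) \<noteq> 0"
      using hnorm_nonneg[of g] g S by (auto simp del: of_real_add simp add: of_real_eq_0_iff)
    ultimately have "(\<lambda>n. ip g (F (r n))) \<longlonglongrightarrow> l * of_real (1 + hnorm ip g)" by simp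
    then show ?thesis by (rule LIMSEQ_imp_Cauchy)
  qed
  have conv: "convergent (\<lambda>n. ip g (F (r n)))" if g: "g \<in> H" for g
  proof (rule Cauchy_convergent, rule CauchyI)
    fix \<epsilon> :: real assume e: "0 < \<epsilon>"
    obtain s where s: "s \<in> S" "hnorm ip (g - s) < \<epsilon> / 3" using S(3)[OF g, of "\<epsilon> / 3"] e by auto
    obtain N where N: "\<And>i j. i \<ge> N \<Longrightarrow> j \<ge> N \<Longrightarrow> norm (ip s (F (r i)) - ip s (F (r j))) < \<epsilon> / 3"
      using CauchyD[OF convS[OF s(1)], of "\<epsilon> / 3"] e by auto
    have sH: "s \<in> H" using s S by auto
    have "norm (ip g (F (r i)) - ip g (F (r j))) < \<epsilon>" if ij: "i \<ge> N" "j \<ge> N" for i j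
    proof -
      let ?u = "ip (g - s) (F (r i))" and ?v = "ip (g - s) (F (r j))"
        and ?w = "ip s (F (r i)) - ip s (F (r j))"
      have "ip g (F (r i)) - ip g (F (r j)) = ?u - ?v + ?w"
        using g sH F by (simp add: ip_diff)
      moreover have "norm (?u - ?v + ?w) \<le> norm ?u + norm ?v + norm ?w"
        by (rule order_trans[OF norm_triangle_ineq add_right_mono[OF norm_triangle_ineq4]])
      moreover have "norm ?u + norm ?v + norm ?w < \<epsilon>"
        using bound[OF H_diff[OF g sH], of "r i"] bound[OF H_diff[OF g sH], of "r j"] N[OF ij] s(2)
        by linarith
      ultimately show ?thesis by simp
    qed
    then show "\<exists>N. \<forall>m\<ge>N. \<forall>n\<ge>N. norm (ip g (F (r m)) - ip g (F (r n))) < \<epsilon>" by blast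
  qed
  define \<phi> where "\<phi> g = lim (\<lambda>n. ip g (F (r n)))" for g
  have lim: "(\<lambda>n. ip g (F (r n))) \<longlonglongrightarrow> \<phi> g" if "g \<in> H" for g
    using conv[OF that] unfolding \<phi>_def by (simp add: convergent_LIMSEQ_iff)
  have "\<exists>h\<in>H. \<forall>g\<in>H. ip g h = \<phi> g"
  proof (rule riesz_representation[where C = 1])
    fix f g assume fg: "f \<in> H" "g \<in> H"
    have "(\<lambda>n. ip f (F (r n)) + ip g (F (r n))) \<longlonglongrightarrow> \<phi> f + \<phi> g" by (intro tendsto_intros lim fg)
    moreover have "(\<lambda>n. ip f (F (r n)) + ip g (F (r n))) \<longlonglongrightarrow> \<phi> (f + g)"
      using lim[of "f + g"] fg F by (simp add: ip_add)
    ultimately show "\<phi> (f + g) = \<phi> f + \<phi> g" by (metis LIMSEQ_unique)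
  next
    fix c f assume f: "f \<in> H"
    have "(\<lambda>n. c * ip f (F (r n))) \<longlonglongrightarrow> c * \<phi> f" by (intro tendsto_intros lim f)
    moreover have "(\<lambda>n. c * ip f (F (r n))) \<longlonglongrightarrow> \<phi> (fscale c f)"
      using lim[of "fscale c f"] f F by (simp add: ip_scale)
    ultimately show "\<phi> (fscale c f) = c * \<phi> f" by (metis LIMSEQ_unique)
  next
    fix f assume f: "f \<in> H"
    have "(\<lambda>n. (cmod (ip f (F (r n))))\<^sup>2) \<longlonglongrightarrow> (cmod (\<phi> f))\<^sup>2"
      by (intro tendsto_intros lim f)
    moreover have "(cmod (ip f (F (r n))))\<^sup>2 \<le> 1 * nsq f" for n
      using bound[OF f, of "r n"] power_mono[of _ "hnorm ip f" 2] hnorm_sq[OF f] by fastforce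
    ultimately show "(cmod (\<phi> f))\<^sup>2 \<le> 1 * nsq f" by (meson LIMSEQ_le_const2)
  qed
  then show ?thesis using that r(1) lim by metis
qed

end

section \<open>The embedding into L2 and its eigenspaces\<close>

locale rkhs_trace = rkhs D K H ip
  for D :: "'a set" and K H ip +
  fixes M :: "'a measure"
  assumes separable: "separable_hilbert H ip"
    and space_M: "space M = D"
    and measurable_H: "\<And>f. f \<in> H \<Longrightarrow> f \<in> borel_measurable M"
    and trace_class: "integrable M (\<lambda>x. Re (K x x))"
begin

definition tr :: real where "tr = (LINT x|M. Re (K x x))"

abbreviation q :: "('a \<Rightarrow> complex) \<Rightarrow> real" where "q f \<equiv> Re (l2_inner M f f)"

lemma integrable_sq: "f \<in> H \<Longrightarrow> integrable M (\<lambda>x. (cmod (f x))\<^sup>2)"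
proof (rule Bochner_Integration.integrable_bound)
  assume f: "f \<in> H"
  show "integrable M (\<lambda>x. nsq f * Re (K x x))" using trace_class by simp
  show "(\<lambda>x. (cmod (f x))\<^sup>2) \<in> borel_measurable M" using measurable_H[OF f] by measurable
  show "AE x in M. norm ((cmod (f x))\<^sup>2) \<le> norm (nsq f * Re (K x x))"
    using eval_bound[OF f] space_M by (intro AE_I2) (fastforce intro: order_trans abs_ge_self)
qed

lemma integrable_prod: "f \<in> H \<Longrightarrow> g \<in> H \<Longrightarrow> integrable M (\<lambda>x. f x * cnj (g x))"
proof (rule Bochner_Integration.integrable_bound)
  assume f: "f \<in> H" and g: "g \<in> H"
  show "integrable M (\<lambda>x. (cmod (f x))\<^sup>2 + (cmod (g x))\<^sup>2)"
    using integrable_sq f g by simp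
  show "(\<lambda>x. f x * cnj (g x)) \<in> borel_measurable M"
    using measurable_H f g
    by (intro borel_measurable_times measurable_compose[OF _ borel_measurable_continuous_onI[of cnj]])
      (auto intro: continuous_intros)
  show "AE x in M. norm (f x * cnj (g x)) \<le> norm ((cmod (f x))\<^sup>2 + (cmod (g x))\<^sup>2)"
  proof (intro AE_I2)
    fix x
    have "0 \<le> (cmod (f x) - cmod (g x))\<^sup>2" "0 \<le> cmod (f x) * cmod (g x)" by simp_all
    then have "cmod (f x) * cmod (g x) \<le> (cmod (f x))\<^sup>2 + (cmod (g x))\<^sup>2"
      unfolding power2_diff by linarith
    then show "norm (f x * cnj (g x)) \<le> norm ((cmod (f x))\<^sup>2 + (cmod (g x))\<^sup>2)"
      by (simp add: norm_mult)
  qed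
qed

lemma l2_add: "f \<in> H \<Longrightarrow> g \<in> H \<Longrightarrow> h \<in> H \<Longrightarrow> l2_inner M (f + g) h = l2_inner M f h + l2_inner M g h"
  by (simp add: l2_inner_def distrib_right integrable_prod)

lemma l2_scale: "l2_inner M (fscale c f) g = c * l2_inner M f g"
  by (simp add: l2_inner_def fscale_def mult.assoc)

lemma l2_cnj: "l2_inner M g f = cnj (l2_inner M f g)"
  unfolding l2_inner_def by (subst Bochner_Integration.integral_cnj[symmetric]) (simp add: mult.commute)

lemma l2_sum_left:
  assumes "finite J" "\<And>k. k \<in> J \<Longrightarrow> g k \<in> H" "f \<in> H"
  shows "l2_inner M (\<Sum>k\<in>J. fscale (c k) (g k)) f = (\<Sum>k\<in>J. c k * l2_inner M (g k) f)"
  using assms(1,2)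
proof (induction J rule: finite_induct)
  case empty
  show ?case by (simp add: l2_inner_def)
next
  case (insert j J)
  have "fscale (c j) (g j) \<in> H" "(\<Sum>k\<in>J. fscale (c k) (g k)) \<in> H"
    using insert.prems by (auto intro!: H_sum)
  moreover have "\<And>k. k \<in> J \<Longrightarrow> g k \<in> H" using insert.prems by blast
  ultimately show ?case
    using l2_add[of "fscale (c j) (g j)" "\<Sum>k\<in>J. fscale (c k) (g k)" f] assms(3) insert.IH
    unfolding sum.insert[OF insert.hyps] l2_scale by (simp only:)
qed

lemma q_add_orthogonal:
  assumes g: "g \<in> H" and h: "h \<in> H" and 0: "l2_inner M h g = 0"
  shows "q (g + h) = q g + q h"
proof -
  have "l2_inner M (g + h) (g + h) = l2_inner M g (g + h) + l2_inner M h (g + h)"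
    using g h by (intro l2_add) auto
  moreover have "l2_inner M g (g + h) = cnj (l2_inner M g g + l2_inner M h g)"
    using l2_add[OF g h g] l2_cnj[of g "g + h"] by simp
  moreover have "l2_inner M h (g + h) = cnj (l2_inner M g h + l2_inner M h h)"
    using l2_add[OF g h h] l2_cnj[of h "g + h"] by simp
  moreover have "l2_inner M g h = 0" using l2_cnj[of g h] 0 by simp
  ultimately show ?thesis using 0 by simp
qed

lemma q_eq: "f \<in> H \<Longrightarrow> q f = (LINT x|M. (cmod (f x))\<^sup>2)"
  unfolding l2_inner_def by (simp only: complex_norm_square[symmetric] integral_complex_of_real Re_complex_of_real)

lemma q_nonneg: "f \<in> H \<Longrightarrow> 0 \<le> q f"
  by (simp add: q_eq)

lemma l2_norm_sq_eq: "f \<in> H \<Longrightarrow> l2_norm_sq M f = ennreal (q f)"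
  unfolding l2_norm_sq_def q_eq using integrable_sq by (intro nn_integral_eq_integral) auto

lemma tr_nonneg: "0 \<le> tr"
  unfolding tr_def using kernel_diag_nonneg space_M by (intro integral_nonneg_AE AE_I2) auto

lemma q_le: "f \<in> H \<Longrightarrow> q f \<le> nsq f * tr"
proof -
  assume f: "f \<in> H"
  have "q f \<le> (LINT x|M. nsq f * Re (K x x))"
    unfolding q_eq[OF f] using integrable_sq[OF f] trace_class eval_bound[OF f] space_M
    by (intro integral_mono) auto
  then show ?thesis by (simp add: tr_def)
qed

lemma l2_cauchy_schwarz: "f \<in> H \<Longrightarrow> g \<in> H \<Longrightarrow> (cmod (l2_inner M f g))\<^sup>2 \<le> q f * q g"
  by (rule psd_form_cauchy_schwarz[OF subspace_H l2_add l2_scale l2_cnj q_nonneg])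

abbreviation T :: "('a \<Rightarrow> complex) \<Rightarrow> 'a \<Rightarrow> complex" where "T \<equiv> embedding_gram H ip M"

text \<open>Gives meaning to the \<open>THE\<close> in the definition of the adjoint:
  \<open>q_le\<close> provides the bound required by the Riesz representation, and
  \<open>ip_ext\<close> the uniqueness.\<close>

lemma gram_spec:
  assumes f: "f \<in> H"
  shows "T f \<in> H \<and> (\<forall>g\<in>H. ip g (T f) = l2_inner M g f)"
proof -
  have "\<exists>h\<in>H. \<forall>g\<in>H. ip g h = l2_inner M g f"
  proof (rule riesz_representation)
    fix g assume g: "g \<in> H"
    have "q g * q f \<le> (nsq g * tr) * q f"
      using q_le[OF g] q_nonneg[OF f] by (rule mult_right_mono)
    then show "(cmod (l2_inner M g f))\<^sup>2 \<le> (tr * q f) * nsq g"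
      using l2_cauchy_schwarz[OF g f] by (simp add: mult.commute mult.left_commute)
  qed (simp_all add: l2_add l2_scale f)
  then obtain h where h: "h \<in> H" "\<And>g. g \<in> H \<Longrightarrow> ip g h = l2_inner M g f" by blast
  then have "\<exists>!h. h \<in> H \<and> (\<forall>g\<in>H. ip g h = l2_inner M g f)"
    by (intro ex1I[of _ h]) (auto intro!: ip_ext)
  from theI'[OF this] show ?thesis
    by (simp add: embedding_gram_def embedding_adjoint_def)
qed

text \<open>Weak form of the eigenvalue equation, stated by the two sesquilinear forms
  alone.\<close>

lemma eigenspace_iff:
  "f \<in> eigenspace H T \<mu> \<longleftrightarrow> f \<in> H \<and> (\<forall>g\<in>H. l2_inner M g f = of_real \<mu> * ip g f)"
proof (cases "f \<in> H")
  case True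
  then have "T f = fscale (of_real \<mu>) f \<longleftrightarrow> (\<forall>g\<in>H. ip g (T f) = ip g (fscale (of_real \<mu>) f))"
    using gram_spec[OF True] by (auto intro!: ip_ext)
  then show ?thesis using gram_spec[OF True] True by (auto simp: eigenspace_def ip_scale_right)
qed (simp add: eigenspace_def)

lemma q_eigenvector: "f \<in> eigenspace H T \<mu> \<Longrightarrow> q f = \<mu> * nsq f"
  unfolding eigenspace_iff using ip_self[of f] by (auto simp: Re_complex_of_real)

lemma subspace_eigenspace: "cfun.subspace (eigenspace H T \<mu>)"
proof (rule cfun.subspaceI)
  have r: "l2_inner M g (f + h) = l2_inner M g f + l2_inner M g h" if "f \<in> H" "g \<in> H" "h \<in> H" for f g h
    using l2_add[OF that(1,3,2)] by (simp add: l2_cnj[of g])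
  show "0 \<in> eigenspace H T \<mu>"
    unfolding eigenspace_iff using r[of 0 _ 0] ip_add_right[of 0 0] by auto
  show "x + y \<in> eigenspace H T \<mu>" if "x \<in> eigenspace H T \<mu>" "y \<in> eigenspace H T \<mu>" for x y
    using that unfolding eigenspace_iff by (auto simp: r ip_add_right distrib_left)
  show "fscale c x \<in> eigenspace H T \<mu>" if "x \<in> eigenspace H T \<mu>" for c x
    using that unfolding eigenspace_iff
    by (auto simp: ip_scale_right l2_cnj[of _ "fscale c x"] l2_scale l2_cnj[of x])
qed

text \<open>Bessel's inequality for the kernel section at each point, integrated over the
  domain.\<close>

lemma q_orthonormal_sum_le:
  assumes "orthonormal J b" "finite J"
  shows "(\<Sum>i\<in>J. q (b i)) \<le> tr"
proof -
  have "(\<Sum>i\<in>J. q (b i)) = (LINT x|M. (\<Sum>i\<in>J. (cmod (b i x))\<^sup>2))"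
    using assms by (simp add: q_eq orthonormal_mem integrable_sq)
  also have "\<dots> \<le> tr"
    unfolding tr_def using assms residual_kernel_nonneg[OF assms] space_M
    by (intro integral_mono trace_class Bochner_Integration.integrable_sum integrable_sq)
      (auto simp: orthonormal_mem residual_kernel_def)
  finally show ?thesis .
qed

text \<open>The form in which compactness of the embedding is used. Testing against kernel sections
  turns weak convergence into pointwise convergence, and \<open>Re (K x x)\<close> dominates the
  squares on the unit ball.\<close>

lemma q_weakly_continuous:
  assumes F: "\<And>k. F k \<in> H" "\<And>k. nsq (F k) \<le> 1" and f: "f \<in> H"
    and lim: "\<And>g. g \<in> H \<Longrightarrow> (\<lambda>k. ip g (F k)) \<longlonglongrightarrow> ip g f"
  shows "(\<lambda>k. q (F k)) \<longlonglongrightarrow> q f"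
  unfolding q_eq[OF F(1)] q_eq[OF f]
proof (rule integral_dominated_convergence)
  show "(\<lambda>x. (cmod (f x))\<^sup>2) \<in> borel_measurable M" using measurable_H[OF f] by measurable
  show "(\<lambda>x. (cmod (F k x))\<^sup>2) \<in> borel_measurable M" for k using measurable_H[OF F(1)[of k]] by measurable
  show "integrable M (\<lambda>x. Re (K x x))" by (rule trace_class)
  show "AE x in M. (\<lambda>k. (cmod (F k x))\<^sup>2) \<longlonglongrightarrow> (cmod (f x))\<^sup>2"
  proof (intro AE_I2)
    fix x assume "x \<in> space M"
    then have x: "x \<in> D" by (simp add: space_M)
    have "(\<lambda>k. cnj (F k x)) \<longlonglongrightarrow> cnj (f x)"
      using lim[OF section_mem[OF x]] F f x by (simp add: ip_section)
    then have "(\<lambda>k. cmod (cnj (F k x))) \<longlonglongrightarrow> cmod (cnj (f x))" by (rule tendsto_norm)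
    then have "(\<lambda>k. cmod (F k x)) \<longlonglongrightarrow> cmod (f x)" by (simp only: complex_mod_cnj)
    then show "(\<lambda>k. (cmod (F k x))\<^sup>2) \<longlonglongrightarrow> (cmod (f x))\<^sup>2" by (rule tendsto_power)
  qed
  show "AE x in M. norm ((cmod (F k x))\<^sup>2) \<le> Re (K x x)" for k
  proof (intro AE_I2)
    fix x assume "x \<in> space M"
    then have x: "x \<in> D" by (simp add: space_M)
    have "nsq (F k) * Re (K x x) \<le> 1 * Re (K x x)"
      using F kernel_diag_nonneg[OF x] by (intro mult_right_mono)
    then show "norm ((cmod (F k x))\<^sup>2) \<le> Re (K x x)" using eval_bound[OF F(1) x, of k] by simp
  qed
qed

end

section \<open>The trace formula\<close>

context rkhs
begin

lemma orthonormal_independent: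
  assumes Os: "orthonormal Os id"
  shows "cfun.independent Os"
  unfolding cfun.independent_explicit_module
proof (intro allI impI)
  fix t u v
  assume t: "finite t" "t \<subseteq> Os" and z: "(\<Sum>v\<in>t. fscale (u v) v) = 0" and v: "v \<in> t"
  have "ip (\<Sum>v\<in>t. fscale (u v) (id v)) (id v) = u v"
    by (rule ip_comb_basis[OF orthonormal_subset[OF Os t(2)] t(1) v])
  moreover have "id v \<in> H" using orthonormal_mem[OF Os] t v by blast
  ultimately show "u v = 0" using z by simp
qed

text \<open>Gram-Schmidt: an infinite independent set never lies in the span of finitely many
  vectors, so orthonormal systems in \<open>V\<close> could be enlarged indefinitely. The finiteness
  is needed before \<open>cfun.dim\<close> can be read as a true dimension.\<close>

lemma subspace_orthonormal_bound:
  assumes V: "cfun.subspace V" "V \<subseteq> H"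
    and bound: "\<And>Os. finite Os \<Longrightarrow> Os \<subseteq> V \<Longrightarrow> orthonormal Os id \<Longrightarrow> card Os \<le> N"
    and b: "cfun.independent b" "b \<subseteq> V"
  shows "finite b"
proof (rule ccontr)
  assume inf: "infinite b"
  have "\<exists>Os. finite Os \<and> card Os = n \<and> Os \<subseteq> V \<and> orthonormal Os id" for n
  proof (induction n)
    case 0
    show ?case by (intro exI[of _ "{}"]) (auto simp: orthonormal_def)
  next
    case (Suc n)
    then obtain Os where Os: "finite Os" "card Os = n" "Os \<subseteq> V" "orthonormal Os id" by blast
    have "\<not> b \<subseteq> cfun.span Os"
      using cfun.independent_span_bound[OF Os(1) b(1)] inf by blast
    then obtain g where g: "g \<in> b" "g \<notin> cfun.span Os" by blast
    have gV: "g \<in> V" "g \<in> H" using g b V by auto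
    define w where "w = g - proj Os id g"
    have pspan: "proj Os id g \<in> cfun.span Os"
      unfolding proj_def by (intro cfun.span_sum cfun.span_scale cfun.span_base) auto
    then have pV: "proj Os id g \<in> V" using cfun.span_minimal[OF Os(3) V(1)] by blast
    have wV: "w \<in> V" unfolding w_def using V(1) gV(1) pV by (rule cfun.subspace_diff)
    have wH: "w \<in> H" using wV V by auto
    have "w \<noteq> 0" using g(2) pspan by (auto simp: w_def)
    then have wpos: "nsq w > 0" using nsq_eq_0_iff[OF wH] ip_nonneg[OF wH] by simp
    define w1 where "w1 = fscale (of_real (1 / sqrt (nsq w))) w"
    have w1V: "w1 \<in> V" unfolding w1_def using V(1) wV by (rule cfun.subspace_scale)
    have w1H: "w1 \<in> H" using w1V V by auto
    have "nsq w1 = 1" unfolding w1_def by (rule nsq_normalize[OF wH wpos])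
    then have n1: "ip w1 w1 = 1" using ip_self[OF w1H] by simp
    have orth: "ip w1 h = 0" "ip h w1 = 0" if "h \<in> Os" for h
    proof -
      have hH: "h \<in> H" using orthonormal_mem[OF Os(4) that] by simp
      have "ip w h = 0" using ip_diff_proj_basis[OF Os(4,1) gV(2) that] by (simp add: w_def)
      then show 1: "ip w1 h = 0" by (simp add: w1_def ip_scale[OF wH hH])
      show "ip h w1 = 0" using ip_cnj[OF w1H hH] 1 by simp
    qed
    have "w1 \<notin> Os" using orth(1)[of w1] n1 by auto
    have "orthonormal (insert w1 Os) id"
      unfolding orthonormal_def using Os(4) orth n1 w1H \<open>w1 \<notin> Os\<close> unfolding orthonormal_def by auto
    moreover have "finite (insert w1 Os)" "card (insert w1 Os) = Suc n" "insert w1 Os \<subseteq> V"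
      using Os w1V \<open>w1 \<notin> Os\<close> by auto
    ultimately show ?case by blast
  qed
  from this[of "Suc N"] obtain Os where "finite Os" "card Os = Suc N" "Os \<subseteq> V" "orthonormal Os id" by blast
  then show False using bound[of Os] by simp
qed

end

locale rkhs_eigen = rkhs_trace +
  fixes lam :: "nat \<Rightarrow> real" and e :: "nat \<Rightarrow> 'a \<Rightarrow> complex"
  assumes eigenvalues: "positive_eigenvalue_sequence H (embedding_gram H ip M) lam"
    and eigenvectors: "orthonormal_eigenvectors H ip (embedding_gram H ip M) lam e"
begin

lemma lam_pos: "1 \<le> j \<Longrightarrow> 0 < lam j"
  and lam_mono: "1 \<le> i \<Longrightarrow> i \<le> j \<Longrightarrow> lam j \<le> lam i"
  and card_eigenvalue: "0 < \<mu> \<Longrightarrow> card {j. 1 \<le> j \<and> lam j = \<mu>} = cfun.dim (eigenspace H T \<mu>)"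
  using eigenvalues unfolding positive_eigenvalue_sequence_def by blast+

lemma e_eigen: "1 \<le> j \<Longrightarrow> e j \<in> eigenspace H T (lam j)"
  using eigenvectors unfolding orthonormal_eigenvectors_def by blast

lemma e_mem: "1 \<le> j \<Longrightarrow> e j \<in> H"
  using e_eigen[of j] by (simp add: eigenspace_def)

lemma e_orthonormal: "orthonormal {1..} e"
  using eigenvectors e_mem unfolding orthonormal_eigenvectors_def orthonormal_def by simp

lemma e_orthonormal_subset: "J \<subseteq> {1..} \<Longrightarrow> orthonormal J e"
  by (rule orthonormal_subset[OF e_orthonormal])

lemma ip_e: "1 \<le> i \<Longrightarrow> 1 \<le> j \<Longrightarrow> ip (e i) (e j) = (if i = j then 1 else 0)"
  using orthonormal_ip[OF e_orthonormal] by simp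

lemma l2_e_right: "f \<in> H \<Longrightarrow> 1 \<le> j \<Longrightarrow> l2_inner M f (e j) = of_real (lam j) * ip f (e j)"
  using e_eigen[of j] by (simp add: eigenspace_iff)

lemma l2_e_left: "f \<in> H \<Longrightarrow> 1 \<le> j \<Longrightarrow> l2_inner M (e j) f = of_real (lam j) * ip (e j) f"
  using l2_e_right[of f j] l2_cnj[of "e j" f] ip_cnj[of f "e j"] e_mem[of j] by simp

lemma q_e: "1 \<le> j \<Longrightarrow> q (e j) = lam j"
  using q_eigenvector[OF e_eigen] ip_e[of j j] by simp

lemma sum_lam_le: "finite J \<Longrightarrow> J \<subseteq> {1..} \<Longrightarrow> sum lam J \<le> tr"
proof -
  assume J: "finite J" "J \<subseteq> {1..}"
  have "sum lam J = (\<Sum>j\<in>J. q (e j))" using J by (intro sum.cong refl) (auto simp: q_e subset_iff)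
  then show ?thesis using q_orthonormal_sum_le[OF e_orthonormal_subset[OF J(2)] J(1)] by simp
qed

text \<open>Excludes the default value 0 of \<open>card\<close> on infinite sets: infinitely many
  repetitions of a positive eigenvalue would exceed the trace.\<close>

lemma finite_eigenvalue_indices:
  assumes "0 < \<mu>"
  shows "finite {j. 1 \<le> j \<and> lam j = \<mu>}"
proof (rule ccontr)
  assume inf: "infinite {j. 1 \<le> j \<and> lam j = \<mu>}"
  obtain N where N: "tr / \<mu> < real N" using reals_Archimedean2 by blast
  obtain J where J: "J \<subseteq> {j. 1 \<le> j \<and> lam j = \<mu>}" "finite J" "card J = N"
    using infinite_arbitrarily_large[OF inf] by metis
  have "sum lam J = real N * \<mu>"
    using J by (subst sum.cong[OF refl, of J lam "\<lambda>_. \<mu>"]) auto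
  moreover have "sum lam J \<le> tr" using J by (intro sum_lam_le) auto
  ultimately show False using N assms by (simp add: divide_less_eq)
qed

text \<open>This is where the multiplicities enter: a nonzero \<open>f\<close>, normalized, together
  with the \<open>e j\<close> for \<open>\<mu>\<close> would be one more independent vector than the
  dimension of the eigenspace. That dimension is finite because each orthonormal eigenvector takes
  \<open>\<mu>\<close> from the trace.\<close>

lemma eigenvector_orthogonal_trivial:
  assumes \<mu>: "0 < \<mu>" and f: "f \<in> eigenspace H T \<mu>" and orth: "\<And>j. 1 \<le> j \<Longrightarrow> ip f (e j) = 0"
  shows "f = 0"
proof (rule ccontr)
  assume "f \<noteq> 0"
  let ?E = "eigenspace H T \<mu>" and ?J = "{j. 1 \<le> j \<and> lam j = \<mu>}"
  have EH: "?E \<subseteq> H" by (auto simp: eigenspace_def)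
  have fH: "f \<in> H" using f EH by blast
  obtain b where b: "b \<subseteq> ?E" "cfun.independent b" "?E \<subseteq> cfun.span b" "card b = cfun.dim ?E"
    by (rule cfun.basis_exists)
  obtain N where N: "tr / \<mu> < real N" using reals_Archimedean2 by blast
  have finb: "finite b"
  proof (rule subspace_orthonormal_bound[OF subspace_eigenspace EH _ b(2,1)])
    fix Os assume Os: "finite Os" "Os \<subseteq> ?E" "orthonormal Os id"
    have "q g = \<mu>" if "g \<in> Os" for g
      using q_eigenvector[of g \<mu>] Os that orthonormal_ip[OF Os(3) that that] by auto
    then have "real (card Os) * \<mu> \<le> tr" using q_orthonormal_sum_le[OF Os(3,1)] by simp
    then have "real (card Os) \<le> tr / \<mu>" using \<mu> by (simp add: pos_le_divide_eq)
    then show "card Os \<le> N" using N by linarith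
  qed
  have npos: "nsq f > 0" using nsq_eq_0_iff[OF fH] ip_nonneg[OF fH] \<open>f \<noteq> 0\<close> by simp
  define f1 where "f1 = fscale (of_real (1 / sqrt (nsq f))) f"
  have f1: "f1 \<in> ?E" unfolding f1_def using subspace_eigenspace f by (rule cfun.subspace_scale)
  then have f1H: "f1 \<in> H" using EH by blast
  have "nsq f1 = 1" unfolding f1_def by (rule nsq_normalize[OF fH npos])
  then have n1: "ip f1 f1 = 1" using ip_self[OF f1H] by simp
  have o1: "ip f1 (e j) = 0" "ip (e j) f1 = 0" if "1 \<le> j" for j
  proof -
    show 1: "ip f1 (e j) = 0" using orth[OF that] by (simp add: f1_def ip_scale[OF fH e_mem[OF that]])
    show "ip (e j) f1 = 0" using ip_cnj[OF f1H e_mem[OF that]] 1 by simp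
  qed
  have inj: "inj_on e ?J"
    by (rule inj_onI) (metis ip_e mem_Collect_eq zero_neq_one)
  have f1n: "f1 \<notin> e ` ?J" using o1(1) n1 by auto
  have on: "orthonormal (insert f1 (e ` ?J)) id"
    unfolding orthonormal_def using o1 n1 f1H e_mem f1n inj by (auto simp: ip_e dest: inj_onD)
  have "insert f1 (e ` ?J) \<subseteq> ?E" using f1 e_eigen by auto
  then have "card (insert f1 (e ` ?J)) \<le> card b"
    using cfun.independent_span_bound[OF finb orthonormal_independent[OF on]] b(3) by blast
  moreover have "card (insert f1 (e ` ?J)) = Suc (card ?J)"
    using f1n finite_eigenvalue_indices[OF \<mu>] card_image[OF inj] by simp
  ultimately show False using card_eigenvalue[OF \<mu>] b(4) by simp
qed

definition G :: "('a \<Rightarrow> complex) set" where "G = {f \<in> H. \<forall>j\<ge>1. ip f (e j) = 0}"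

lemma G_H: "f \<in> G \<Longrightarrow> f \<in> H" and G_orth: "f \<in> G \<Longrightarrow> 1 \<le> j \<Longrightarrow> ip f (e j) = 0"
  by (auto simp: G_def)

lemma subspace_G: "cfun.subspace G"
  by (rule cfun.subspaceI) (auto simp: G_def ip_add ip_scale e_mem)

text \<open>Were the form \<open>q\<close> nonzero on the complement \<open>G\<close> of all \<open>e j\<close>, then by weak compactness it would
  attain its supremum \<open>\<mu>\<close> on the unit ball of \<open>G\<close>, and a maximizer would be an eigenvector for
  \<open>\<mu>\<close> that is missing from the sequence.\<close>

lemma q_complement:
  assumes "f0 \<in> G"
  shows "q f0 = 0"
proof (rule ccontr)
  assume "q f0 \<noteq> 0"
  then have q0: "q f0 > 0" using q_nonneg[OF G_H[OF assms]] by simp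
  then have n0: "nsq f0 > 0" using q_le[OF G_H[OF assms]] ip_nonneg[OF G_H[OF assms]]
    by (cases "nsq f0 = 0") auto
  have q_scale: "q (fscale (of_real c) f) = c\<^sup>2 * q f" if "f \<in> H" for c f
    using that l2_cnj[of f "fscale (of_real c) f"]
    by (simp add: l2_scale[of _ _ f] l2_scale[of _ _ "fscale _ f"] power2_eq_square)
  let ?U = "{f \<in> G. nsq f \<le> 1}"
  define \<mu> where "\<mu> = Sup (q ` ?U)"
  have bdd: "bdd_above (q ` ?U)"
  proof (rule bdd_aboveI2)
    fix f assume f: "f \<in> ?U"
    have "nsq f * tr \<le> 1 * tr" using f tr_nonneg by (intro mult_right_mono) auto
    then show "q f \<le> tr" using q_le[of f] f G_H by auto
  qed
  have norml: "q f \<le> \<mu> * nsq f" if f: "f \<in> G" for f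
  proof (cases "nsq f = 0")
    case True
    then show ?thesis using q_le[OF G_H[OF f]] by simp
  next
    case False
    then have pos: "nsq f > 0" using ip_nonneg[OF G_H[OF f]] by simp
    let ?g = "fscale (of_real (1 / sqrt (nsq f))) f"
    have g: "?g \<in> G" using subspace_G f by (rule cfun.subspace_scale)
    have "nsq ?g \<le> 1" by (rule eq_refl[OF nsq_normalize[OF G_H[OF f] pos]])
    then have "q ?g \<le> \<mu>" unfolding \<mu>_def using g bdd by (intro cSup_upper) auto
    moreover have "q ?g = q f / nsq f"
      using q_scale[OF G_H[OF f], of "1 / sqrt (nsq f)"] pos by (simp add: power_divide)
    ultimately show ?thesis using pos by (simp add: divide_le_eq)
  qed
  have \<mu>pos: "0 < \<mu>" using norml[OF assms] q0 n0 by (smt (verit) zero_less_mult_pos2)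
  have "\<exists>f\<in>?U. \<mu> - 1 / real (Suc n) < q f" for n
  proof -
    have "0 \<in> ?U" using cfun.subspace_0[OF subspace_G] by simp
    then have "q ` ?U \<noteq> {}" by blast
    moreover have "\<mu> - 1 / real (Suc n) < Sup (q ` ?U)" by (simp add: \<mu>_def)
    ultimately have "\<exists>y\<in>q ` ?U. \<mu> - 1 / real (Suc n) < y" by (rule less_cSupD)
    then show ?thesis by blast
  qed
  then have "\<forall>n. \<exists>f. f \<in> ?U \<and> \<mu> - 1 / real (Suc n) < q f" by blast
  from choice[OF this] obtain F where "\<And>n. F n \<in> ?U \<and> \<mu> - 1 / real (Suc n) < q (F n)" by blast
  then have F: "\<And>n. F n \<in> G" "\<And>n. nsq (F n) \<le> 1" and Fq: "\<And>n. \<mu> - 1 / real (Suc n) < q (F n)"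
    by blast+
  obtain r f where r: "strict_mono (r :: nat \<Rightarrow> nat)" and f: "f \<in> H"
    and lim: "\<And>g. g \<in> H \<Longrightarrow> (\<lambda>k. ip g (F (r k))) \<longlonglongrightarrow> ip g f"
    by (rule weak_sequential_compactness[of F, OF separable G_H[OF F(1)] F(2)]) blast
  have fG: "f \<in> G"
    unfolding G_def
  proof (intro CollectI conjI allI impI f)
    fix j :: nat assume j: "1 \<le> j"
    have "ip (e j) (F (r k)) = 0" for k
      using ip_cnj[OF G_H[OF F(1)] e_mem[OF j], of "r k"] G_orth[OF F(1) j] by simp
    then have "ip (e j) f = 0" using lim[OF e_mem[OF j]] by (simp add: LIMSEQ_const_iff)
    then show "ip f (e j) = 0" using ip_cnj[OF e_mem[OF j] f] by simp
  qed
  have "nsq f \<le> 1"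
  proof -
    have "(\<lambda>k. (cmod (ip f (F (r k))))\<^sup>2) \<longlonglongrightarrow> (cmod (ip f f))\<^sup>2" by (intro tendsto_intros lim f)
    moreover have "(cmod (ip f (F (r k))))\<^sup>2 \<le> nsq f" for k
    proof -
      have "nsq f * nsq (F (r k)) \<le> nsq f * 1" by (intro mult_left_mono F ip_nonneg f)
      then show ?thesis using ip_cauchy_schwarz[OF f G_H[OF F(1)], of "r k"] by simp
    qed
    ultimately have "(cmod (ip f f))\<^sup>2 \<le> nsq f" by (meson LIMSEQ_le_const2)
    then have "nsq f * nsq f \<le> nsq f * 1"
      using ip_self[OF f] ip_nonneg[OF f] by (metis norm_of_real power2_abs power2_eq_square mult_1_right)
    then show ?thesis using ip_nonneg[OF f] by (cases "nsq f = 0") (auto simp: mult_le_cancel_left)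
  qed
  have "\<mu> \<le> q f"
  proof -
    have "(\<lambda>k. q (F (r k))) \<longlonglongrightarrow> q f"
      by (rule q_weakly_continuous[OF G_H[OF F(1)] F(2) f lim])
    moreover have "(\<lambda>k. \<mu> - inverse (real (Suc (r k)))) \<longlonglongrightarrow> \<mu> - 0"
      using LIMSEQ_subseq_LIMSEQ[OF LIMSEQ_inverse_real_of_nat r]
      by (intro tendsto_diff tendsto_const) (simp add: comp_def)
    moreover have "\<mu> - inverse (real (Suc (r k))) \<le> q (F (r k))" for k
      using Fq[of "r k"] by (simp add: inverse_eq_divide)
    ultimately have "\<mu> - 0 \<le> q f" by (intro LIMSEQ_le) auto
    then show ?thesis by simp
  qed
  \<comment> \<open>By maximality this form is positive semidefinite on \<open>G\<close>, and at the
    maximizer it is not positive. Cauchy-Schwarz then annihilates all its values against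
    \<open>f\<close>, which replaces a first variation.\<close>
  let ?B = "\<lambda>g h. of_real \<mu> * ip g h - l2_inner M g h"
  have "\<mu> * nsq f \<le> \<mu> * 1" using \<open>nsq f \<le> 1\<close> \<mu>pos by (intro mult_left_mono) auto
  then have "Re (?B f f) \<le> 0" using \<open>\<mu> \<le> q f\<close> by simp
  have B0: "?B g f = 0" if g: "g \<in> G" for g
  proof -
    have "(cmod (?B g f))\<^sup>2 \<le> Re (?B g g) * Re (?B f f)"
    proof (rule psd_form_cauchy_schwarz[OF subspace_G, where B = ?B])
      show "?B h g = cnj (?B g h)" if "g \<in> G" "h \<in> G" for g h
        using that ip_cnj[of g h] l2_cnj[of h g] G_H by simp
    qed (use g fG norml in \<open>auto simp: G_H ip_add ip_scale l2_add l2_scale algebra_simps\<close>)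
    moreover have "Re (?B g g) * Re (?B f f) \<le> 0"
      using norml[OF g] \<open>Re (?B f f) \<le> 0\<close> by (intro mult_nonneg_nonpos) auto
    ultimately have "(cmod (?B g f))\<^sup>2 \<le> 0" by (rule order_trans)
    then show ?thesis by simp
  qed
  have Tf: "T f \<in> H" "\<And>g. g \<in> H \<Longrightarrow> ip g (T f) = l2_inner M g f" using gram_spec[OF f] by auto
  \<comment> \<open>So far the eigenvalue equation is only known when tested on \<open>G\<close>.
    The complement is invariant under \<open>T\<close>, so the defect itself lies in
    \<open>G\<close> and can be tested against itself.\<close>
  let ?g = "fscale (of_real \<mu>) f - T f"
  have gH: "?g \<in> H" using f Tf by simp
  have "?g \<in> G"
    unfolding G_def
  proof (intro CollectI conjI allI impI gH)
    fix j :: nat assume j: "1 \<le> j"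
    have "ip (e j) f = 0" using ip_cnj[OF f e_mem[OF j]] G_orth[OF fG j] by simp
    then have "ip (e j) (T f) = 0" using Tf(2)[OF e_mem[OF j]] l2_e_left[OF f j] by simp
    then have "ip (T f) (e j) = 0" using ip_cnj[OF e_mem[OF j] Tf(1)] by simp
    then show "ip ?g (e j) = 0" using G_orth[OF fG j] f Tf e_mem[OF j] by (simp add: ip_diff ip_scale)
  qed
  have "ip ?g ?g = of_real \<mu> * ip ?g f - ip ?g (T f)"
    using gH f Tf by (subst ip_diff_right) (auto simp: ip_scale_right)
  also have "\<dots> = ?B ?g f" using Tf(2)[OF gH] by simp
  also have "\<dots> = 0" using \<open>?g \<in> G\<close> by (rule B0)
  finally have "?g = 0" by (rule ip_definite[OF gH])
  then have "f \<in> eigenspace H T \<mu>" using f by (simp add: eigenspace_def)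
  then have "f = 0" using eigenvector_orthogonal_trivial[OF \<mu>pos] G_orth[OF fG] by blast
  then have "q f = 0" using q_le[OF f] q_nonneg[OF f] by simp
  then show False using \<open>\<mu> \<le> q f\<close> \<mu>pos by simp
qed

text \<open>The exceptional null set has to serve all of \<open>G\<close> at once. A countable dense
  subset of \<open>G\<close> provides it, and point evaluation, being bounded, extends the vanishing
  to the rest.\<close>

lemma G_vanishes_AE: "AE x in M. \<forall>g\<in>G. g x = 0"
proof -
  have "G \<subseteq> H" using G_H by blast
  then obtain S where S: "countable S" "S \<subseteq> G"
    and dense: "\<And>f \<epsilon>. f \<in> G \<Longrightarrow> \<epsilon> > 0 \<Longrightarrow> \<exists>g\<in>S. hnorm ip (f - g) < \<epsilon>"
    using separable_subset[OF separable] by metis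
  have "AE x in M. \<forall>g\<in>S. g x = 0"
  proof (subst AE_ball_countable[OF S(1)], intro ballI)
    fix g assume "g \<in> S"
    then have g: "g \<in> G" "g \<in> H" using S G_H by auto
    have "(LINT x|M. (cmod (g x))\<^sup>2) = 0" using q_complement[OF g(1)] q_eq[OF g(2)] by simp
    then have "AE x in M. (cmod (g x))\<^sup>2 = 0"
      using integral_nonneg_eq_0_iff_AE[OF integrable_sq[OF g(2)]] by simp
    then show "AE x in M. g x = 0" by eventually_elim simp
  qed
  then show ?thesis
  proof (rule AE_mp, intro AE_I2 impI ballI)
    fix x g assume x: "x \<in> space M" and Sx: "\<forall>g\<in>S. g x = 0" and g: "g \<in> G"
    have xD: "x \<in> D" using x space_M by simp
    have K0: "0 \<le> Re (K x x)" by (rule kernel_diag_nonneg[OF xD])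
    show "g x = 0"
    proof (rule ccontr)
      assume "g x \<noteq> 0"
      \<comment> \<open>The summand 1 keeps the denominator positive if \<open>K x x\<close>
        vanishes, and it makes the final estimate strict.\<close>
      define \<epsilon> where "\<epsilon> = cmod (g x) / sqrt (Re (K x x) + 1)"
      have "\<epsilon> > 0" using \<open>g x \<noteq> 0\<close> K0 by (simp add: \<epsilon>_def)
      then obtain s where s: "s \<in> S" "hnorm ip (g - s) < \<epsilon>" using dense[OF g] by blast
      have sH: "s \<in> H" "g \<in> H" using s g S G_H by auto
      have "s x = 0" using Sx s(1) by blast
      then have "(cmod (g x))\<^sup>2 = (cmod ((g - s) x))\<^sup>2" by simp
      also have "\<dots> \<le> nsq (g - s) * Re (K x x)" by (rule eval_bound[OF H_diff[OF sH(2,1)] xD])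
      also have "\<dots> \<le> \<epsilon>\<^sup>2 * Re (K x x)"
      proof (rule mult_right_mono[OF _ K0])
        have "(hnorm ip (g - s))\<^sup>2 \<le> \<epsilon>\<^sup>2"
          using s(2) hnorm_nonneg[of "g - s"] sH by (intro power_mono) auto
        then show "nsq (g - s) \<le> \<epsilon>\<^sup>2" using hnorm_sq[of "g - s"] sH by simp
      qed
      also have "\<dots> = (cmod (g x))\<^sup>2 * (Re (K x x) / (Re (K x x) + 1))"
        using K0 by (simp add: \<epsilon>_def power_divide)
      also have "\<dots> < (cmod (g x))\<^sup>2 * 1"
        using \<open>g x \<noteq> 0\<close> K0 by (intro mult_strict_left_mono) auto
      finally show False by simp
    qed
  qed
qed

lemma summable_e_sq:
  assumes f: "f \<in> H"
  shows "summable (\<lambda>j. (cmod (ip f (e (Suc j))))\<^sup>2)"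
proof (rule summableI_nonneg_bounded)
  fix n
  have "(\<Sum>j<n. (cmod (ip f (e (Suc j))))\<^sup>2) = (\<Sum>j\<in>Suc ` {..<n}. (cmod (ip f (e j)))\<^sup>2)"
    by (simp add: sum.reindex)
  also have "\<dots> \<le> nsq f" by (rule bessel) (auto intro: e_orthonormal_subset f)
  finally show "(\<Sum>j<n. (cmod (ip f (e (Suc j))))\<^sup>2) \<le> nsq f" .
qed simp

lemma expansion_converges:
  assumes f: "f \<in> H"
  shows "\<exists>p\<in>H. (\<lambda>n. hnorm ip (proj {1..n} e f - p)) \<longlonglongrightarrow> 0"
proof (rule complete)
  have on: "orthonormal {1..n} e" for n by (rule e_orthonormal_subset) auto
  show "proj {1..n} e f \<in> H" for n by (rule proj_mem[OF on])
  fix \<epsilon> :: real assume e: "\<epsilon> > 0"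
  let ?c = "\<lambda>j. (cmod (ip f (e j)))\<^sup>2"
  obtain N where N: "\<And>m n. m \<ge> N \<Longrightarrow> norm (\<Sum>j=m..<n. ?c (Suc j)) < \<epsilon>\<^sup>2"
    using summable_Cauchy[THEN iffD1, OF summable_e_sq[OF f]] e by (metis zero_less_power)
  have step: "hnorm ip (proj {1..j} e f - proj {1..i} e f) < \<epsilon>" if "N \<le> i" "i \<le> j" for i j
  proof -
    have "{1..j} = {1..i} \<union> {i+1..j}" "{1..i} \<inter> {i+1..j} = {}" using that by auto
    then have "proj {1..j} e f - proj {1..i} e f = (\<Sum>k\<in>{i+1..j}. fscale (ip f (e k)) (e k))"
      unfolding proj_def by (simp add: sum.union_disjoint)
    then have "nsq (proj {1..j} e f - proj {1..i} e f) = (\<Sum>k\<in>{i+1..j}. ?c k)"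
      by (simp add: nsq_comb e_orthonormal_subset)
    also have "\<dots> = (\<Sum>k=i..<j. ?c (Suc k))"
      by (rule sum.reindex_bij_witness[of _ Suc "\<lambda>k. k - 1"]) auto
    also have "\<dots> < \<epsilon>\<^sup>2" using N[OF that(1), of j] by simp
    finally show ?thesis unfolding hnorm_def using e by (simp add: real_less_lsqrt)
  qed
  have "hnorm ip (proj {1..i} e f - proj {1..j} e f) < \<epsilon>" if "N \<le> i" "N \<le> j" for i j
    using step[of i j] step[of j i] that hnorm_minus_commute[OF proj_mem[OF on] proj_mem[OF on], of i f j f]
    by (cases "i \<le> j") auto
  then show "\<exists>N. \<forall>i\<ge>N. \<forall>j\<ge>N. hnorm ip (proj {1..i} e f - proj {1..j} e f) < \<epsilon>" by blast
qed

text \<open>Only almost everywhere, since the embedding may have a kernel, on which the eigenvectors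
  see nothing. With \<open>p\<close> the limit of the expansion of the section, the defect
  \<open>?h\<close> lies in \<open>G\<close>. It is orthogonal to \<open>p\<close>, and also to the
  section because it vanishes at \<open>x\<close>; hence it is 0.\<close>

lemma kernel_diag_expansion_AE: "AE x in M. (\<lambda>j. (cmod (e (Suc j) x))\<^sup>2) sums Re (K x x)"
  using G_vanishes_AE
proof (rule AE_mp, intro AE_I2 impI)
  fix x assume "x \<in> space M" and Gx: "\<forall>g\<in>G. g x = 0"
  then have x: "x \<in> D" by (simp add: space_M)
  let ?k = "kernel_section D K x"
  let ?s = "\<lambda>n. proj {1..n} e ?k"
  have k: "?k \<in> H" by (rule section_mem[OF x])
  have on: "orthonormal {1..n} e" for n by (rule e_orthonormal_subset) auto
  have s: "?s n \<in> H" for n by (rule proj_mem[OF on])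
  obtain p where p: "p \<in> H" "(\<lambda>n. hnorm ip (?s n - p)) \<longlonglongrightarrow> 0"
    using expansion_converges[OF k] by blast
  let ?h = "?k - p"
  have h: "?h \<in> H" using k p by simp
  have "?h \<in> G"
    unfolding G_def
  proof (intro CollectI conjI allI impI h)
    fix j :: nat assume j: "1 \<le> j"
    have "(\<lambda>n. ip (?s n) (e j)) \<longlonglongrightarrow> ip p (e j)"
      by (rule convergent_seq_ip_left[OF s p e_mem[OF j]])
    moreover have "(\<lambda>n. ip (?s n) (e j)) \<longlonglongrightarrow> ip ?k (e j)"
    proof (rule tendsto_eventually, rule eventually_sequentiallyI[of j])
      fix n assume "j \<le> n"
      then show "ip (?s n) (e j) = ip ?k (e j)" using j by (intro ip_proj_basis on) auto
    qed
    ultimately have "ip p (e j) = ip ?k (e j)" by (rule LIMSEQ_unique)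
    then show "ip ?h (e j) = 0" using k p e_mem[OF j] by (simp add: ip_diff)
  qed
  have "ip ?h p = 0"
  proof -
    have "(\<lambda>n. ip ?h (?s n)) \<longlonglongrightarrow> ip ?h p" by (rule convergent_seq_ip[OF s p h])
    moreover have "ip ?h (?s n) = 0" for n
      using G_orth[OF \<open>?h \<in> G\<close>] by (intro ip_proj_right on k h) auto
    ultimately show ?thesis by (simp add: LIMSEQ_const_iff)
  qed
  moreover have "?h x = 0" using Gx \<open>?h \<in> G\<close> by blast
  then have "ip ?h ?k = 0" using reproducing[OF h x] by metis
  ultimately have "ip ?h ?h = 0" using h k p by (subst ip_diff_right) auto
  then have "?h = 0" by (rule ip_definite[OF h])
  then have "p = ?k" by simp
  have "(\<lambda>n. ip ?k (?s n)) \<longlonglongrightarrow> ip ?k ?k" using convergent_seq_ip[OF s p k] \<open>p = ?k\<close> by simp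
  then have "(\<lambda>n. Re (ip ?k (?s n))) \<longlonglongrightarrow> Re (K x x)"
    using tendsto_Re nsq_section[OF x] by metis
  moreover have "Re (ip ?k (?s n)) = (\<Sum>j<n. (cmod (e (Suc j) x))\<^sup>2)" for n
  proof -
    have "ip ?k (?s n) = (\<Sum>j\<in>{1..n}. cnj (ip ?k (e j)) * ip ?k (e j))"
      unfolding proj_def using k by (subst ip_sum_right) (auto simp: e_mem ip_scale_right)
    also have "\<dots> = (\<Sum>j\<in>{1..n}. of_real ((cmod (e j x))\<^sup>2))"
      unfolding complex_norm_square using x by (intro sum.cong refl) (auto simp: ip_section e_mem)
    also have "\<dots> = of_real (\<Sum>j\<in>{1..n}. (cmod (e j x))\<^sup>2)" by simp
    finally have "Re (ip ?k (?s n)) = (\<Sum>j\<in>{1..n}. (cmod (e j x))\<^sup>2)" by (simp only: Re_complex_of_real)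
    also have "\<dots> = (\<Sum>j<n. (cmod (e (Suc j) x))\<^sup>2)"
      by (rule sum.reindex_bij_witness[of _ Suc "\<lambda>k. k - 1"]) auto
    finally show ?thesis .
  qed
  ultimately show "(\<lambda>j. (cmod (e (Suc j) x))\<^sup>2) sums Re (K x x)" by (simp add: sums_def)
qed

text \<open>Termwise integration of the diagonal expansion. Equality is essential: it makes the
  residual traces tend to 0 and identifies the series of squared singular numbers with a difference
  of traces.\<close>

theorem trace_formula: "(\<lambda>j. lam (Suc j)) sums tr"
proof -
  have int: "(LINT x|M. (cmod (e (Suc j) x))\<^sup>2) = lam (Suc j)" for j
    using q_eq[OF e_mem, of "Suc j"] q_e[of "Suc j"] by simp
  have summ: "summable (\<lambda>j. lam (Suc j))"
  proof (rule summableI_nonneg_bounded)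
    fix n
    have "(\<Sum>j<n. lam (Suc j)) = sum lam (Suc ` {..<n})" by (simp add: sum.reindex)
    also have "\<dots> \<le> tr" by (rule sum_lam_le) auto
    finally show "(\<Sum>j<n. lam (Suc j)) \<le> tr" .
  qed (simp add: lam_pos less_imp_le)
  have "(\<lambda>j. LINT x|M. (cmod (e (Suc j) x))\<^sup>2) sums (LINT x|M. (\<Sum>j. (cmod (e (Suc j) x))\<^sup>2))"
  proof (rule sums_integral)
    show "integrable M (\<lambda>x. (cmod (e (Suc j) x))\<^sup>2)" for j by (intro integrable_sq e_mem) simp
    show "AE x in M. summable (\<lambda>j. norm ((cmod (e (Suc j) x))\<^sup>2))"
      using kernel_diag_expansion_AE by eventually_elim (simp add: sums_summable)
    show "summable (\<lambda>j. LINT x|M. norm ((cmod (e (Suc j) x))\<^sup>2))" using summ by (simp add: int)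
  qed
  moreover have "(LINT x|M. (\<Sum>j. (cmod (e (Suc j) x))\<^sup>2)) = tr"
    unfolding tr_def
  proof (rule integral_cong_AE)
    show "(\<lambda>x. \<Sum>j. (cmod (e (Suc j) x))\<^sup>2) \<in> borel_measurable M"
      using measurable_H[OF e_mem] by measurable
    show "AE x in M. (\<Sum>j. (cmod (e (Suc j) x))\<^sup>2) = Re (K x x)"
      using kernel_diag_expansion_AE by eventually_elim (simp add: sums_iff)
  qed (use trace_class in auto)
  ultimately show ?thesis by (simp add: int)
qed

lemma integrable_residual_kernel: "integrable M (residual_kernel {1..N} e)"
  unfolding residual_kernel_def[abs_def]
  by (intro Bochner_Integration.integrable_diff Bochner_Integration.integrable_sum trace_class
      integrable_sq e_mem) auto

lemma integral_residual_kernel: "(LINT x|M. residual_kernel {1..N} e x) = tr - sum lam {1..N}"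
proof -
  have int: "integrable M (\<lambda>x. (cmod (e j x))\<^sup>2)" if "j \<in> {1..N}" for j
    using that by (intro integrable_sq e_mem) auto
  have "(LINT x|M. residual_kernel {1..N} e x) = tr - (\<Sum>j\<in>{1..N}. (LINT x|M. (cmod (e j x))\<^sup>2))"
    unfolding residual_kernel_def tr_def using int
    by (subst Bochner_Integration.integral_diff) (auto intro: trace_class simp: Bochner_Integration.integral_sum)
  also have "(\<Sum>j\<in>{1..N}. (LINT x|M. (cmod (e j x))\<^sup>2)) = sum lam {1..N}"
    using q_eq[OF e_mem] q_e by (intro sum.cong refl) auto
  finally show ?thesis .
qed

lemma residual_trace_tendsto: "(\<lambda>N. tr - sum lam {1..N}) \<longlonglongrightarrow> 0"
proof -
  have "(\<lambda>N. \<Sum>j<N. lam (Suc j)) \<longlonglongrightarrow> tr" using trace_formula by (simp add: sums_def)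
  moreover have "(\<Sum>j<N. lam (Suc j)) = sum lam {1..N}" for N
    by (rule sum.reindex_bij_witness[of _ "\<lambda>k. k - 1" Suc]) auto
  ultimately have "(\<lambda>N. sum lam {1..N}) \<longlonglongrightarrow> tr" by simp
  then have "(\<lambda>N. tr - sum lam {1..N}) \<longlonglongrightarrow> tr - tr" by (intro tendsto_intros)
  then show ?thesis by simp
qed

lemma q_le_residual:
  assumes f: "f \<in> H" and orth: "\<And>j. j \<in> {1..N} \<Longrightarrow> ip f (e j) = 0"
  shows "q f \<le> nsq f * (tr - sum lam {1..N})"
proof -
  have on: "orthonormal {1..N} e" by (rule e_orthonormal_subset) auto
  have "q f \<le> (LINT x|M. nsq f * residual_kernel {1..N} e x)"
    unfolding q_eq[OF f]
  proof (intro integral_mono integrable_sq f)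
    show "integrable M (\<lambda>x. nsq f * residual_kernel {1..N} e x)"
      using integrable_residual_kernel by simp
    show "(cmod (f x))\<^sup>2 \<le> nsq f * residual_kernel {1..N} e x" if "x \<in> space M" for x
      using that by (intro residual_eval_bound[OF on _ _ f orth]) (auto simp: space_M)
  qed
  also have "\<dots> = nsq f * (LINT x|M. residual_kernel {1..N} e x)" by simp
  finally show ?thesis by (simp only: integral_residual_kernel)
qed

text \<open>Cuts \<open>f\<close> at \<open>N\<close>: on the expansion up to \<open>N\<close> the
  ordering of the eigenvalues bounds the form by \<open>lam m\<close>, and the rest is bounded by
  the residual trace, which vanishes as \<open>N\<close> grows.\<close>

lemma q_tail_le:
  assumes m: "1 \<le> m" and f: "f \<in> H" and orth: "\<And>j. j \<in> {1..<m} \<Longrightarrow> ip f (e j) = 0"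
  shows "q f \<le> lam m * nsq f"
proof -
  have *: "q f \<le> lam m * nsq f + nsq f * (tr - sum lam {1..N})" for N
  proof -
    have on: "orthonormal {1..N} e" by (rule e_orthonormal_subset) auto
    let ?p = "proj {1..N} e f" and ?c = "\<lambda>j. ip f (e j)"
    let ?r = "f - ?p"
    have pH: "?p \<in> H" and rH: "?r \<in> H" using f on by simp_all
    have r_orth: "ip ?r (e j) = 0" if "j \<in> {1..N}" for j by (rule ip_diff_proj_basis[OF on _ f that]) simp
    have l2_p: "l2_inner M ?p g = (\<Sum>j\<in>{1..N}. ?c j * (of_real (lam j) * ip (e j) g))" if g: "g \<in> H" for g
    proof -
      have "l2_inner M ?p g = (\<Sum>j\<in>{1..N}. ?c j * l2_inner M (e j) g)"
        unfolding proj_def using e_mem g by (intro l2_sum_left) auto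
      also have "\<dots> = (\<Sum>j\<in>{1..N}. ?c j * (of_real (lam j) * ip (e j) g))"
        by (intro sum.cong refl) (simp add: l2_e_left[OF g])
      finally show ?thesis .
    qed
    have pr: "l2_inner M ?p ?r = 0"
    proof -
      have "ip (e j) ?r = 0" if "j \<in> {1..N}" for j
        using ip_cnj[OF rH e_mem, of j] r_orth[OF that] that by simp
      then show ?thesis unfolding l2_p[OF rH] by (intro sum.neutral) auto
    qed
    have "l2_inner M ?p ?p = (\<Sum>j\<in>{1..N}. of_real (lam j * (cmod (?c j))\<^sup>2))"
      unfolding l2_p[OF pH]
    proof (intro sum.cong refl)
      fix j assume j: "j \<in> {1..N}"
      have "ip (e j) ?p = cnj (?c j)"
        using ip_cnj[OF pH e_mem, of j] ip_proj_basis[OF on _ j, of f] j by simp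
      then have "?c j * (of_real (lam j) * ip (e j) ?p) = of_real (lam j) * (?c j * cnj (?c j))" by simp
      then show "?c j * (of_real (lam j) * ip (e j) ?p) = of_real (lam j * (cmod (?c j))\<^sup>2)"
        by (simp only: complex_norm_square of_real_mult)
    qed
    then have "q ?p = (\<Sum>j\<in>{1..N}. lam j * (cmod (?c j))\<^sup>2)" by (simp del: of_real_mult of_real_power)
    also have "\<dots> \<le> (\<Sum>j\<in>{1..N}. lam m * (cmod (?c j))\<^sup>2)"
    proof (intro sum_mono)
      fix j assume j: "j \<in> {1..N}"
      show "lam j * (cmod (?c j))\<^sup>2 \<le> lam m * (cmod (?c j))\<^sup>2"
        using orth[of j] j lam_mono[OF m, of j] by (cases "j < m") (auto intro: mult_right_mono)
    qed
    also have "\<dots> = lam m * (\<Sum>j\<in>{1..N}. (cmod (?c j))\<^sup>2)" by (simp add: sum_distrib_left)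
    also have "\<dots> \<le> lam m * nsq f"
      using bessel[OF on _ f] lam_pos[OF m] by (intro mult_left_mono) auto
    finally have qp: "q ?p \<le> lam m * nsq f" .
    have "nsq ?r \<le> nsq f"
      using nsq_diff_proj[OF on _ f] sum_nonneg[of "{1..N}" "\<lambda>j. (cmod (?c j))\<^sup>2"] by simp
    moreover have "0 \<le> tr - sum lam {1..N}" using sum_lam_le[of "{1..N}"] by auto
    ultimately have "nsq ?r * (tr - sum lam {1..N}) \<le> nsq f * (tr - sum lam {1..N})"
      by (rule mult_right_mono)
    with q_le_residual[OF rH r_orth] have qr: "q ?r \<le> nsq f * (tr - sum lam {1..N})"
      by (rule order_trans)
    have "q f = q ?r + q ?p"
      using q_add_orthogonal[OF rH pH pr] by (simp only: diff_add_cancel)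
    then show ?thesis using qp qr by linarith
  qed
  have "(\<lambda>N. lam m * nsq f + nsq f * (tr - sum lam {1..N})) \<longlonglongrightarrow> lam m * nsq f + nsq f * 0"
    by (intro tendsto_intros residual_trace_tendsto)
  then have "q f \<le> lam m * nsq f + nsq f * 0" using * by (meson LIMSEQ_le_const)
  then show ?thesis by simp
qed

end

section \<open>Concentration of sums of random rank-one matrices\<close>

lemma borel_measurable_cnj [measurable (raw)]:
  "f \<in> borel_measurable M \<Longrightarrow> (\<lambda>x. cnj (f x)) \<in> borel_measurable M"
  by (rule measurable_compose[OF _ borel_measurable_continuous_onI]) (auto intro: continuous_intros)

text \<open>Integrating out the last node plays the role of conditional expectation. The additive
  term \<open>d\<close> carries the truncation error of the lower tail and the summands of the
  Markov estimate for the far tail.\<close>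

lemma nn_integral_PiM_recursion:
  fixes \<mu> :: "'a measure" and \<Psi> :: "nat \<Rightarrow> (nat \<Rightarrow> 'a) \<Rightarrow> ennreal"
  assumes "prob_space \<mu>"
    and meas: "\<And>k. k \<le> n \<Longrightarrow> \<Psi> k \<in> borel_measurable (PiM {1..k} (\<lambda>_. \<mu>))"
    and step: "\<And>k X. k < n \<Longrightarrow> X \<in> space (PiM {1..k} (\<lambda>_. \<mu>)) \<Longrightarrow>
        (\<integral>\<^sup>+x. \<Psi> (Suc k) (X(Suc k := x)) \<partial>\<mu>) \<le> c * \<Psi> k X + d"
    and init: "\<Psi> 0 (\<lambda>_. undefined) \<le> z"
  shows "(\<integral>\<^sup>+X. \<Psi> n X \<partial>PiM {1..n} (\<lambda>_. \<mu>)) \<le> c ^ n * z + (\<Sum>i<n. c ^ i) * d"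
proof -
  interpret prob_space \<mu> by fact
  interpret product_sigma_finite "\<lambda>_::nat. \<mu>" by unfold_locales
  interpret P: product_prob_space "\<lambda>_::nat. \<mu>" UNIV by unfold_locales
  have "k \<le> n \<Longrightarrow> (\<integral>\<^sup>+X. \<Psi> k X \<partial>PiM {1..k} (\<lambda>_. \<mu>)) \<le> c ^ k * z + (\<Sum>i<k. c ^ i) * d" for k
  proof (induction k)
    case 0
    \<comment> \<open>The product over the empty index set is the point mass at the function that is
      undefined everywhere, hence the form of \<open>init\<close>.\<close>
    show ?case using init by (simp add: PiM_empty nn_integral_count_space_finite)
  next
    case (Suc k)
    have ins: "{1..Suc k} = insert (Suc k) {1..k}" by auto
    interpret Pk: prob_space "PiM {1..k} (\<lambda>_. \<mu>)" by (rule prob_space_PiM) (rule assms(1))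
    have "(\<integral>\<^sup>+X. \<Psi> (Suc k) X \<partial>PiM {1..Suc k} (\<lambda>_. \<mu>)) =
        (\<integral>\<^sup>+X. (\<integral>\<^sup>+x. \<Psi> (Suc k) (X(Suc k := x)) \<partial>\<mu>) \<partial>PiM {1..k} (\<lambda>_. \<mu>))"
      unfolding ins using meas[OF Suc.prems] unfolding ins
      by (intro product_nn_integral_insert) auto
    also have "\<dots> \<le> (\<integral>\<^sup>+X. c * \<Psi> k X + d \<partial>PiM {1..k} (\<lambda>_. \<mu>))"
      using Suc.prems by (intro nn_integral_mono step) auto
    also have "\<dots> = c * (\<integral>\<^sup>+X. \<Psi> k X \<partial>PiM {1..k} (\<lambda>_. \<mu>)) + d"
      using meas[of k] Suc.prems Pk.emeasure_space_1
      by (simp add: nn_integral_add nn_integral_cmult)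
    also have "\<dots> \<le> c * (c ^ k * z + (\<Sum>i<k. c ^ i) * d) + d"
      using Suc by (intro add_mono mult_left_mono) auto
    also have "\<dots> = c ^ Suc k * z + (\<Sum>i<Suc k. c ^ i) * d"
      by (simp only: sum.lessThan_Suc_shift) (simp add: distrib_left distrib_right sum_distrib_left mult.assoc
          sum_distrib_right add.commute add.left_commute)
    finally show ?case .
  qed
  then show ?thesis by simp
qed

lemma app_on_apply: "app_on I a v i = (\<Sum>k\<in>I. a i k * v k)"
  by (simp add: app_on_def)

lemma unit_at_same: "unit_at k k = 1"
  by (simp add: unit_at_def)

lemma app_on_pow_expand:
  assumes "finite I" "i \<in> I"
  shows "(app_on I a ^^ p) v i = (\<Sum>k\<in>I. (app_on I a ^^ p) (unit_at k) i * v k)"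
  using assms(2)
proof (induction p arbitrary: i)
  case 0
  then show ?case using assms(1) by (simp add: unit_at_def if_distrib if_distribR cong: if_cong)
next
  case (Suc p)
  have "(app_on I a ^^ Suc p) v i = (\<Sum>l\<in>I. a i l * (app_on I a ^^ p) v l)"
    by (simp add: app_on_apply)
  also have "\<dots> = (\<Sum>l\<in>I. a i l * (\<Sum>k\<in>I. (app_on I a ^^ p) (unit_at k) l * v k))"
    using Suc.IH by (intro sum.cong refl) metis
  also have "\<dots> = (\<Sum>l\<in>I. \<Sum>k\<in>I. a i l * (app_on I a ^^ p) (unit_at k) l * v k)"
    by (simp add: sum_distrib_left mult.assoc)
  also have "\<dots> = (\<Sum>k\<in>I. \<Sum>l\<in>I. a i l * (app_on I a ^^ p) (unit_at k) l * v k)"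
    by (rule sum.swap)
  also have "\<dots> = (\<Sum>k\<in>I. (app_on I a ^^ Suc p) (unit_at k) i * v k)"
    by (simp add: app_on_apply sum_distrib_right)
  finally show ?case .
qed

text \<open>Exhibits the form as a fixed linear combination of the products
  \<open>v k * cnj (v i)\<close>, whose expectations are covariances.\<close>

lemma qpow_expand:
  assumes "finite I"
  shows "qpow I a p v = Re (\<Sum>i\<in>I. \<Sum>k\<in>I. (app_on I a ^^ p) (unit_at k) i * (v k * cnj (v i)))"
proof -
  have "inner_on I ((app_on I a ^^ p) v) v =
      (\<Sum>i\<in>I. (\<Sum>k\<in>I. (app_on I a ^^ p) (unit_at k) i * v k) * cnj (v i))"
    unfolding inner_on_def by (intro sum.cong refl) (subst app_on_pow_expand[OF assms], simp_all)
  then show ?thesis by (simp add: qpow_def sum_distrib_right mult.assoc)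
qed

lemma app_on_pow_measurable:
  assumes "\<And>i j. i \<in> I \<Longrightarrow> j \<in> I \<Longrightarrow> (\<lambda>x. A x i j) \<in> borel_measurable M" "i \<in> I"
  shows "(\<lambda>x. (app_on I (A x) ^^ p) v i) \<in> borel_measurable M"
  using assms(2)
proof (induction p arbitrary: i)
  case (Suc p)
  then show ?case using assms(1)
    by (auto simp: app_on_apply intro!: borel_measurable_sum borel_measurable_times)
qed simp

lemma exp_tr_measurable:
  assumes "\<And>i j. i \<in> I \<Longrightarrow> j \<in> I \<Longrightarrow> (\<lambda>x. A x i j) \<in> borel_measurable M"
  shows "(\<lambda>x. exp_tr I t q (A x)) \<in> borel_measurable M"
  unfolding exp_tr_def trpow_def qpow_def inner_on_def
  by (intro borel_measurable_sum borel_measurable_times borel_measurable_const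
      measurable_compose[OF _ borel_measurable_Re] borel_measurable_cnj app_on_pow_measurable assms) auto

lemma trpow_0: "finite I \<Longrightarrow> trpow I a 0 = real (card I)"
  by (simp add: trpow_def qpow_def inner_on_unit_left unit_at_same)

lemma exp_tr_mono:
  assumes "psd_on I a" "0 \<le> t" "p \<le> q"
  shows "exp_tr I t p a \<le> exp_tr I t q a"
  unfolding exp_tr_def using assms by (intro sum_mono2) (auto simp: trpow_nonneg)

lemma exp_tr_nonneg: "psd_on I a \<Longrightarrow> 0 \<le> t \<Longrightarrow> 0 \<le> exp_tr I t q a"
  unfolding exp_tr_def by (intro sum_nonneg) (auto simp: trpow_nonneg)

text \<open>Degree 0 contributes \<open>card I\<close> to the trace but only 1 at a single vector.
  Removing it from both sides keeps the dimension out of the upper tail.\<close>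

lemma exp_tr_minus_card_ge:
  assumes I: "finite I" "psd_on I a" and t: "0 \<le> t" and c: "(\<Sum>i\<in>I. (cmod (c i))\<^sup>2) = 1"
    and s: "0 \<le> s" "s \<le> qpow I a 1 c"
  shows "(\<Sum>p\<le>q. (t * s) ^ p / fact p) - 1 \<le> exp_tr I t q a - real (card I)"
proof -
  have "(\<Sum>p\<le>q. (t * s) ^ p / fact p) - 1 = (\<Sum>p\<in>{..q} - {0}. (t * s) ^ p / fact p)"
    by (subst sum.remove[of "{..q}" 0]) auto
  also have "\<dots> \<le> (\<Sum>p\<in>{..q} - {0}. t ^ p / fact p * trpow I a p)"
    by (intro sum_mono exp_tr_term_ge[OF I t c s])
  also have "\<dots> = exp_tr I t q a - real (card I)"
  proof -
    have "exp_tr I t q a = t ^ 0 / fact 0 * trpow I a 0 + (\<Sum>p\<in>{..q} - {0}. t ^ p / fact p * trpow I a p)"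
      unfolding exp_tr_def by (rule sum.remove) auto
    then show ?thesis using trpow_0[OF I(1), of a] by simp
  qed
  finally show ?thesis .
qed

text \<open>The price of truncation in Markov's inequality: the factor 2 of the upper tail bound and
  half of the factor 4 of the lower one.\<close>

lemma exp_partial_sum_ge_half:
  fixes x :: real
  shows "\<forall>\<^sub>F q in sequentially. exp x / 2 \<le> (\<Sum>p\<le>q. x ^ p / fact p)"
proof -
  have "(\<lambda>n. x ^ n / fact n) sums exp x"
    using exp_converges[of x] by (simp add: divide_inverse mult.commute)
  then have "(\<lambda>q. \<Sum>p\<le>q. x ^ p / fact p) \<longlonglongrightarrow> exp x" by (simp add: sums_def_le)
  then have "\<forall>\<^sub>F q in sequentially. exp x / 2 < (\<Sum>p\<le>q. x ^ p / fact p)"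
    by (rule order_tendstoD) simp
  then show ?thesis by eventually_elim simp
qed

section \<open>Gram matrices of sampled vectors\<close>

definition gram_on :: "('a \<Rightarrow> 'i \<Rightarrow> complex) \<Rightarrow> nat \<Rightarrow> (nat \<Rightarrow> 'a) \<Rightarrow> 'i \<Rightarrow> 'i \<Rightarrow> complex" where
  "gram_on v k X = (\<lambda>i j. \<Sum>l\<in>{1..k}. v (X l) i * cnj (v (X l) j))"

text \<open>Bounds the Gram matrix from below. Adding a sample lowers this matrix by a rank-one term, so
  the rank-one estimates are applied to it with the roles of old and new matrix exchanged.\<close>

definition cogram_on ::
    "real \<Rightarrow> ('a \<Rightarrow> 'i \<Rightarrow> complex) \<Rightarrow> nat \<Rightarrow> (nat \<Rightarrow> 'a) \<Rightarrow> 'i \<Rightarrow> 'i \<Rightarrow> complex" where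
  "cogram_on N v k X = (\<lambda>i j. (if i = j then of_real N else 0) - gram_on v k X i j)"

lemma gram_on_Suc: "gram_on v (Suc k) (X(Suc k := x)) = rank_one_update (gram_on v k X) (v x)"
proof -
  have ins: "{1..Suc k} = insert (Suc k) {1..k}" by auto
  show ?thesis unfolding gram_on_def rank_one_update_def ins
    by (intro ext) (subst sum.insert, auto simp: add.commute intro!: sum.cong)
qed

lemma cogram_on_Suc: "rank_one_update (cogram_on N v (Suc k) (X(Suc k := x))) (v x) = cogram_on N v k X"
  unfolding cogram_on_def gram_on_Suc by (auto simp: rank_one_update_def fun_eq_iff)

lemma cogram_on_0: "cogram_on N v 0 X = (\<lambda>i j. if i = j then of_real N else 0)"
  by (auto simp: cogram_on_def gram_on_def fun_eq_iff)

lemma app_gram_on: "app_on I (gram_on v k X) c = (\<lambda>i. \<Sum>l\<in>{1..k}. inner_on I c (v (X l)) * v (X l) i)"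
proof
  fix i
  have "app_on I (gram_on v k X) c i = (\<Sum>j\<in>I. \<Sum>l\<in>{1..k}. v (X l) i * cnj (v (X l) j) * c j)"
    by (simp add: app_on_def gram_on_def sum_distrib_right)
  also have "\<dots> = (\<Sum>l\<in>{1..k}. \<Sum>j\<in>I. v (X l) i * cnj (v (X l) j) * c j)" by (rule sum.swap)
  finally show "app_on I (gram_on v k X) c i = (\<Sum>l\<in>{1..k}. inner_on I c (v (X l)) * v (X l) i)"
    by (simp add: inner_on_def sum_distrib_left mult.commute mult.left_commute)
qed

lemma inner_gram_on:
  "inner_on I (app_on I (gram_on v k X) c) c = of_real (\<Sum>l\<in>{1..k}. (cmod (inner_on I c (v (X l))))\<^sup>2)"
proof -
  have "inner_on I (app_on I (gram_on v k X) c) c =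
      (\<Sum>i\<in>I. \<Sum>l\<in>{1..k}. inner_on I c (v (X l)) * (v (X l) i * cnj (c i)))"
    unfolding app_gram_on by (simp add: inner_on_def[of I _ c] sum_distrib_right mult.assoc)
  also have "\<dots> = (\<Sum>l\<in>{1..k}. \<Sum>i\<in>I. inner_on I c (v (X l)) * (v (X l) i * cnj (c i)))"
    by (rule sum.swap)
  also have "\<dots> = (\<Sum>l\<in>{1..k}. inner_on I c (v (X l)) * inner_on I (v (X l)) c)"
    by (simp add: inner_on_def[of I _ c] sum_distrib_left)
  also have "\<dots> = (\<Sum>l\<in>{1..k}. of_real ((cmod (inner_on I c (v (X l))))\<^sup>2))"
    unfolding complex_norm_square using inner_on_cnj[of I _ c] by (intro sum.cong refl) simp
  finally show ?thesis by simp
qed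

lemma qpow_gram_on: "qpow I (gram_on v k X) 1 c = (\<Sum>l\<in>{1..k}. (cmod (inner_on I c (v (X l))))\<^sup>2)"
  unfolding qpow_def using inner_gram_on[of I v k X c] by (simp del: of_real_sum of_real_power)

lemma inner_cogram_on:
  assumes "finite I"
  shows "inner_on I (app_on I (cogram_on N v k X) c) c =
    of_real (N * (\<Sum>i\<in>I. (cmod (c i))\<^sup>2) - (\<Sum>l\<in>{1..k}. (cmod (inner_on I c (v (X l))))\<^sup>2))"
proof -
  have "app_on I (cogram_on N v k X) c i = of_real N * c i - app_on I (gram_on v k X) c i" if "i \<in> I" for i
  proof -
    have "app_on I (cogram_on N v k X) c i =
        (\<Sum>j\<in>I. (if j = i then of_real N * c j else 0) - gram_on v k X i j * c j)"
      unfolding app_on_apply by (intro sum.cong refl) (simp add: cogram_on_def left_diff_distrib)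
    then show ?thesis using assms that by (simp add: sum_subtractf app_on_apply)
  qed
  then have "inner_on I (app_on I (cogram_on N v k X) c) c =
      inner_on I (\<lambda>i. of_real N * c i - app_on I (gram_on v k X) c i) c"
    by (simp add: inner_on_def)
  also have "\<dots> = of_real N * inner_on I c c - inner_on I (app_on I (gram_on v k X) c) c"
    by (simp only: inner_on_diff_left inner_on_scale_left)
  finally show ?thesis unfolding inner_gram_on inner_on_self by simp
qed

lemma qpow_cogram_on:
  "finite I \<Longrightarrow> qpow I (cogram_on N v k X) 1 c =
    N * (\<Sum>i\<in>I. (cmod (c i))\<^sup>2) - (\<Sum>l\<in>{1..k}. (cmod (inner_on I c (v (X l))))\<^sup>2)"
  unfolding qpow_def using inner_cogram_on[of I N v k X c]
  by (simp del: of_real_sum of_real_power of_real_diff of_real_mult)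

lemma psd_on_gram_on: "psd_on I (gram_on v k X)"
  unfolding psd_on_def inner_gram_on
  by (auto simp: gram_on_def mult.commute sum_nonneg simp del: of_real_sum of_real_power)

lemma inner_on_cauchy_schwarz:
  "(cmod (inner_on I c u))\<^sup>2 \<le> (\<Sum>i\<in>I. (cmod (c i))\<^sup>2) * (\<Sum>i\<in>I. (cmod (u i))\<^sup>2)"
proof -
  have "cmod (inner_on I c u) \<le> (\<Sum>i\<in>I. cmod (c i) * cmod (u i))"
    unfolding inner_on_def by (rule order_trans[OF norm_sum]) (simp add: norm_mult)
  then have "(cmod (inner_on I c u))\<^sup>2 \<le> (\<Sum>i\<in>I. cmod (c i) * cmod (u i))\<^sup>2"
    by (rule power_mono) simp
  also have "\<dots> \<le> (\<Sum>i\<in>I. (cmod (c i))\<^sup>2) * (\<Sum>i\<in>I. (cmod (u i))\<^sup>2)"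
    by (rule Cauchy_Schwarz_ineq_sum)
  finally show ?thesis .
qed

text \<open>By Cauchy-Schwarz each rank-one summand is at most \<open>R\<close> times the identity,
  so \<open>N\<close> only has to dominate \<open>k\<close> of them.\<close>

lemma psd_on_cogram_on:
  assumes "finite I" and R: "\<And>l. l \<in> {1..k} \<Longrightarrow> (\<Sum>i\<in>I. (cmod (v (X l) i))\<^sup>2) \<le> R" and N: "real k * R \<le> N"
  shows "psd_on I (cogram_on N v k X)"
  unfolding psd_on_def
proof (intro conjI allI ballI)
  fix i j
  show "cogram_on N v k X j i = cnj (cogram_on N v k X i j)"
    by (auto simp: cogram_on_def gram_on_def mult.commute)
next
  fix c
  let ?s = "\<Sum>i\<in>I. (cmod (c i))\<^sup>2"
  have "(\<Sum>l\<in>{1..k}. (cmod (inner_on I c (v (X l))))\<^sup>2) \<le> (\<Sum>l\<in>{1..k}. ?s * R)"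
  proof (intro sum_mono)
    fix l assume "l \<in> {1..k}"
    then have "?s * (\<Sum>i\<in>I. (cmod (v (X l) i))\<^sup>2) \<le> ?s * R"
      using R by (intro mult_left_mono sum_nonneg) auto
    then show "(cmod (inner_on I c (v (X l))))\<^sup>2 \<le> ?s * R"
      using inner_on_cauchy_schwarz[of I c "v (X l)"] by linarith
  qed
  also have "\<dots> = ?s * (real k * R)" by simp
  also have "\<dots> \<le> ?s * N" using N by (intro mult_left_mono sum_nonneg) auto
  finally show "0 \<le> Re (inner_on I (app_on I (cogram_on N v k X) c) c)"
    unfolding inner_cogram_on[OF assms(1)] by (simp add: mult.commute)
qed

lemma gram_on_measurable:
  assumes "\<And>i. i \<in> I \<Longrightarrow> (\<lambda>x. v x i) \<in> borel_measurable \<mu>" "i \<in> I" "j \<in> I"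
  shows "(\<lambda>X. gram_on v k X i j) \<in> borel_measurable (PiM {1..k} (\<lambda>_. \<mu>))"
  unfolding gram_on_def
proof (intro borel_measurable_sum borel_measurable_times borel_measurable_cnj)
  fix l assume l: "l \<in> {1..k}"
  show "(\<lambda>X. v (X l) i) \<in> borel_measurable (PiM {1..k} (\<lambda>_. \<mu>))"
    "(\<lambda>X. v (X l) j) \<in> borel_measurable (PiM {1..k} (\<lambda>_. \<mu>))"
    using l assms by (auto intro!: measurable_compose[OF measurable_component_singleton])
qed

lemma markov_sublevel:
  assumes "prob_space N" and f: "f \<in> borel_measurable N" "\<And>X. 0 \<le> f X"
    and int: "(\<integral>\<^sup>+X. ennreal (f X) \<partial>N) \<le> ennreal z" and z: "0 \<le> z" and \<theta>: "0 < (\<theta> :: real)"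
  shows "measure N {X \<in> space N. \<theta> \<le> f X} \<le> z / \<theta>"
proof -
  interpret N: prob_space N by fact
  have "{X \<in> space N. \<theta> \<le> f X} \<subseteq> {X \<in> space N. 1 \<le> ennreal (1 / \<theta>) * ennreal (f X)}"
    using f(2) \<theta> by (auto simp: ennreal_mult[symmetric] field_simps simp flip: ennreal_1 intro!: ennreal_leI)
  then have "emeasure N {X \<in> space N. \<theta> \<le> f X} \<le> emeasure N {X \<in> space N. 1 \<le> ennreal (1 / \<theta>) * ennreal (f X)}"
    using f(1) by (intro emeasure_mono) measurable
  also have "\<dots> \<le> ennreal (1 / \<theta>) * (\<integral>\<^sup>+X. ennreal (f X) * indicator (space N) X \<partial>N)"
    using nn_integral_Markov_inequality[of "\<lambda>X. ennreal (f X)" "space N" N "ennreal (1 / \<theta>)"] f(1)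
    by (simp add: Int_absorb1 Collect_restrict Int_absorb2)
  also have "(\<integral>\<^sup>+X. ennreal (f X) * indicator (space N) X \<partial>N) = (\<integral>\<^sup>+X. ennreal (f X) \<partial>N)"
    by (intro nn_integral_cong) simp
  also have "ennreal (1 / \<theta>) * \<dots> \<le> ennreal (1 / \<theta>) * ennreal z"
    using int by (intro mult_left_mono) auto
  also have "\<dots> = ennreal (z / \<theta>)" using z \<theta> by (simp flip: ennreal_mult)
  finally show ?thesis unfolding N.emeasure_eq_measure using z \<theta> by (simp add: ennreal_le_iff)
qed

section \<open>Tail bounds for the extreme eigenvalues of random Gram matrices\<close>

locale random_vector = prob_space \<mu> for \<mu> :: "'a measure" +
  fixes I :: "'i set" and v :: "'a \<Rightarrow> 'i \<Rightarrow> complex" and R :: real and w :: "'i \<Rightarrow> real"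
  assumes finite_I: "finite I"
    and v_measurable: "\<And>i. i \<in> I \<Longrightarrow> (\<lambda>x. v x i) \<in> borel_measurable \<mu>"
    and v_bound: "\<And>x. x \<in> space \<mu> \<Longrightarrow> (\<Sum>i\<in>I. (cmod (v x i))\<^sup>2) \<le> R"
    and v_cov: "\<And>i k. i \<in> I \<Longrightarrow> k \<in> I \<Longrightarrow>
        (LINT x|\<mu>. v x i * cnj (v x k)) = (if i = k then of_real (w i) else 0)"
begin

abbreviation P :: "nat \<Rightarrow> (nat \<Rightarrow> 'a) measure" where "P k \<equiv> PiM {1..k} (\<lambda>_. \<mu>)"

lemma space_P: "X \<in> space (P k) \<Longrightarrow> l \<in> {1..k} \<Longrightarrow> X l \<in> space \<mu>"
  by (auto simp: space_PiM)

lemma integrable_v_prod: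
  assumes i: "i \<in> I" and k: "k \<in> I"
  shows "integrable \<mu> (\<lambda>x. v x i * cnj (v x k))"
proof (rule integrable_const_bound[where B = R])
  show "(\<lambda>x. v x i * cnj (v x k)) \<in> borel_measurable \<mu>"
    using v_measurable i k by (intro borel_measurable_times borel_measurable_cnj)
  show "AE x in \<mu>. norm (v x i * cnj (v x k)) \<le> R"
  proof (rule AE_I2)
    fix x assume x: "x \<in> space \<mu>"
    have le: "(cmod (v x j))\<^sup>2 \<le> R" if "j \<in> I" for j
      using member_le_sum[OF that, of "\<lambda>i. (cmod (v x i))\<^sup>2"] finite_I v_bound[OF x] by force
    have "0 \<le> (cmod (v x i) - cmod (v x k))\<^sup>2" by simp
    then have "2 * (cmod (v x i) * cmod (v x k)) \<le> (cmod (v x i))\<^sup>2 + (cmod (v x k))\<^sup>2"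
      by (simp add: power2_diff)
    then show "norm (v x i * cnj (v x k)) \<le> R" using le[OF i] le[OF k] by (simp add: norm_mult)
  qed
qed

text \<open>As the covariance is diagonal, only the diagonal entries of A^p survive the expectation,
  weighted by \<open>w\<close>.\<close>

lemma integrable_qpow: "integrable \<mu> (\<lambda>x. qpow I a p (v x))"
  and expectation_qpow: "(LINT x|\<mu>. qpow I a p (v x)) = (\<Sum>i\<in>I. w i * qpow I a p (unit_at i))"
proof -
  let ?f = "\<lambda>x. \<Sum>i\<in>I. \<Sum>k\<in>I. (app_on I a ^^ p) (unit_at k) i * (v x k * cnj (v x i))"
  have f: "integrable \<mu> ?f"
    by (intro Bochner_Integration.integrable_sum integrable_mult_right integrable_v_prod)
  then show "integrable \<mu> (\<lambda>x. qpow I a p (v x))"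
    unfolding qpow_expand[OF finite_I] by (rule integrable_Re)
  have "(LINT x|\<mu>. qpow I a p (v x)) = Re (LINT x|\<mu>. ?f x)"
    unfolding qpow_expand[OF finite_I] using f by (rule integral_Re)
  also have "(LINT x|\<mu>. ?f x) = (\<Sum>i\<in>I. \<Sum>k\<in>I. (app_on I a ^^ p) (unit_at k) i * (if k = i then of_real (w k) else 0))"
    by (subst Bochner_Integration.integral_sum,
        auto intro!: Bochner_Integration.integrable_sum integrable_mult_right integrable_v_prod sum.cong
          simp: Bochner_Integration.integral_sum integrable_v_prod v_cov)
  also have "\<dots> = (\<Sum>i\<in>I. (app_on I a ^^ p) (unit_at i) i * of_real (w i))"
    using finite_I by (simp add: if_distrib cong: if_cong)
  also have "Re \<dots> = (\<Sum>i\<in>I. w i * qpow I a p (unit_at i))"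
    using finite_I by (simp add: qpow_def inner_on_unit_right mult.commute)
  finally show "(LINT x|\<mu>. qpow I a p (v x)) = (\<Sum>i\<in>I. w i * qpow I a p (unit_at i))" .
qed

lemma integrable_exp_qpow: "integrable \<mu> (\<lambda>x. exp_qpow I t q a (v x))"
  unfolding exp_qpow_def by (intro Bochner_Integration.integrable_sum integrable_mult_right integrable_qpow)

lemma expectation_exp_qpow:
  "(LINT x|\<mu>. exp_qpow I t q a (v x)) = (\<Sum>p\<le>q. t ^ p / fact p * (\<Sum>i\<in>I. w i * qpow I a p (unit_at i)))"
  unfolding exp_qpow_def
  by (subst Bochner_Integration.integral_sum, intro integrable_mult_right integrable_qpow)
    (simp only: integral_mult_right_zero expectation_qpow)

lemma gram_on_P_measurable:
  "(\<lambda>X. exp_tr I t q (gram_on v k X)) \<in> borel_measurable (P k)"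
  by (intro exp_tr_measurable gram_on_measurable v_measurable)

lemma cogram_on_P_measurable:
  "(\<lambda>X. exp_tr I t q (cogram_on N v k X)) \<in> borel_measurable (P k)"
  unfolding cogram_on_def
  by (intro exp_tr_measurable borel_measurable_diff gram_on_measurable v_measurable borel_measurable_const)

lemma prob_space_P: "prob_space (P k)"
  by (rule prob_space_PiM) (rule prob_space_axioms)

lemma normalize_vector:
  fixes c :: "'i \<Rightarrow> complex"
  assumes "(\<Sum>i\<in>I. (cmod (c i))\<^sup>2) \<noteq> 0"
  obtains d where "(\<Sum>i\<in>I. (cmod (d i))\<^sup>2) = 1"
    "\<And>u. (cmod (inner_on I d u))\<^sup>2 = (cmod (inner_on I c u))\<^sup>2 / (\<Sum>i\<in>I. (cmod (c i))\<^sup>2)"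
proof -
  let ?s = "\<Sum>i\<in>I. (cmod (c i))\<^sup>2"
  have "0 \<le> ?s" by (intro sum_nonneg) simp
  then have s: "?s > 0" using assms by simp
  let ?d = "\<lambda>i. of_real (1 / sqrt ?s) * c i"
  have sq: "(cmod (of_real (1 / sqrt ?s) * z))\<^sup>2 = (cmod z)\<^sup>2 / ?s" for z
  proof -
    have "(cmod (of_real (1 / sqrt ?s) * z))\<^sup>2 = (1 / sqrt ?s)\<^sup>2 * (cmod z)\<^sup>2"
      by (simp only: norm_mult norm_of_real power_mult_distrib power2_abs)
    also have "(1 / sqrt ?s)\<^sup>2 = 1 / ?s" using s by (simp add: power_divide)
    finally show ?thesis by simp
  qed
  show ?thesis
  proof (rule that[of ?d])
    show "(\<Sum>i\<in>I. (cmod (?d i))\<^sup>2) = 1" unfolding sq using s by (simp flip: sum_divide_distrib)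
    show "(cmod (inner_on I ?d u))\<^sup>2 = (cmod (inner_on I c u))\<^sup>2 / ?s" for u
      unfolding inner_on_scale_left sq ..
  qed
qed

text \<open>One node multiplies the expectation of the tracked quantity by at most
  \<open>1 + a\<close>: degree 0 of the expected form contributes the trace of the covariance, at
  most \<open>S\<close>, and higher degrees at most \<open>L\<close> times the trace. Markov's
  inequality after \<open>n\<close> nodes gives the bound, with \<open>n\<close> where the dimension
  would stand.\<close>

theorem upper_tail:
  assumes w: "\<And>i. i \<in> I \<Longrightarrow> 0 \<le> w i" "\<And>i. i \<in> I \<Longrightarrow> w i \<le> L" "sum w I \<le> S" and L: "0 \<le> L"
    and n: "1 \<le> n" and t: "0 \<le> t" and s: "0 \<le> s"
    and a: "a = t * exp (t * R) * (L + S / real n)"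
  shows "\<exists>B\<in>sets (P n). measure (P n) B \<le> 2 * real n * exp (real n * a - t * s) \<and>
    (\<forall>X\<in>space (P n) - B. \<forall>c. (\<Sum>l\<in>{1..n}. (cmod (inner_on I c (v (X l))))\<^sup>2) \<le> s * (\<Sum>i\<in>I. (cmod (c i))\<^sup>2))"
proof -
  have S: "0 \<le> S" using w(1,3) by (meson order_trans sum_nonneg)
  have a0: "0 \<le> a" unfolding a using t L S by simp
  obtain q0 where q0: "exp (t * s) / 2 \<le> (\<Sum>p\<le>q0. (t * s) ^ p / fact p)"
    using exp_partial_sum_ge_half[of "t * s"] by (auto simp: eventually_sequentially)
  define q where "q = Suc q0"
  have "(\<Sum>p\<le>q0. (t * s) ^ p / fact p) \<le> (\<Sum>p\<le>q. (t * s) ^ p / fact p)"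
    unfolding q_def using t s by simp
  with q0 have \<theta>: "exp (t * s) / 2 \<le> (\<Sum>p\<le>q. (t * s) ^ p / fact p)" by (rule order_trans)
  \<comment> \<open>This starts at \<open>n\<close> for the zero matrix and never falls below
    \<open>n\<close>, so the additive \<open>S\<close> per node is at most \<open>S / n\<close>
    times the current value.\<close>
  define f where "f k X = exp_tr I t q (gram_on v k X) - real (card I) + real n" for k X
  have card_le: "real (card I) \<le> exp_tr I t q' (gram_on v k X)" for k X q'
  proof -
    have "exp_tr I t 0 (gram_on v k X) \<le> exp_tr I t q' (gram_on v k X)"
      by (intro exp_tr_mono psd_on_gram_on t) simp
    then show ?thesis by (simp add: exp_tr_def trpow_0 finite_I)
  qed
  have f_pos: "0 \<le> f k X" for k X using card_le unfolding f_def by (simp add: add_nonneg_nonneg)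
  have main: "(\<integral>\<^sup>+X. ennreal (f n X) \<partial>P n) \<le> ennreal (1 + a) ^ n * ennreal (real n) + (\<Sum>i<n. ennreal (1 + a) ^ i) * 0"
  proof (rule nn_integral_PiM_recursion[OF prob_space_axioms])
    show "(\<lambda>X. ennreal (f k X)) \<in> borel_measurable (P k)" for k
      unfolding f_def using gram_on_P_measurable by measurable
    have "gram_on v 0 X = (\<lambda>_ _. 0)" for X by (simp add: gram_on_def)
    moreover have "exp_tr I t q (\<lambda>_ _. 0) = real (card I)"
    proof -
      have "trpow I (\<lambda>_ _. 0) p = 0" if "p \<noteq> 0" for p
        using that by (cases p) (auto simp: trpow_def qpow_def app_on_def inner_on_def)
      then have "exp_tr I t q (\<lambda>_ _. 0) = (\<Sum>p\<le>q. if p = 0 then real (card I) else 0)"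
        unfolding exp_tr_def by (intro sum.cong) (auto simp: trpow_0 finite_I)
      then show ?thesis by simp
    qed
    ultimately show "ennreal (f 0 (\<lambda>_. undefined)) \<le> ennreal (real n)" by (simp add: f_def)
    fix k X assume X: "X \<in> space (P k)"
    let ?A = "gram_on v k X"
    have psd: "psd_on I ?A" by (rule psd_on_gram_on)
    let ?g = "\<lambda>x. f k X + t * exp (t * R) * exp_qpow I t q0 ?A (v x)"
    have int: "integrable \<mu> ?g" by (intro Bochner_Integration.integrable_add integrable_mult_right integrable_exp_qpow) simp
    have le: "f (Suc k) (X(Suc k := x)) \<le> ?g x" if "x \<in> space \<mu>" for x
      using exp_tr_rank_one_update_upper[OF finite_I psd t v_bound[OF that], of q0]
      unfolding f_def gram_on_Suc q_def by simp
    have "(\<integral>\<^sup>+x. ennreal (f (Suc k) (X(Suc k := x))) \<partial>\<mu>) \<le> (\<integral>\<^sup>+x. ennreal (?g x) \<partial>\<mu>)"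
      by (intro nn_integral_mono ennreal_leI le)
    also have "\<dots> = ennreal (LINT x|\<mu>. ?g x)"
      using order_trans[OF f_pos le] by (intro nn_integral_eq_integral int AE_I2) auto
    finally have nn: "(\<integral>\<^sup>+x. ennreal (f (Suc k) (X(Suc k := x))) \<partial>\<mu>) \<le> ennreal (LINT x|\<mu>. ?g x)" .
    have "(LINT x|\<mu>. ?g x) = f k X + t * exp (t * R) * (LINT x|\<mu>. exp_qpow I t q0 ?A (v x))"
      by (simp add: integrable_exp_qpow prob_space)
    also have "\<dots> \<le> f k X + t * exp (t * R) * (S + L * (exp_tr I t q ?A - real (card I)))"
    proof (intro add_left_mono mult_left_mono)
      have "(LINT x|\<mu>. exp_qpow I t q0 ?A (v x)) =
          (\<Sum>p\<le>q0. t ^ p / fact p * (\<Sum>i\<in>I. w i * qpow I ?A p (unit_at i)))"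
        by (rule expectation_exp_qpow)
      also have "\<dots> \<le> (\<Sum>p\<le>q0. (if p = 0 then S else 0) + L * (t ^ p / fact p * trpow I ?A p - (if p = 0 then real (card I) else 0)))"
      proof (intro sum_mono)
        fix p
        show "t ^ p / fact p * (\<Sum>i\<in>I. w i * qpow I ?A p (unit_at i)) \<le>
          (if p = 0 then S else 0) + L * (t ^ p / fact p * trpow I ?A p - (if p = 0 then real (card I) else 0))"
        proof (cases "p = 0")
          case True
          have "(\<Sum>i\<in>I. w i * qpow I ?A 0 (unit_at i)) = sum w I"
            using finite_I by (intro sum.cong refl) (simp add: qpow_def inner_on_unit_left unit_at_same)
          then show ?thesis using True w(3) by (simp add: trpow_0 finite_I)
        next
          case False
          have "(\<Sum>i\<in>I. w i * qpow I ?A p (unit_at i)) \<le> (\<Sum>i\<in>I. L * qpow I ?A p (unit_at i))"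
            using w by (intro sum_mono mult_right_mono qpow_nonneg psd) auto
          also have "\<dots> = L * trpow I ?A p" by (simp add: trpow_def sum_distrib_left)
          finally have "t ^ p / fact p * (\<Sum>i\<in>I. w i * qpow I ?A p (unit_at i)) \<le> t ^ p / fact p * (L * trpow I ?A p)"
            using t by (intro mult_left_mono) auto
          then show ?thesis using False by (simp add: mult.left_commute)
        qed
      qed
      also have "\<dots> = S + L * (exp_tr I t q0 ?A - real (card I))"
        by (simp add: sum.distrib sum_subtractf exp_tr_def flip: sum_distrib_left)
      also have "\<dots> \<le> S + L * (exp_tr I t q ?A - real (card I))"
        using exp_tr_mono[OF psd t, of q0 q] L by (intro add_left_mono mult_left_mono) (auto simp: q_def)
      finally show "(LINT x|\<mu>. exp_qpow I t q0 ?A (v x)) \<le> S + L * (exp_tr I t q ?A - real (card I))" .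
    qed (use t in auto)
    also have "\<dots> \<le> (1 + a) * f k X"
    proof -
      have "S + L * (exp_tr I t q ?A - real (card I)) \<le> (L + S / real n) * f k X"
      proof -
        have "S = S / real n * real n" using n by simp
        also have "\<dots> \<le> S / real n * f k X"
          using card_le S by (intro mult_left_mono) (auto simp: f_def)
        finally have "S \<le> S / real n * f k X" .
        moreover have "L * (exp_tr I t q ?A - real (card I)) \<le> L * f k X"
          using L by (intro mult_left_mono) (auto simp: f_def)
        ultimately show ?thesis by (simp add: distrib_right)
      qed
      then have "t * exp (t * R) * (S + L * (exp_tr I t q ?A - real (card I))) \<le> t * exp (t * R) * ((L + S / real n) * f k X)"
        using t by (intro mult_left_mono) auto
      then show ?thesis by (simp add: a algebra_simps)
    qed
    finally have "ennreal (LINT x|\<mu>. ?g x) \<le> ennreal ((1 + a) * f k X)" by (rule ennreal_leI)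
    with nn have "(\<integral>\<^sup>+x. ennreal (f (Suc k) (X(Suc k := x))) \<partial>\<mu>) \<le> ennreal ((1 + a) * f k X)"
      by (rule order_trans)
    then show "(\<integral>\<^sup>+x. ennreal (f (Suc k) (X(Suc k := x))) \<partial>\<mu>) \<le> ennreal (1 + a) * ennreal (f k X) + 0"
      using a0 f_pos by (simp only: ennreal_mult add_0_right add_nonneg_nonneg zero_le_one)
  qed
  let ?B = "{X \<in> space (P n). exp (t * s) / 2 \<le> f n X}"
  have B: "?B \<in> sets (P n)" unfolding f_def using gram_on_P_measurable by measurable
  have "(\<integral>\<^sup>+X. ennreal (f n X) \<partial>P n) \<le> ennreal ((1 + a) ^ n * real n)"
    using main a0 by (simp add: ennreal_mult ennreal_power del: ennreal_plus)
  then have "measure (P n) ?B \<le> (1 + a) ^ n * real n / (exp (t * s) / 2)"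
    using a0 f_pos gram_on_P_measurable unfolding f_def[abs_def]
    by (intro markov_sublevel[OF prob_space_P]) auto
  also have "\<dots> = 2 / exp (t * s) * ((1 + a) ^ n * real n)" by simp
  also have "\<dots> \<le> 2 / exp (t * s) * (exp (real n * a) * real n)"
  proof -
    have "(1 + a) ^ n \<le> exp a ^ n" using a0 by (intro power_mono exp_ge_add_one_self) auto
    then show ?thesis by (intro mult_left_mono mult_right_mono) (auto simp: exp_of_nat_mult)
  qed
  also have "\<dots> = 2 * real n * exp (real n * a - t * s)" by (simp add: exp_diff)
  finally have prob: "measure (P n) ?B \<le> 2 * real n * exp (real n * a - t * s)" .
  have good: "(\<Sum>l\<in>{1..n}. (cmod (inner_on I c (v (X l))))\<^sup>2) \<le> s * (\<Sum>i\<in>I. (cmod (c i))\<^sup>2)"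
    if X: "X \<in> space (P n) - ?B" for X c
  proof (cases "(\<Sum>i\<in>I. (cmod (c i))\<^sup>2) = 0")
    case True
    then have "(cmod (inner_on I c u))\<^sup>2 = 0" for u
      using inner_on_cauchy_schwarz[of I c u] by simp
    then show ?thesis using True by simp
  next
    case False
    let ?s = "\<Sum>i\<in>I. (cmod (c i))\<^sup>2"
    have "0 \<le> ?s" by (intro sum_nonneg) simp
    then have spos: "?s > 0" using False by simp
    obtain d where d: "(\<Sum>i\<in>I. (cmod (d i))\<^sup>2) = 1"
      "\<And>u. (cmod (inner_on I d u))\<^sup>2 = (cmod (inner_on I c u))\<^sup>2 / ?s"
      using normalize_vector[OF False] by blast
    have "qpow I (gram_on v n X) 1 d \<le> s"
    proof (rule ccontr)
      assume "\<not> ?thesis"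
      then have "s \<le> qpow I (gram_on v n X) 1 d" by simp
      from exp_tr_minus_card_ge[OF finite_I psd_on_gram_on t d(1) s this, of q] \<theta>
      have "exp (t * s) / 2 \<le> f n X" using n by (simp add: f_def)
      then show False using X by simp
    qed
    then have "(\<Sum>l\<in>{1..n}. (cmod (inner_on I c (v (X l))))\<^sup>2) / ?s \<le> s"
      unfolding qpow_gram_on d(2) by (simp add: sum_divide_distrib)
    then show ?thesis using spos by (simp add: divide_le_eq)
  qed
  show ?thesis using B prob good by blast
qed

text \<open>A small eigenvalue of the Gram matrix is a large one of \<open>N\<close> times the
  identity minus the Gram matrix. Since the covariance is the identity, each node removes in
  expectation at least the fraction \<open>b\<close> of the trace of the exponential, up to
  truncation; \<open>t \<le> 1\<close> keeps \<open>1 - b\<close> nonnegative.\<close>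

theorem lower_tail:
  assumes w: "\<And>i. i \<in> I \<Longrightarrow> w i = 1" and t: "0 < t" "t \<le> 1" and R: "0 \<le> R" and s: "0 \<le> s"
    and I: "I \<noteq> {}"
  shows "\<exists>B\<in>sets (P n). measure (P n) B \<le> 4 * real (card I) * exp (t * s - real n * (t * exp (- (t * R)))) \<and>
    (\<forall>X\<in>space (P n) - B. \<forall>c. s * (\<Sum>i\<in>I. (cmod (c i))\<^sup>2) \<le> (\<Sum>l\<in>{1..n}. (cmod (inner_on I c (v (X l))))\<^sup>2))"
proof -
  \<comment> \<open>\<open>n * R\<close> keeps the complementary matrix positive semidefinite
    through all nodes. The added \<open>s\<close> makes the threshold \<open>N - s\<close>
    nonnegative.\<close>
  define N where "N = real n * R + s"
  define b where "b = t * exp (- (t * R))"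
  have N: "0 \<le> N" "s \<le> N" using R s by (auto simp: N_def)
  have b: "0 < b" "b \<le> 1"
  proof -
    show "0 < b" using t by (simp add: b_def)
    have "t * exp (- (t * R)) \<le> 1 * 1" using t R by (intro mult_mono) auto
    then show "b \<le> 1" by (simp add: b_def)
  qed
  have card: "0 < real (card I)" using finite_I I by (simp add: card_gt_0_iff)
  \<comment> \<open>Bounds the term of top degree, which is lost in each step because the form is
    truncated one degree lower than the trace.\<close>
  define \<delta> where "\<delta> P = t ^ P / fact P * (real (card I) * N ^ P)" for P
  have \<delta>0: "0 \<le> \<delta> P" for P unfolding \<delta>_def using t N by simp
  have "(\<lambda>P. real (card I) * (inverse (fact P) * (t * N) ^ P)) \<longlonglongrightarrow> real (card I) * 0"
    by (intro tendsto_intros summable_LIMSEQ_zero summable_exp)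
  then have "\<delta> \<longlonglongrightarrow> 0"
    by (simp add: \<delta>_def[abs_def] power_mult_distrib divide_inverse mult.commute mult.left_commute)
  then have "(\<lambda>P. real n * \<delta> (Suc P)) \<longlonglongrightarrow> real n * 0" by (intro tendsto_intros LIMSEQ_Suc)
  \<comment> \<open>The degree is taken so large that the losses of all \<open>n\<close> steps
    together stay below the main term. They at most double it, hence the leading 2 in
    \<open>?z\<close>.\<close>
  then have ev1: "\<forall>\<^sub>F P in sequentially. real n * \<delta> (Suc P) < real (card I) * exp (- (real n * b)) * exp (t * N)"
    using card by (intro order_tendstoD) auto
  have ev2: "\<forall>\<^sub>F P in sequentially. exp (t * (N - s)) / 2 \<le> (\<Sum>p\<le>Suc P. (t * (N - s)) ^ p / fact p)"
    using exp_partial_sum_ge_half[of "t * (N - s)"] by (subst eventually_sequentially_Suc)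
  obtain P0 where P0: "real n * \<delta> (Suc P0) < real (card I) * exp (- (real n * b)) * exp (t * N)"
    "exp (t * (N - s)) / 2 \<le> (\<Sum>p\<le>Suc P0. (t * (N - s)) ^ p / fact p)"
    using eventually_conj[OF ev1 ev2] by (auto simp: eventually_sequentially)
  define q where "q = Suc P0"
  have psd: "psd_on I (cogram_on N v k X)" if "k \<le> n" "\<And>l. l \<in> {1..k} \<Longrightarrow> X l \<in> space \<mu>" for k X
  proof (rule psd_on_cogram_on[OF finite_I])
    show "(\<Sum>i\<in>I. (cmod (v (X l) i))\<^sup>2) \<le> R" if "l \<in> {1..k}" for l
      using v_bound \<open>\<And>l. l \<in> {1..k} \<Longrightarrow> X l \<in> space \<mu>\<close> that by blast
    have "real k * R \<le> real n * R" using that(1) R by (intro mult_right_mono) auto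
    then show "real k * R \<le> N" using s by (simp add: N_def)
  qed
  \<comment> \<open>Markov's inequality is applied to a function that is nonnegative everywhere; for
    nodes in the space the maximum changes nothing.\<close>
  define f where "f k X = max 0 (exp_tr I t q (cogram_on N v k X))" for k X
  have f_eq: "f k X = exp_tr I t q (cogram_on N v k X)" if "k \<le> n" "\<And>l. l \<in> {1..k} \<Longrightarrow> X l \<in> space \<mu>" for k X
    unfolding f_def using exp_tr_nonneg[OF psd[OF that]] t by simp
  have f_meas: "f k \<in> borel_measurable (P k)" for k
    unfolding f_def using cogram_on_P_measurable by measurable
  have tr0: "trpow I (cogram_on N v 0 X) p = real (card I) * N ^ p" for p X
  proof -
    have "(app_on I (cogram_on N v 0 X) ^^ p) u i = of_real (N ^ p) * u i" if "i \<in> I" for u i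
      using that
    proof (induction p arbitrary: i)
      case (Suc p)
      then show ?case using finite_I
        by (simp add: app_on_apply cogram_on_0 if_distrib if_distribR cong: if_cong)
    qed simp
    then have "qpow I (cogram_on N v 0 X) p (unit_at k) = N ^ p" if "k \<in> I" for k
      unfolding qpow_def using that finite_I by (simp add: inner_on_unit_right unit_at_same del: of_real_power)
    then show ?thesis by (simp add: trpow_def)
  qed
  \<comment> \<open>New samples only lower the matrix, and with it the traces of all powers, so the
    initial multiple of the identity gives the bound.\<close>
  have tr_le: "trpow I (cogram_on N v k X) p \<le> real (card I) * N ^ p"
    if "k \<le> n" "\<And>l. l \<in> {1..k} \<Longrightarrow> X l \<in> space \<mu>" for k X p
    using that
  proof (induction k)
    case 0
    then show ?case by (simp add: tr0)
  next
    case (Suc k)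
    let ?A = "cogram_on N v (Suc k) X"
    have psdA: "psd_on I ?A" using Suc.prems by (intro psd) auto
    have "rank_one_update ?A (v (X (Suc k))) = cogram_on N v k X"
      using cogram_on_Suc[of N v k X "X (Suc k)"] by simp
    then have "trpow I ?A p \<le> trpow I (cogram_on N v k X) p"
      using trpow_rank_one_update_bounds(1)[OF finite_I psdA, of p "v (X (Suc k))"] qpow_nonneg[OF psdA, of "p - 1" "v (X (Suc k))"]
      by (smt (verit) mult_nonneg_nonneg of_nat_0_le_iff)
    also have "\<dots> \<le> real (card I) * N ^ p" using Suc by simp
    finally show ?case .
  qed
  let ?c = "1 - b"
  have main: "(\<integral>\<^sup>+X. ennreal (f n X) \<partial>P n) \<le> ennreal ?c ^ n * ennreal (real (card I) * exp (t * N))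
      + (\<Sum>i<n. ennreal ?c ^ i) * ennreal (\<delta> q)"
  proof (rule nn_integral_PiM_recursion[OF prob_space_axioms])
    show "(\<lambda>X. ennreal (f k X)) \<in> borel_measurable (P k)" for k using f_meas by measurable
    have "exp_tr I t q (cogram_on N v 0 (\<lambda>_. undefined)) = real (card I) * (\<Sum>p\<le>q. (t * N) ^ p / fact p)"
      by (simp add: exp_tr_def tr0 sum_distrib_left power_mult_distrib mult.commute mult.left_commute)
    also have "\<dots> \<le> real (card I) * exp (t * N)"
      using t N by (intro mult_left_mono exp_partial_sum_le) auto
    finally show "ennreal (f 0 (\<lambda>_. undefined)) \<le> ennreal (real (card I) * exp (t * N))"
      by (intro ennreal_leI) (subst f_eq, auto)
    fix k X assume k: "k < n" and X: "X \<in> space (P k)"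
    let ?A = "cogram_on N v k X"
    have Xl: "X l \<in> space \<mu>" if "l \<in> {1..k}" for l using space_P[OF X that] .
    have fk: "f k X = exp_tr I t q ?A" using k Xl by (intro f_eq) auto
    have psdA: "psd_on I ?A" using k Xl by (intro psd) auto
    let ?g = "\<lambda>x. f k X - b * exp_qpow I t P0 ?A (v x)"
    have int: "integrable \<mu> ?g"
      by (intro Bochner_Integration.integrable_diff integrable_mult_right integrable_exp_qpow) simp
    have le: "f (Suc k) (X(Suc k := x)) \<le> ?g x" and f0: "0 \<le> f (Suc k) (X(Suc k := x))"
      if x: "x \<in> space \<mu>" for x
    proof -
      let ?X = "X(Suc k := x)"
      have Xl': "?X l \<in> space \<mu>" if "l \<in> {1..Suc k}" for l using that x Xl by auto
      have fS: "f (Suc k) ?X = exp_tr I t q (cogram_on N v (Suc k) ?X)"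
        using k Xl' by (intro f_eq) auto
      have psdS: "psd_on I (cogram_on N v (Suc k) ?X)" using k Xl' by (intro psd) auto
      have "exp_tr I t q (cogram_on N v (Suc k) ?X) + b * exp_qpow I t P0 ?A (v x) \<le> exp_tr I t q ?A"
        using exp_tr_rank_one_update_lower[OF finite_I psdS less_imp_le[OF t(1)] v_bound[OF x], of P0]
        unfolding cogram_on_Suc q_def b_def .
      then show "f (Suc k) ?X \<le> ?g x" unfolding fS fk by linarith
      show "0 \<le> f (Suc k) ?X" by (simp add: f_def)
    qed
    have "(\<integral>\<^sup>+x. ennreal (f (Suc k) (X(Suc k := x))) \<partial>\<mu>) \<le> (\<integral>\<^sup>+x. ennreal (?g x) \<partial>\<mu>)"
      by (intro nn_integral_mono ennreal_leI le)
    also have "\<dots> = ennreal (LINT x|\<mu>. ?g x)"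
      using order_trans[OF f0 le] by (intro nn_integral_eq_integral int AE_I2) auto
    finally have nn: "(\<integral>\<^sup>+x. ennreal (f (Suc k) (X(Suc k := x))) \<partial>\<mu>) \<le> ennreal (LINT x|\<mu>. ?g x)" .
    have "(LINT x|\<mu>. ?g x) = f k X - b * (LINT x|\<mu>. exp_qpow I t P0 ?A (v x))"
      by (simp add: integrable_exp_qpow prob_space)
    also have "(LINT x|\<mu>. exp_qpow I t P0 ?A (v x)) = exp_tr I t P0 ?A"
      unfolding expectation_exp_qpow exp_tr_def trpow_def using w by simp
    also have "exp_tr I t P0 ?A = f k X - t ^ q / fact q * trpow I ?A q"
      unfolding fk by (simp add: exp_tr_def q_def)
    finally have eq: "(LINT x|\<mu>. ?g x) = ?c * f k X + b * (t ^ q / fact q * trpow I ?A q)"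
      by (simp add: algebra_simps)
    have "t ^ q / fact q * trpow I ?A q \<le> \<delta> q"
      unfolding \<delta>_def using t k Xl by (intro mult_left_mono tr_le) auto
    moreover have "0 \<le> t ^ q / fact q * trpow I ?A q" using t trpow_nonneg[OF psdA] by simp
    ultimately have "b * (t ^ q / fact q * trpow I ?A q) \<le> 1 * \<delta> q" using b by (intro mult_mono) auto
    then have "(LINT x|\<mu>. ?g x) \<le> ?c * f k X + \<delta> q" unfolding eq by simp
    then have "ennreal (LINT x|\<mu>. ?g x) \<le> ennreal (?c * f k X + \<delta> q)" by (rule ennreal_leI)
    also have "\<dots> = ennreal ?c * ennreal (f k X) + ennreal (\<delta> q)"
      using b \<delta>0[of q] by (simp add: ennreal_plus ennreal_mult f_def)
    finally show "(\<integral>\<^sup>+x. ennreal (f (Suc k) (X(Suc k := x))) \<partial>\<mu>) \<le> ennreal ?c * ennreal (f k X) + ennreal (\<delta> q)"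
      using nn by (rule order_trans[rotated])
  qed
  let ?z = "2 * (real (card I) * exp (- (real n * b)) * exp (t * N))"
  have "(\<integral>\<^sup>+X. ennreal (f n X) \<partial>P n) \<le> ennreal (?c ^ n * (real (card I) * exp (t * N)) + (\<Sum>i<n. ?c ^ i) * \<delta> q)"
    using main b \<delta>0[of q] by (simp add: ennreal_plus ennreal_mult ennreal_power sum_ennreal sum_nonneg)
  also have "\<dots> \<le> ennreal ?z"
  proof (rule ennreal_leI)
    have "?c ^ n \<le> exp (- b) ^ n" using b exp_ge_add_one_self[of "- b"] by (intro power_mono) auto
    also have "\<dots> = exp (- (real n * b))" by (simp flip: exp_of_nat_mult)
    finally have "?c ^ n * (real (card I) * exp (t * N)) \<le> exp (- (real n * b)) * (real (card I) * exp (t * N))"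
      by (intro mult_right_mono) auto
    moreover have "(\<Sum>i<n. ?c ^ i) \<le> (\<Sum>i<n. 1)" using b by (intro sum_mono power_le_one) auto
    then have "(\<Sum>i<n. ?c ^ i) * \<delta> q \<le> real n * \<delta> q" using \<delta>0[of q] by (intro mult_right_mono) auto
    ultimately show "?c ^ n * (real (card I) * exp (t * N)) + (\<Sum>i<n. ?c ^ i) * \<delta> q \<le> ?z"
      using P0(1) unfolding q_def by (simp add: mult.commute mult.left_commute)
  qed
  finally have int: "(\<integral>\<^sup>+X. ennreal (f n X) \<partial>P n) \<le> ennreal ?z" .
  let ?\<theta> = "exp (t * (N - s)) / 2"
  let ?B = "{X \<in> space (P n). ?\<theta> \<le> f n X}"
  have B: "?B \<in> sets (P n)" using f_meas by measurable
  have "measure (P n) ?B \<le> ?z / ?\<theta>"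
    by (rule markov_sublevel[OF prob_space_P f_meas _ int]) (auto simp: f_def)
  also have "?z / ?\<theta> = 4 * real (card I) * exp (t * s - real n * b)"
    by (simp add: exp_minus exp_diff algebra_simps divide_simps flip: exp_add)
  finally have prob: "measure (P n) ?B \<le> 4 * real (card I) * exp (t * s - real n * b)" .
  have good: "s * (\<Sum>i\<in>I. (cmod (c i))\<^sup>2) \<le> (\<Sum>l\<in>{1..n}. (cmod (inner_on I c (v (X l))))\<^sup>2)"
    if X: "X \<in> space (P n) - ?B" for X c
  proof (cases "(\<Sum>i\<in>I. (cmod (c i))\<^sup>2) = 0")
    case True
    then show ?thesis by (simp add: sum_nonneg)
  next
    case False
    let ?s = "\<Sum>i\<in>I. (cmod (c i))\<^sup>2"
    have "0 \<le> ?s" by (intro sum_nonneg) simp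
    then have spos: "?s > 0" using False by simp
    obtain d where d: "(\<Sum>i\<in>I. (cmod (d i))\<^sup>2) = 1"
      "\<And>u. (cmod (inner_on I d u))\<^sup>2 = (cmod (inner_on I c u))\<^sup>2 / ?s"
      using normalize_vector[OF False] by blast
    have Xl: "X l \<in> space \<mu>" if "l \<in> {1..n}" for l using X space_P that by blast
    have psdn: "psd_on I (cogram_on N v n X)" using Xl by (intro psd) auto
    have "qpow I (cogram_on N v n X) 1 d \<le> N - s"
    proof (rule ccontr)
      assume "\<not> ?thesis"
      then have "N - s \<le> qpow I (cogram_on N v n X) 1 d" by simp
      with N have "(\<Sum>p\<le>q. (t * (N - s)) ^ p / fact p) \<le> exp_tr I t q (cogram_on N v n X)"
        by (intro exp_tr_ge[OF finite_I psdn less_imp_le[OF t(1)] d(1)]) auto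
      with P0(2) have "?\<theta> \<le> exp_tr I t q (cogram_on N v n X)"
        unfolding q_def by (rule order_trans)
      then have "?\<theta> \<le> f n X" unfolding f_def by simp
      then show False using X by simp
    qed
    then have "s \<le> (\<Sum>l\<in>{1..n}. (cmod (inner_on I c (v (X l))))\<^sup>2) / ?s"
      unfolding qpow_cogram_on[OF finite_I] d by (simp add: sum_divide_distrib)
    then show ?thesis using spos by (simp add: le_divide_eq)
  qed
  show ?thesis using B prob good unfolding b_def by blast
qed

end

section \<open>Least squares matrices\<close>

lemma dim_mat_adjoint [simp]: "dim_row (mat_adjoint L) = dim_col L" "dim_col (mat_adjoint L) = dim_row L"
  by (simp_all add: mat_adjoint_def)

lemma mat_adjoint_carrier: "L \<in> carrier_mat n d \<Longrightarrow> mat_adjoint L \<in> carrier_mat d n"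
  by (intro carrier_matI) auto

lemma mat_adjoint_index:
  fixes L :: "complex mat"
  assumes "L \<in> carrier_mat n d" "i < d" "j < n"
  shows "mat_adjoint L $$ (i, j) = cnj (L $$ (j, i))"
  using assms by (auto simp: mat_adjoint_def mat_of_rows_index)

lemma mult_mat_vec_index:
  assumes "L \<in> carrier_mat n d" "v \<in> carrier_vec d" "j < n"
  shows "(L *\<^sub>v v) $ j = (\<Sum>k<d. L $$ (j, k) * v $ k)"
  using assms by (simp add: scalar_prod_def atLeast0LessThan)

lemma adjoint_mult_vec_index:
  fixes L :: "complex mat"
  assumes "L \<in> carrier_mat n d" "b \<in> carrier_vec n" "i < d"
  shows "(mat_adjoint L *\<^sub>v b) $ i = (\<Sum>j<n. cnj (L $$ (j, i)) * b $ j)"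
  unfolding mult_mat_vec_index[OF mat_adjoint_carrier[OF assms(1)] assms(2,3)]
  using assms by (intro sum.cong refl) (simp add: mat_adjoint_index)

lemma gram_mat_index:
  fixes L :: "complex mat"
  assumes "L \<in> carrier_mat n d" "i < d" "k < d"
  shows "(mat_adjoint L * L) $$ (i, k) = (\<Sum>j<n. cnj (L $$ (j, i)) * L $$ (j, k))"
  using assms by (simp add: scalar_prod_def atLeast0LessThan mat_adjoint_index)

lemma adjoint_mult_vec_inner:
  fixes L :: "complex mat"
  assumes L: "L \<in> carrier_mat n d" and c: "c \<in> carrier_vec d" and b: "b \<in> carrier_vec n"
    and z: "mat_adjoint L *\<^sub>v b = 0\<^sub>v d"
  shows "(\<Sum>j<n. cnj ((L *\<^sub>v c) $ j) * b $ j) = 0"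
proof -
  have "(\<Sum>j<n. cnj ((L *\<^sub>v c) $ j) * b $ j) = (\<Sum>j<n. \<Sum>i<d. cnj (c $ i) * (cnj (L $$ (j, i)) * b $ j))"
    by (intro sum.cong refl)
      (simp add: mult_mat_vec_index[OF L c] sum_distrib_left mult_ac del: index_mult_mat_vec)
  also have "\<dots> = (\<Sum>i<d. \<Sum>j<n. cnj (c $ i) * (cnj (L $$ (j, i)) * b $ j))" by (rule sum.swap)
  also have "\<dots> = (\<Sum>i<d. cnj (c $ i) * (mat_adjoint L *\<^sub>v b) $ i)"
    by (intro sum.cong refl)
      (simp add: adjoint_mult_vec_index[OF L b] sum_distrib_left del: index_mult_mat_vec)
  finally show ?thesis unfolding z by simp
qed

lemma kernel_gram_mat:
  fixes L :: "complex mat"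
  assumes L: "L \<in> carrier_mat n d" and v: "v \<in> carrier_vec d" and z: "(mat_adjoint L * L) *\<^sub>v v = 0\<^sub>v d"
  shows "L *\<^sub>v v = 0\<^sub>v n"
proof -
  have Lv: "L *\<^sub>v v \<in> carrier_vec n" using L v by simp
  have "mat_adjoint L *\<^sub>v (L *\<^sub>v v) = 0\<^sub>v d"
    using z assoc_mult_mat_vec[OF mat_adjoint_carrier[OF L] L v] by simp
  from adjoint_mult_vec_inner[OF L v Lv this]
  have "(\<Sum>j<n. of_real ((cmod ((L *\<^sub>v v) $ j))\<^sup>2)) = (0 :: complex)"
    by (simp only: complex_norm_square mult.commute)
  then have "(\<Sum>j<n. (cmod ((L *\<^sub>v v) $ j))\<^sup>2) = 0"
    unfolding of_real_sum[symmetric] by (simp only: of_real_eq_0_iff)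
  then have "(L *\<^sub>v v) $ j = 0" if "j < n" for j
    using that by (simp add: sum_nonneg_eq_0_iff)
  then show ?thesis using Lv by (intro eq_vecI) (auto dest: carrier_vecD simp del: index_mult_mat_vec dim_mult_mat_vec)
qed

text \<open>Linear independence is a property of the set of columns, in which a repeated column is
  invisible, so repetitions have to be excluded separately.\<close>

lemma (in vec_space) rank_less_if_not_distinct:
  assumes "A \<in> carrier_mat n nc" "\<not> distinct (cols A)"
  shows "rank A < nc"
proof -
  obtain S where S: "maximal S (\<lambda>T. T \<subseteq> set (cols A) \<and> lin_indpt T)"
    using maximal_exists[of "(\<lambda>T. T \<subseteq> set (cols A) \<and> lin_indpt T)" "card (set (cols A))" "{}"]
    by (meson List.finite_set card_mono empty_iff empty_subsetI finite_lin_indpt2 rev_finite_subset)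
  then have "card S \<le> card (set (cols A))" by (simp add: card_mono maximal_def)
  also have "\<dots> < length (cols A)"
    using assms(2) card_length[of "cols A"] card_distinct[of "cols A"] by linarith
  finally show ?thesis using rank_card_indpt[OF assms(1) S] assms(1) by simp
qed

lemma (in vec_space) full_rank_iff_trivial_kernel:
  assumes A: "A \<in> carrier_mat n nc"
  shows "rank A = nc \<longleftrightarrow> (\<forall>v\<in>carrier_vec nc. A *\<^sub>v v = 0\<^sub>v n \<longrightarrow> v = 0\<^sub>v nc)"
proof
  assume r: "rank A = nc"
  then have d: "distinct (cols A)" using rank_less_if_not_distinct[OF A] by auto
  have "lin_indpt (set (cols A))" by (rule full_rank_lin_indpt[OF A r d])
  then show "\<forall>v\<in>carrier_vec nc. A *\<^sub>v v = 0\<^sub>v n \<longrightarrow> v = 0\<^sub>v nc"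
    using lin_depI[OF A _ _ _ d] by blast
next
  assume k: "\<forall>v\<in>carrier_vec nc. A *\<^sub>v v = 0\<^sub>v n \<longrightarrow> v = 0\<^sub>v nc"
  have d: "distinct (cols A)"
  proof (rule ccontr)
    assume "\<not> distinct (cols A)"
    then obtain i j where ij: "i < nc" "j < nc" "i \<noteq> j" "cols A ! i = cols A ! j"
      using A by (auto simp: distinct_conv_nth)
    let ?v = "unit_vec nc i - unit_vec nc j :: 'a vec"
    have "A *\<^sub>v ?v = A *\<^sub>v unit_vec nc i - A *\<^sub>v unit_vec nc j"
      using A by (intro mult_minus_distrib_mat_vec) auto
    also have "\<dots> = col A i - col A j"
    proof -
      have "A *\<^sub>v unit_vec nc k = col A k" if "k < nc" for k
        using A that by (intro eq_vecI) auto
      then show ?thesis using ij(1,2) by simp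
    qed
    also have "\<dots> = 0\<^sub>v n" using A ij by simp
    finally have "?v = 0\<^sub>v nc" using k by simp
    then have "?v $ i = 0" using ij(1) by simp
    then show False using ij by simp
  qed
  have "lin_indpt (set (cols A))"
    using lin_depE[OF A _ d] k by metis
  then show "rank A = nc" by (rule lin_indpt_full_rank[OF A d])
qed

text \<open>Turns definedness of the operator into the nonvanishing of a polynomial in the matrix
  entries and their conjugates, which gives a measurable event and an invertible Gram
  matrix.\<close>

lemma full_rank_iff_det_gram:
  fixes L :: "complex mat"
  assumes L: "L \<in> carrier_mat n d"
  shows "vec_space.rank n L = d \<longleftrightarrow> det (mat_adjoint L * L) \<noteq> 0"
proof -
  have B: "mat_adjoint L * L \<in> carrier_mat d d" using mat_adjoint_carrier[OF L] L by simp
  have "(mat_adjoint L * L) *\<^sub>v v = 0\<^sub>v d \<longleftrightarrow> L *\<^sub>v v = 0\<^sub>v n" if v: "v \<in> carrier_vec d" for v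
  proof
    assume z: "L *\<^sub>v v = 0\<^sub>v n"
    have "(mat_adjoint L * L) *\<^sub>v v = mat_adjoint L *\<^sub>v (L *\<^sub>v v)"
      by (rule assoc_mult_mat_vec[OF mat_adjoint_carrier[OF L] L v])
    also have "\<dots> = 0\<^sub>v d"
      unfolding z by (intro eq_vecI)
        (auto simp: adjoint_mult_vec_index[OF L] carrier_matD[OF L] simp del: index_mult_mat_vec)
    finally show "(mat_adjoint L * L) *\<^sub>v v = 0\<^sub>v d" .
  qed (rule kernel_gram_mat[OF L v])
  then show ?thesis
    unfolding vec_space.full_rank_iff_trivial_kernel[OF L] det_0_iff_vec_prod_zero_field[OF B] by blast
qed

text \<open>Identifies the computed inverse with Cramer's rule, which makes its entries rational
  functions of those of \<open>B\<close>.\<close>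

lemma mat_inverse_of_det:
  fixes B :: "complex mat"
  assumes B: "B \<in> carrier_mat d d" and "det B \<noteq> 0"
  defines "C \<equiv> the (mat_inverse B)"
  shows "C \<in> carrier_mat d d" "B * C = 1\<^sub>m d" "C * B = 1\<^sub>m d"
    "\<And>i j. i < d \<Longrightarrow> j < d \<Longrightarrow> C $$ (i, j) = adj_mat B $$ (i, j) / det B"
proof -
  let ?A = "adj_mat B" and ?D = "det B"
  have A: "?A \<in> carrier_mat d d" "B * ?A = ?D \<cdot>\<^sub>m 1\<^sub>m d" "?A * B = ?D \<cdot>\<^sub>m 1\<^sub>m d"
    using adj_mat[OF B] by auto
  let ?I = "(1 / ?D) \<cdot>\<^sub>m ?A"
  have "?I * B = 1\<^sub>m d" "B * ?I = 1\<^sub>m d" "?I \<in> carrier_mat d d"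
    using A B assms(2) by (auto simp: mult_smult_assoc_mat[OF A(1) B] mult_smult_distrib[OF B A(1)])
  then have "B \<in> Units (ring_mat TYPE(complex) d ())"
    using B unfolding Units_def by (auto simp: ring_mat_simps)
  then obtain C' where C': "mat_inverse B = Some C'" using mat_inverse(1)[OF B] by fastforce
  from mat_inverse(2)[OF B this] have C: "B * C = 1\<^sub>m d" "C * B = 1\<^sub>m d" "C \<in> carrier_mat d d"
    by (auto simp: C_def C')
  then show "B * C = 1\<^sub>m d" "C * B = 1\<^sub>m d" "C \<in> carrier_mat d d" by auto
  have "C = C * (B * ?I)" using C \<open>B * ?I = 1\<^sub>m d\<close> by simp
  also have "\<dots> = (C * B) * ?I" using C B \<open>?I \<in> _\<close> by (intro assoc_mult_mat[symmetric]) auto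
  also have "\<dots> = ?I" unfolding C(2) by (rule left_mult_one_mat) fact
  finally have "C = ?I" .
  then show "C $$ (i, j) = adj_mat B $$ (i, j) / det B" if "i < d" "j < d" for i j
    using A(1) that by simp
qed

text \<open>One expression for the entries of both the least squares matrix and the data
  vector.\<close>

definition weighted :: "('a \<Rightarrow> real) \<Rightarrow> ('a \<Rightarrow> complex) \<Rightarrow> 'a \<Rightarrow> complex" where
  "weighted \<rho> f x = (if \<rho> x \<noteq> 0 then f x / complex_of_real (sqrt (\<rho> x)) else 0)"

lemma weighted_comb: "weighted \<rho> (\<Sum>i\<in>J. fscale (c i) (g i)) x = (\<Sum>i\<in>J. c i * weighted \<rho> (g i) x)"
  by (simp add: weighted_def sum_fscale_apply sum_divide_distrib)

lemma weighted_add: "weighted \<rho> (f + g) x = weighted \<rho> f x + weighted \<rho> g x"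
  by (simp add: weighted_def add_divide_distrib)

context
  fixes \<eta> :: "nat \<Rightarrow> 'a \<Rightarrow> complex" and \<rho> :: "'a \<Rightarrow> real" and n m :: nat
begin

abbreviation "Lmat X \<equiv> wls_matrix \<eta> \<rho> n m X"
abbreviation "Bmat X \<equiv> mat_adjoint (Lmat X) * Lmat X"

lemma Lmat_carrier: "Lmat X \<in> carrier_mat n (m - 1)"
  by (simp add: wls_matrix_def)

lemma Lmat_index: "j < n \<Longrightarrow> k < m - 1 \<Longrightarrow> Lmat X $$ (j, k) = weighted \<rho> (\<eta> (Suc k)) (X (Suc j))"
  by (simp add: wls_matrix_def weighted_def)

lemma data_carrier: "wls_data \<rho> n X f \<in> carrier_vec n"
  by (simp add: wls_data_def)

lemma data_index: "j < n \<Longrightarrow> wls_data \<rho> n X f $ j = weighted \<rho> f (X (Suc j))"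
  by (simp add: wls_data_def weighted_def)

lemma Bmat_carrier: "Bmat X \<in> carrier_mat (m - 1) (m - 1)"
  using mat_adjoint_carrier[OF Lmat_carrier] Lmat_carrier by (rule mult_carrier_mat)

lemma wls_defined_iff: "wls_defined \<eta> \<rho> n m X \<longleftrightarrow> det (Bmat X) \<noteq> 0"
  unfolding wls_defined_def by (rule full_rank_iff_det_gram[OF Lmat_carrier])

lemma wls_coeffs_eq:
  assumes "wls_defined \<eta> \<rho> n m X"
  shows "wls_coeffs \<eta> \<rho> n m X f = the (mat_inverse (Bmat X)) *\<^sub>v (mat_adjoint (Lmat X) *\<^sub>v wls_data \<rho> n X f)"
  unfolding wls_coeffs_def Let_def
  by (rule assoc_mult_mat_vec[OF mat_inverse_of_det(1)[OF Bmat_carrier] mat_adjoint_carrier[OF Lmat_carrier] data_carrier])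
    (use assms in \<open>simp add: wls_defined_iff\<close>)

lemma wls_coeffs_carrier:
  "wls_defined \<eta> \<rho> n m X \<Longrightarrow> wls_coeffs \<eta> \<rho> n m X f \<in> carrier_vec (m - 1)"
  by (simp only: wls_coeffs_eq, rule mult_mat_vec_carrier[OF mat_inverse_of_det(1)[OF Bmat_carrier]
      mult_mat_vec_carrier[OF mat_adjoint_carrier[OF Lmat_carrier] data_carrier]])
    (simp only: wls_defined_iff not_False_eq_True)

lemma wls_normal_equations:
  assumes "wls_defined \<eta> \<rho> n m X"
  shows "mat_adjoint (Lmat X) *\<^sub>v (Lmat X *\<^sub>v wls_coeffs \<eta> \<rho> n m X f) =
    mat_adjoint (Lmat X) *\<^sub>v wls_data \<rho> n X f"
proof -
  let ?L = "Lmat X" and ?b = "wls_data \<rho> n X f" and ?C = "the (mat_inverse (Bmat X))"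
  let ?r = "mat_adjoint ?L *\<^sub>v ?b"
  have det: "det (Bmat X) \<noteq> 0" using assms by (simp add: wls_defined_iff)
  note C = mat_inverse_of_det[OF Bmat_carrier det]
  have r: "?r \<in> carrier_vec (m - 1)"
    by (rule mult_mat_vec_carrier[OF mat_adjoint_carrier[OF Lmat_carrier] data_carrier])
  have "mat_adjoint ?L *\<^sub>v (?L *\<^sub>v (?C *\<^sub>v ?r)) = Bmat X *\<^sub>v (?C *\<^sub>v ?r)"
    by (rule assoc_mult_mat_vec[symmetric, OF mat_adjoint_carrier[OF Lmat_carrier] Lmat_carrier])
      (rule mult_mat_vec_carrier[OF C(1) r])
  also have "\<dots> = (Bmat X * ?C) *\<^sub>v ?r"
    by (rule assoc_mult_mat_vec[symmetric, OF Bmat_carrier C(1) r])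
  also have "\<dots> = ?r" unfolding C(2) using r by simp
  finally show ?thesis unfolding wls_coeffs_eq[OF assms] .
qed

text \<open>The fitted values are the orthogonal projection of the data onto the range of the
  matrix, hence no longer than the data.\<close>

lemma wls_residual_bound:
  assumes "wls_defined \<eta> \<rho> n m X"
  shows "(\<Sum>j<n. (cmod ((Lmat X *\<^sub>v wls_coeffs \<eta> \<rho> n m X f) $ j))\<^sup>2) \<le> (\<Sum>l\<in>{1..n}. (cmod (weighted \<rho> f (X l)))\<^sup>2)"
proof -
  let ?L = "Lmat X" and ?b = "wls_data \<rho> n X f" and ?c = "wls_coeffs \<eta> \<rho> n m X f"
  let ?y = "?L *\<^sub>v ?c"
  have c: "?c \<in> carrier_vec (m - 1)" by (rule wls_coeffs_carrier[OF assms])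
  have y: "?y \<in> carrier_vec n" by (rule mult_mat_vec_carrier[OF Lmat_carrier c])
  have "mat_adjoint ?L *\<^sub>v (?y - ?b) = mat_adjoint ?L *\<^sub>v ?y - mat_adjoint ?L *\<^sub>v ?b"
    by (rule mult_minus_distrib_mat_vec[OF mat_adjoint_carrier[OF Lmat_carrier] y data_carrier])
  also have "\<dots> = 0\<^sub>v (m - 1)"
    unfolding wls_normal_equations[OF assms]
    using mult_mat_vec_carrier[OF mat_adjoint_carrier[OF Lmat_carrier] data_carrier] by simp
  finally have z: "mat_adjoint ?L *\<^sub>v (?y - ?b) = 0\<^sub>v (m - 1)" .
  have "(\<Sum>j<n. cnj (?y $ j) * (?y - ?b) $ j) = 0"
    by (rule adjoint_mult_vec_inner[OF Lmat_carrier c _ z]) (use y data_carrier in auto)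
  then have "(\<Sum>j<n. ?y $ j * cnj (?y $ j)) = (\<Sum>j<n. ?b $ j * cnj (?y $ j))"
    using y data_carrier[of X f] by (simp add: algebra_simps sum_subtractf)
  then have "inner_on {..<n} (\<lambda>j. ?y $ j) (\<lambda>j. ?y $ j) = inner_on {..<n} (\<lambda>j. ?b $ j) (\<lambda>j. ?y $ j)"
    by (simp add: inner_on_def)
  then have "of_real (\<Sum>j<n. (cmod (?y $ j))\<^sup>2) = inner_on {..<n} (\<lambda>j. ?b $ j) (\<lambda>j. ?y $ j)"
    by (simp only: inner_on_self)
  moreover have "0 \<le> (\<Sum>j<n. (cmod (?y $ j))\<^sup>2)" by (intro sum_nonneg) simp
  ultimately have "((\<Sum>j<n. (cmod (?y $ j))\<^sup>2))\<^sup>2 \<le> (\<Sum>j<n. (cmod (?b $ j))\<^sup>2) * (\<Sum>j<n. (cmod (?y $ j))\<^sup>2)"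
    using inner_on_cauchy_schwarz[of "{..<n}" "\<lambda>j. ?b $ j" "\<lambda>j. ?y $ j"]
    by (metis abs_of_nonneg norm_of_real)
  moreover have "s \<le> s'" if "s\<^sup>2 \<le> s' * s" "0 \<le> s" "0 \<le> s'" for s s' :: real
    using that by (cases "s = 0") (auto simp: power2_eq_square)
  moreover have "0 \<le> (\<Sum>j<n. (cmod (?b $ j))\<^sup>2)" by (intro sum_nonneg) simp
  ultimately have "(\<Sum>j<n. (cmod (?y $ j))\<^sup>2) \<le> (\<Sum>j<n. (cmod (?b $ j))\<^sup>2)"
    using \<open>0 \<le> (\<Sum>j<n. (cmod (?y $ j))\<^sup>2)\<close> by blast
  also have "\<dots> = (\<Sum>j<n. (cmod (weighted \<rho> f (X (Suc j))))\<^sup>2)"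
    by (intro sum.cong refl) (simp add: data_index)
  also have "\<dots> = (\<Sum>l\<in>{1..n}. (cmod (weighted \<rho> f (X l)))\<^sup>2)"
    by (rule sum.reindex_bij_witness[of _ "\<lambda>k. k - 1" Suc]) auto
  finally show ?thesis .
qed

text \<open>Translates from vectors indexed from 0 to index sets starting at 1. The conjugates
  appear because \<open>inner_on\<close> is conjugate-linear in the sampled vector.\<close>

lemma Lmat_mult_norm:
  assumes c: "c \<in> carrier_vec (m - 1)"
  shows "(\<Sum>j<n. (cmod ((Lmat X *\<^sub>v c) $ j))\<^sup>2) =
    (\<Sum>l\<in>{1..n}. (cmod (inner_on {1..m - 1} (\<lambda>i. cnj (c $ (i - 1))) (\<lambda>i. weighted \<rho> (\<eta> i) (X l))))\<^sup>2)"
proof -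
  have "cmod ((Lmat X *\<^sub>v c) $ j) =
      cmod (inner_on {1..m - 1} (\<lambda>i. cnj (c $ (i - 1))) (\<lambda>i. weighted \<rho> (\<eta> i) (X (Suc j))))" if "j < n" for j
  proof -
    have "(Lmat X *\<^sub>v c) $ j = (\<Sum>k<m - 1. weighted \<rho> (\<eta> (Suc k)) (X (Suc j)) * c $ k)"
      using that by (simp add: mult_mat_vec_index[OF Lmat_carrier c] Lmat_index)
    also have "\<dots> = (\<Sum>i\<in>{1..m - 1}. weighted \<rho> (\<eta> i) (X (Suc j)) * c $ (i - 1))"
      by (rule sum.reindex_bij_witness[of _ "\<lambda>k. k - 1" Suc]) auto
    also have "\<dots> = cnj (inner_on {1..m - 1} (\<lambda>i. cnj (c $ (i - 1))) (\<lambda>i. weighted \<rho> (\<eta> i) (X (Suc j))))"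
      by (simp add: inner_on_def mult.commute)
    finally show ?thesis by simp
  qed
  then have "(\<Sum>j<n. (cmod ((Lmat X *\<^sub>v c) $ j))\<^sup>2) =
    (\<Sum>j<n. (cmod (inner_on {1..m - 1} (\<lambda>i. cnj (c $ (i - 1))) (\<lambda>i. weighted \<rho> (\<eta> i) (X (Suc j)))))\<^sup>2)"
    by simp
  also have "\<dots> = (\<Sum>l\<in>{1..n}. (cmod (inner_on {1..m - 1} (\<lambda>i. cnj (c $ (i - 1))) (\<lambda>i. weighted \<rho> (\<eta> i) (X l))))\<^sup>2)"
    by (rule sum.reindex_bij_witness[of _ "\<lambda>k. k - 1" Suc]) auto
  finally show ?thesis .
qed

text \<open>The lower eigenvalue bound is used twice: it makes the kernel trivial, and together with
  \<open>wls_residual_bound\<close> it bounds the map from data to coefficients.\<close>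

lemma wls_stability:
  assumes s: "0 < s"
    and lower: "\<And>c. s * (\<Sum>i\<in>{1..m - 1}. (cmod (c i))\<^sup>2) \<le>
      (\<Sum>l\<in>{1..n}. (cmod (inner_on {1..m - 1} c (\<lambda>i. weighted \<rho> (\<eta> i) (X l))))\<^sup>2)"
  shows "wls_defined \<eta> \<rho> n m X"
    and "s * (\<Sum>k\<in>{1..m - 1}. (cmod (wls_coeffs \<eta> \<rho> n m X f $ (k - 1)))\<^sup>2) \<le>
      (\<Sum>l\<in>{1..n}. (cmod (weighted \<rho> f (X l)))\<^sup>2)"
proof -
  have low: "s * (\<Sum>k\<in>{1..m - 1}. (cmod (c $ (k - 1)))\<^sup>2) \<le> (\<Sum>j<n. (cmod ((Lmat X *\<^sub>v c) $ j))\<^sup>2)"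
    if "c \<in> carrier_vec (m - 1)" for c
    using lower[of "\<lambda>i. cnj (c $ (i - 1))"] Lmat_mult_norm[OF that] by simp
  have "c = 0\<^sub>v (m - 1)" if c: "c \<in> carrier_vec (m - 1)" and z: "Lmat X *\<^sub>v c = 0\<^sub>v n" for c
  proof -
    have "s * (\<Sum>k\<in>{1..m - 1}. (cmod (c $ (k - 1)))\<^sup>2) \<le> 0" using low[OF c] unfolding z by simp
    then have "(\<Sum>k\<in>{1..m - 1}. (cmod (c $ (k - 1)))\<^sup>2) = 0"
      using s by (intro antisym sum_nonneg) (auto simp: mult_le_0_iff)
    then have "(cmod (c $ (k - 1)))\<^sup>2 = 0" if "k \<in> {1..m - 1}" for k
      using that by (subst (asm) sum_nonneg_eq_0_iff) auto
    from this[of "Suc k" for k] have "c $ k = 0" if "k < m - 1" for k using that by auto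
    then show ?thesis using c by (intro eq_vecI) auto
  qed
  then show def: "wls_defined \<eta> \<rho> n m X"
    unfolding wls_defined_def by (subst vec_space.full_rank_iff_trivial_kernel[OF Lmat_carrier]) blast
  show "s * (\<Sum>k\<in>{1..m - 1}. (cmod (wls_coeffs \<eta> \<rho> n m X f $ (k - 1)))\<^sup>2) \<le>
      (\<Sum>l\<in>{1..n}. (cmod (weighted \<rho> f (X l)))\<^sup>2)"
    using low[OF wls_coeffs_carrier[OF def]] wls_residual_bound[OF def] by (rule order_trans)
qed

text \<open>The operator reproduces the span of the \<eta> exactly, so the coefficient error depends
  only on the projection residual.\<close>

lemma wls_coeffs_add_comb:
  assumes def: "wls_defined \<eta> \<rho> n m X" and k: "k \<in> {1..m - 1}"
  shows "wls_coeffs \<eta> \<rho> n m X (f + (\<Sum>i\<in>{1..m - 1}. fscale (a i) (\<eta> i))) $ (k - 1) =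
    wls_coeffs \<eta> \<rho> n m X f $ (k - 1) + a k"
proof -
  let ?L = "Lmat X" and ?b = "wls_data \<rho> n X f" and ?C = "the (mat_inverse (Bmat X))"
  let ?h = "\<Sum>i\<in>{1..m - 1}. fscale (a i) (\<eta> i)" and ?a = "vec (m - 1) (\<lambda>k. a (Suc k))"
  have det: "det (Bmat X) \<noteq> 0" using def by (simp add: wls_defined_iff)
  note C = mat_inverse_of_det[OF Bmat_carrier det]
  have a: "?a \<in> carrier_vec (m - 1)" by simp
  have La: "?L *\<^sub>v ?a \<in> carrier_vec n" by (rule mult_mat_vec_carrier[OF Lmat_carrier a])
  have "weighted \<rho> ?h x = (\<Sum>i\<in>{1..m - 1}. weighted \<rho> (\<eta> i) x * a i)" for x
    by (simp add: weighted_comb mult.commute)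
  then have wh: "weighted \<rho> ?h x = (\<Sum>k<m - 1. weighted \<rho> (\<eta> (Suc k)) x * a (Suc k))" for x
    by (simp only:) (rule sum.reindex_bij_witness[of _ Suc "\<lambda>k. k - 1"], auto)
  have data: "wls_data \<rho> n X (f + ?h) = ?b + ?L *\<^sub>v ?a"
  proof (rule eq_vecI)
    fix j assume "j < dim_vec (?b + ?L *\<^sub>v ?a)"
    then have j: "j < n" using carrier_vecD[OF La] by (simp only: index_add_vec(2))
    have "(?L *\<^sub>v ?a) $ j = weighted \<rho> ?h (X (Suc j))"
      unfolding mult_mat_vec_index[OF Lmat_carrier a j] wh using j by (intro sum.cong) (auto simp: Lmat_index)
    then show "wls_data \<rho> n X (f + ?h) $ j = (?b + ?L *\<^sub>v ?a) $ j"
      using j La data_carrier[of X f] by (simp only: data_index weighted_add index_add_vec carrier_vecD)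
  qed (simp only: index_add_vec(2) carrier_vecD[OF La] carrier_vecD[OF data_carrier])
  have ad: "mat_adjoint ?L \<in> carrier_mat (m - 1) n" by (rule mat_adjoint_carrier[OF Lmat_carrier])
  have rb: "mat_adjoint ?L *\<^sub>v ?b \<in> carrier_vec (m - 1)" by (rule mult_mat_vec_carrier[OF ad data_carrier])
  have "mat_adjoint ?L *\<^sub>v (?b + ?L *\<^sub>v ?a) = mat_adjoint ?L *\<^sub>v ?b + Bmat X *\<^sub>v ?a"
    using mult_add_distrib_mat_vec[OF ad data_carrier La] assoc_mult_mat_vec[OF ad Lmat_carrier a] by simp
  then have "wls_coeffs \<eta> \<rho> n m X (f + ?h) = ?C *\<^sub>v (mat_adjoint ?L *\<^sub>v ?b + Bmat X *\<^sub>v ?a)"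
    unfolding wls_coeffs_eq[OF def] data by simp
  also have "\<dots> = ?C *\<^sub>v (mat_adjoint ?L *\<^sub>v ?b) + ?C *\<^sub>v (Bmat X *\<^sub>v ?a)"
    by (rule mult_add_distrib_mat_vec[OF C(1) rb mult_mat_vec_carrier[OF Bmat_carrier a]])
  also have "?C *\<^sub>v (Bmat X *\<^sub>v ?a) = (?C * Bmat X) *\<^sub>v ?a"
    by (rule assoc_mult_mat_vec[symmetric, OF C(1) Bmat_carrier a])
  also have "\<dots> = ?a" unfolding C(3) using a by simp
  finally have "wls_coeffs \<eta> \<rho> n m X (f + ?h) = wls_coeffs \<eta> \<rho> n m X f + ?a"
    unfolding wls_coeffs_eq[OF def] .
  moreover have "k - 1 < dim_vec ?a" "Suc (k - 1) = k" using k by auto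
  ultimately show ?thesis by (simp only: index_add_vec(1) dim_vec index_vec)
qed

text \<open>Cramer's rule for the coefficients. It is meaningful for all nodes, with value 0 when
  the determinant vanishes, so its measurability can be stated on the whole space.\<close>

definition coeff_formula :: "(nat \<Rightarrow> 'a) \<Rightarrow> ('a \<Rightarrow> complex) \<Rightarrow> nat \<Rightarrow> complex" where
  "coeff_formula X f k = (\<Sum>l<m - 1. adj_mat (Bmat X) $$ (k - 1, l) / det (Bmat X) *
     (\<Sum>j<n. cnj (weighted \<rho> (\<eta> (Suc l)) (X (Suc j))) * weighted \<rho> f (X (Suc j))))"

lemma wls_coeffs_formula:
  assumes def: "wls_defined \<eta> \<rho> n m X" and k: "k \<in> {1..m - 1}"
  shows "wls_coeffs \<eta> \<rho> n m X f $ (k - 1) = coeff_formula X f k"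
proof -
  have det: "det (Bmat X) \<noteq> 0" using def by (simp add: wls_defined_iff)
  note C = mat_inverse_of_det[OF Bmat_carrier det]
  have rb: "mat_adjoint (Lmat X) *\<^sub>v wls_data \<rho> n X f \<in> carrier_vec (m - 1)"
    by (rule mult_mat_vec_carrier[OF mat_adjoint_carrier[OF Lmat_carrier] data_carrier])
  have k': "k - 1 < m - 1" using k by auto
  show ?thesis
    unfolding wls_coeffs_eq[OF def] coeff_formula_def mult_mat_vec_index[OF C(1) rb k']
    using k' by (intro sum.cong refl)
      (simp add: C(4) adjoint_mult_vec_index[OF Lmat_carrier data_carrier] Lmat_index data_index)
qed

end

section \<open>Measurability of determinants and adjugates\<close>

lemma det_measurable:
  fixes A :: "'x \<Rightarrow> complex mat"
  assumes A: "\<And>x. A x \<in> carrier_mat d d"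
    and m: "\<And>i j. i < d \<Longrightarrow> j < d \<Longrightarrow> (\<lambda>x. A x $$ (i, j)) \<in> borel_measurable N"
  shows "(\<lambda>x. det (A x)) \<in> borel_measurable N"
  unfolding det_def'[OF A]
proof (intro borel_measurable_sum borel_measurable_times borel_measurable_const borel_measurable_prod)
  fix p i assume "p \<in> {p. p permutes {0..<d}}" "i \<in> {0..<d}"
  then have "i < d" "p i < d" using permutes_in_image[of p "{0..<d}" i] by auto
  then show "(\<lambda>x. A x $$ (i, p i)) \<in> borel_measurable N" by (rule m)
qed

lemma adj_mat_measurable:
  fixes A :: "'x \<Rightarrow> complex mat"
  assumes A: "\<And>x. A x \<in> carrier_mat d d"
    and m: "\<And>i j. i < d \<Longrightarrow> j < d \<Longrightarrow> (\<lambda>x. A x $$ (i, j)) \<in> borel_measurable N"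
    and ij: "i < d" "j < d"
  shows "(\<lambda>x. adj_mat (A x) $$ (i, j)) \<in> borel_measurable N"
proof -
  have eq: "adj_mat (A x) $$ (i, j) = (-1) ^ (j + i) * det (mat_delete (A x) j i)" for x
    using A[of x] ij by (simp add: adj_mat_def cofactor_def)
  have "(\<lambda>x. det (mat_delete (A x) j i)) \<in> borel_measurable N"
  proof (rule det_measurable[where d = "d - 1"])
    show "mat_delete (A x) j i \<in> carrier_mat (d - 1) (d - 1)" for x
      using A[of x] by (simp add: mat_delete_def)
    fix i' j' assume "i' < d - 1" "j' < d - 1"
    then show "(\<lambda>x. mat_delete (A x) j i $$ (i', j')) \<in> borel_measurable N"
      by (auto simp: mat_delete_def carrier_matD[OF A] intro!: m)
  qed
  then show ?thesis unfolding eq by (intro borel_measurable_times borel_measurable_const)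
qed

section \<open>The sampling measure\<close>

locale wls_sampling = rkhs_eigen +
  fixes m n :: nat
  assumes m2: "2 \<le> m" and n1: "1 \<le> n"
begin

definition \<eta> :: "nat \<Rightarrow> 'a \<Rightarrow> complex" where
  "\<eta> j = fscale (of_real (inverse (sqrt (lam j)))) (e j)"

text \<open>Equals the sum of \<open>lam j\<close> over \<open>j \<ge> m\<close> by
  \<open>trace_formula\<close>. As a difference it is literally the denominator in the sampling
  density.\<close>

definition tail :: real where "tail = tr - sum lam {1..m - 1}"

definition \<rho> :: "'a \<Rightarrow> real" where "\<rho> = sampling_density M K lam e \<eta> m"

definition \<mu> :: "'a measure" where "\<mu> = density M (\<lambda>x. ennreal (\<rho> x))"

abbreviation Q :: "(nat \<Rightarrow> 'a) measure" where "Q \<equiv> PiM {1..n} (\<lambda>_. \<mu>)"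

lemma on_atMost: "orthonormal {1..N} e"
  by (rule e_orthonormal_subset) auto

lemma sum_lam_tail_le: "m - 1 \<le> N \<Longrightarrow> sum lam {m..N} \<le> tail"
proof -
  assume N: "m - 1 \<le> N"
  have "{1..N} = {1..m - 1} \<union> {m..N}" using m2 N by auto
  then have "sum lam {1..N} = sum lam {1..m - 1} + sum lam {m..N}"
    using m2 by (simp add: sum.union_disjoint)
  moreover have "sum lam {1..N} \<le> tr" by (rule sum_lam_le) auto
  ultimately show ?thesis by (simp add: tail_def)
qed

lemma lam_m_le_tail: "lam m \<le> tail"
  using sum_lam_tail_le[of m] by simp

lemma lam_m_pos: "0 < lam m"
  using lam_pos m2 by simp

lemma tail_pos: "0 < tail"
  using lam_m_le_tail lam_m_pos by linarith

lemma \<eta>_mem: "1 \<le> j \<Longrightarrow> \<eta> j \<in> H"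
  by (simp add: \<eta>_def e_mem)

lemma cmod_\<eta>: "1 \<le> j \<Longrightarrow> (cmod (\<eta> j x))\<^sup>2 = (cmod (e j x))\<^sup>2 / lam j"
proof -
  assume j: "1 \<le> j"
  have "(cmod (\<eta> j x))\<^sup>2 = (inverse (sqrt (lam j)))\<^sup>2 * (cmod (e j x))\<^sup>2"
    unfolding \<eta>_def fscale_def norm_mult norm_of_real power_mult_distrib power2_abs ..
  then show ?thesis using lam_pos[OF j] by (simp add: power_inverse divide_inverse mult.commute)
qed

lemma \<rho>_eq: "\<rho> x = 1 / 2 * (1 / real (m - 1) * (\<Sum>j\<in>{1..m - 1}. (cmod (\<eta> j x))\<^sup>2) +
    residual_kernel {1..m - 1} e x / tail)"
  by (simp add: \<rho>_def sampling_density_def residual_kernel_def tail_def tr_def)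

lemma residual_nonneg: "x \<in> D \<Longrightarrow> 0 \<le> residual_kernel {1..N} e x"
  by (rule residual_kernel_nonneg[OF on_atMost]) auto

text \<open>The density is the mean of two nonnegative functions, each normalized, so each of them
  is at most twice the density. These factors 2 are the ones in the vector bounds
  \<open>2 * real (m - 1)\<close> and \<open>2 * tail\<close>.\<close>

lemma \<rho>_ge:
  assumes "x \<in> D"
  shows "(\<Sum>j\<in>{1..m - 1}. (cmod (\<eta> j x))\<^sup>2) \<le> 2 * real (m - 1) * \<rho> x"
    and "residual_kernel {1..m - 1} e x \<le> 2 * tail * \<rho> x" and "0 \<le> \<rho> x"
proof -
  let ?s = "\<Sum>j\<in>{1..m - 1}. (cmod (\<eta> j x))\<^sup>2" and ?r = "residual_kernel {1..m - 1} e x"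
  have s: "0 \<le> ?s" by (intro sum_nonneg) simp
  have r: "0 \<le> ?r" by (rule residual_nonneg[OF assms])
  have m: "0 < real (m - 1)" using m2 by simp
  have 1: "0 \<le> ?s / real (m - 1)" "0 \<le> ?r / tail" using s r m tail_pos by auto
  have "2 * (1 / 2 * (1 / k * a + b)) = a / k + b" for a b k :: real by simp
  then have 2: "2 * \<rho> x = ?s / real (m - 1) + ?r / tail" unfolding \<rho>_eq .
  have "0 \<le> 2 * \<rho> x" unfolding 2 using 1 by (rule add_nonneg_nonneg)
  then show "0 \<le> \<rho> x" by simp
  have "?s / real (m - 1) \<le> 2 * \<rho> x" unfolding 2 using 1(2) by (simp only: le_add_same_cancel1)
  then show "?s \<le> 2 * real (m - 1) * \<rho> x" using m by (simp only: pos_divide_le_eq mult_ac)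
  have "?r / tail \<le> 2 * \<rho> x" unfolding 2 using 1(1) by (simp only: le_add_same_cancel2)
  then show "?r \<le> 2 * tail * \<rho> x" using tail_pos by (simp add: pos_divide_le_eq mult_ac)
qed

text \<open>Where the density vanishes, so do \<open>e 1\<close> to \<open>e (m - 1)\<close> and
  evaluation on their complement. The default value 0 of the weights therefore loses
  nothing.\<close>

lemma \<rho>_zero:
  assumes x: "x \<in> D" and z: "\<rho> x = 0" and f: "f \<in> H"
  shows "f x = 0"
proof -
  let ?p = "proj {1..m - 1} e f"
  have "(\<Sum>j\<in>{1..m - 1}. (cmod (\<eta> j x))\<^sup>2) \<le> 0" using \<rho>_ge(1)[OF x] z by simp
  then have s0: "(\<Sum>j\<in>{1..m - 1}. (cmod (\<eta> j x))\<^sup>2) = 0"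
    by (intro antisym sum_nonneg) auto
  have e0: "e j x = 0" if "j \<in> {1..m - 1}" for j
  proof -
    have "(cmod (\<eta> j x))\<^sup>2 = 0"
      using s0 that by (subst (asm) sum_nonneg_eq_0_iff) auto
    then show ?thesis using cmod_\<eta>[of j x] lam_pos[of j] that by auto
  qed
  have p0: "?p x = 0" unfolding proj_def sum_fscale_apply using e0 by simp
  have r0: "residual_kernel {1..m - 1} e x \<le> 0" using \<rho>_ge(2)[OF x] z by simp
  have g: "f - ?p \<in> H" using f proj_mem[OF on_atMost] by simp
  have "ip (f - ?p) (e j) = 0" if "j \<in> {1..m - 1}" for j
    by (rule ip_diff_proj_basis[OF on_atMost _ f that]) simp
  then have "(cmod ((f - ?p) x))\<^sup>2 \<le> nsq (f - ?p) * residual_kernel {1..m - 1} e x"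
    by (rule residual_eval_bound[OF on_atMost finite_atLeastAtMost x g])
  also have "\<dots> \<le> 0" using r0 ip_nonneg[OF g] by (simp add: mult_nonneg_nonpos)
  finally show ?thesis using p0 by simp
qed

lemma \<rho>_measurable: "\<rho> \<in> borel_measurable M"
  unfolding \<rho>_eq[abs_def]
  using measurable_H[OF \<eta>_mem] borel_measurable_integrable[OF integrable_residual_kernel]
  by (intro borel_measurable_times borel_measurable_add borel_measurable_divide
      borel_measurable_const borel_measurable_sum borel_measurable_power borel_measurable_norm) auto

lemma space_\<mu>: "space \<mu> = D"
  by (simp add: \<mu>_def space_M)

lemma measurable_\<mu>: "f \<in> borel_measurable M \<Longrightarrow> f \<in> borel_measurable \<mu>"
  by (simp add: \<mu>_def)

lemma weighted_measurable: "f \<in> H \<Longrightarrow> weighted \<rho> f \<in> borel_measurable \<mu>"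
proof -
  assume f: "f \<in> H"
  have [measurable]: "\<rho> \<in> borel_measurable M" "f \<in> borel_measurable M"
    using \<rho>_measurable measurable_H[OF f] .
  have "weighted \<rho> f \<in> borel_measurable M" unfolding weighted_def[abs_def] by measurable
  then show ?thesis by (rule measurable_\<mu>)
qed

text \<open>The squared weight cancels the density, so covariances under the sampling measure are L2
  inner products.\<close>

lemma weighted_cov:
  assumes f: "f \<in> H" and g: "g \<in> H"
  shows "(LINT x|\<mu>. weighted \<rho> f x * cnj (weighted \<rho> g x)) = l2_inner M f g"
proof -
  have "weighted \<rho> f \<in> borel_measurable M" "weighted \<rho> g \<in> borel_measurable M"
    using weighted_measurable f g by (simp_all add: \<mu>_def)
  then have "(LINT x|\<mu>. weighted \<rho> f x * cnj (weighted \<rho> g x)) =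
      (LINT x|M. \<rho> x *\<^sub>R (weighted \<rho> f x * cnj (weighted \<rho> g x)))"
    unfolding \<mu>_def using \<rho>_ge(3) space_M
    by (intro integral_density \<rho>_measurable borel_measurable_times borel_measurable_cnj AE_I2) auto
  also have "\<dots> = (LINT x|M. f x * cnj (g x))"
  proof (rule Bochner_Integration.integral_cong[OF refl])
    fix x assume "x \<in> space M"
    then have x: "x \<in> D" by (simp add: space_M)
    show "\<rho> x *\<^sub>R (weighted \<rho> f x * cnj (weighted \<rho> g x)) = f x * cnj (g x)"
    proof (cases "\<rho> x = 0")
      case True
      then show ?thesis using \<rho>_zero[OF x True f] by simp
    next
      case False
      then have "0 < \<rho> x" using \<rho>_ge(3)[OF x] by simp
      then have "complex_of_real (sqrt (\<rho> x)) * complex_of_real (sqrt (\<rho> x)) = of_real (\<rho> x)"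
        unfolding of_real_mult[symmetric] by simp
      then show ?thesis using \<open>0 < \<rho> x\<close> by (simp add: weighted_def scaleR_conv_of_real)
    qed
  qed
  finally show ?thesis by (simp add: l2_inner_def)
qed

lemma prob_space_\<mu>: "prob_space \<mu>"
proof
  have int: "integrable M (\<lambda>x. (cmod (\<eta> j x))\<^sup>2)" if "j \<in> {1..m - 1}" for j
    using that by (intro integrable_sq \<eta>_mem) auto
  have q\<eta>: "(LINT x|M. (cmod (\<eta> j x))\<^sup>2) = 1" if "j \<in> {1..m - 1}" for j
  proof -
    have j: "1 \<le> j" using that by simp
    have "(LINT x|M. (cmod (\<eta> j x))\<^sup>2) = (LINT x|M. (cmod (e j x))\<^sup>2 / lam j)"
      using cmod_\<eta>[OF j] by simp
    then show ?thesis using q_eq[OF e_mem[OF j]] q_e[OF j] lam_pos[OF j] by simp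
  qed
  have "integrable M \<rho>"
    unfolding \<rho>_eq[abs_def] using int integrable_residual_kernel
    by (intro integrable_mult_right Bochner_Integration.integrable_add integrable_divide
        Bochner_Integration.integrable_sum) auto
  moreover have "(LINT x|M. \<rho> x) = 1"
  proof -
    have "(LINT x|M. \<rho> x) = 1 / 2 * (1 / real (m - 1) * (\<Sum>j\<in>{1..m - 1}. (LINT x|M. (cmod (\<eta> j x))\<^sup>2)) +
        (LINT x|M. residual_kernel {1..m - 1} e x) / tail)"
    proof -
      have "integrable M (\<lambda>x. 1 / real (m - 1) * (\<Sum>j\<in>{1..m - 1}. (cmod (\<eta> j x))\<^sup>2))"
        using int by (intro integrable_mult_right Bochner_Integration.integrable_sum)
      moreover have "integrable M (\<lambda>x. residual_kernel {1..m - 1} e x / tail)"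
        using integrable_residual_kernel by (intro integrable_divide)
      ultimately show ?thesis
        unfolding \<rho>_eq by (simp only: integral_mult_right_zero integral_divide_zero
            Bochner_Integration.integral_add Bochner_Integration.integral_sum[OF int])
    qed
    also have "\<dots> = 1 / 2 * (1 / real (m - 1) * real (m - 1) + tail / tail)"
      unfolding integral_residual_kernel tail_def[symmetric] using q\<eta> by simp
    finally show ?thesis using m2 tail_pos by simp
  qed
  ultimately have "(\<integral>\<^sup>+x. ennreal (\<rho> x) \<partial>M) = 1"
    using \<rho>_ge(3) space_M by (subst nn_integral_eq_integral) auto
  moreover have "emeasure \<mu> (space \<mu>) = (\<integral>\<^sup>+x. ennreal (\<rho> x) * indicator (space M) x \<partial>M)"
    unfolding \<mu>_def space_density using \<rho>_measurable by (intro emeasure_density) auto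
  moreover have "(\<integral>\<^sup>+x. ennreal (\<rho> x) * indicator (space M) x \<partial>M) = (\<integral>\<^sup>+x. ennreal (\<rho> x) \<partial>M)"
    by (intro nn_integral_cong) simp
  ultimately show "emeasure \<mu> (space \<mu>) = 1" by simp
qed

lemma sum_weighted_sq: "\<rho> x \<noteq> 0 \<Longrightarrow> x \<in> D \<Longrightarrow> (cmod (weighted \<rho> f x))\<^sup>2 = (cmod (f x))\<^sup>2 / \<rho> x"
  using \<rho>_ge(3)[of x] by (simp add: weighted_def norm_divide power_divide)

text \<open>The covariance is the identity because the \<open>\<eta> i\<close> are orthonormal in
  L2; the norm bound is the first half of the density.\<close>

sublocale low: random_vector \<mu> "{1..m - 1}" "\<lambda>x i. weighted \<rho> (\<eta> i) x" "2 * real (m - 1)" "\<lambda>_. 1"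
proof (intro random_vector.intro random_vector_axioms.intro prob_space_\<mu>)
  show "(\<lambda>x. weighted \<rho> (\<eta> i) x) \<in> borel_measurable \<mu>" if "i \<in> {1..m - 1}" for i
    using weighted_measurable[OF \<eta>_mem, of i] that by simp
  fix x assume "x \<in> space \<mu>"
  then have x: "x \<in> D" by (simp add: space_\<mu>)
  show "(\<Sum>i\<in>{1..m - 1}. (cmod (weighted \<rho> (\<eta> i) x))\<^sup>2) \<le> 2 * real (m - 1)"
  proof (cases "\<rho> x = 0")
    case True
    then show ?thesis by (simp add: weighted_def)
  next
    case False
    then have "0 < \<rho> x" using \<rho>_ge(3)[OF x] by simp
    then show ?thesis using \<rho>_ge(1)[OF x] False x
      by (simp add: sum_weighted_sq pos_divide_le_eq flip: sum_divide_distrib)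
  qed
next
  fix i k assume ik: "i \<in> {1..m - 1}" "k \<in> {1..m - 1}"
  then have i: "1 \<le> i" "1 \<le> k" by auto
  have "l2_inner M (\<eta> i) (\<eta> k) = of_real (inverse (sqrt (lam i))) * cnj (of_real (inverse (sqrt (lam k))) * l2_inner M (e k) (e i))"
    unfolding \<eta>_def l2_scale by (subst l2_cnj) (simp add: l2_scale)
  also have "l2_inner M (e k) (e i) = of_real (lam i) * (if k = i then 1 else 0)"
    using i by (simp add: l2_e_right e_mem ip_e)
  also have "of_real (inverse (sqrt (lam i))) * cnj (of_real (inverse (sqrt (lam k))) * (of_real (lam i) * (if k = i then 1 else 0)))
     = (if i = k then of_real (inverse (sqrt (lam i)) * inverse (sqrt (lam i)) * lam i) else (0 :: complex))"
    by simp
  also have "inverse (sqrt (lam i)) * inverse (sqrt (lam i)) * lam i = 1"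
    using lam_pos[OF i(1)] by (simp flip: inverse_mult_distrib)
  finally show "(LINT x|\<mu>. weighted \<rho> (\<eta> i) x * cnj (weighted \<rho> (\<eta> k) x)) = (if i = k then of_real 1 else 0)"
    using weighted_cov[OF \<eta>_mem \<eta>_mem] i by simp
qed simp

text \<open>The covariances are the eigenvalues, and the second half of the density bounds the
  vectors by \<open>2 * tail\<close>, uniformly in \<open>N\<close>.\<close>

lemma random_vector_up: "random_vector \<mu> {m..N} (\<lambda>x i. weighted \<rho> (e i) x) (2 * tail) lam"
proof (intro random_vector.intro random_vector_axioms.intro prob_space_\<mu>)
  have ge1: "1 \<le> i" if "i \<in> {m..N}" for i using that m2 by auto
  show "(\<lambda>x. weighted \<rho> (e i) x) \<in> borel_measurable \<mu>" if "i \<in> {m..N}" for i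
    using weighted_measurable[OF e_mem[OF ge1[OF that]]] .
  fix x assume "x \<in> space \<mu>"
  then have x: "x \<in> D" by (simp add: space_\<mu>)
  show "(\<Sum>i\<in>{m..N}. (cmod (weighted \<rho> (e i) x))\<^sup>2) \<le> 2 * tail"
  proof (cases "\<rho> x = 0")
    case True
    then show ?thesis using tail_pos by (simp add: weighted_def)
  next
    case False
    then have pos: "0 < \<rho> x" using \<rho>_ge(3)[OF x] by simp
    have "(\<Sum>i\<in>{m..N}. (cmod (e i x))\<^sup>2) \<le> residual_kernel {1..m - 1} e x"
    proof (cases "m - 1 \<le> N")
      case True
      then have "{1..N} = {1..m - 1} \<union> {m..N}" using m2 by auto
      then have "(\<Sum>i\<in>{1..N}. (cmod (e i x))\<^sup>2) = (\<Sum>i\<in>{1..m - 1}. (cmod (e i x))\<^sup>2) + (\<Sum>i\<in>{m..N}. (cmod (e i x))\<^sup>2)"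
        using m2 by (simp add: sum.union_disjoint)
      then show ?thesis using residual_nonneg[OF x, of N] by (simp add: residual_kernel_def)
    next
      case False
      then show ?thesis using residual_nonneg[OF x] by simp
    qed
    also have "\<dots> \<le> 2 * tail * \<rho> x" by (rule \<rho>_ge(2)[OF x])
    finally show ?thesis using False x pos
      by (simp add: sum_weighted_sq pos_divide_le_eq flip: sum_divide_distrib)
  qed
next
  fix i k assume ik: "i \<in> {m..N}" "k \<in> {m..N}"
  then have i: "1 \<le> i" "1 \<le> k" using m2 by auto
  show "(LINT x|\<mu>. weighted \<rho> (e i) x * cnj (weighted \<rho> (e k) x)) = (if i = k then of_real (lam i) else 0)"
    using weighted_cov[OF e_mem e_mem] i by (simp add: l2_e_right e_mem ip_e)
qed simp

text \<open>The squared norm of weighted point evaluation on the complement of \<open>e 1\<close> to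
  \<open>e N\<close>. The test \<open>x \<in> D\<close> makes it nonnegative everywhere, as the
  Markov estimate requires.\<close>

definition weighted_residual :: "nat \<Rightarrow> 'a \<Rightarrow> real" where
  "weighted_residual N x = (if x \<in> D \<and> \<rho> x \<noteq> 0 then residual_kernel {1..N} e x / \<rho> x else 0)"

lemma weighted_residual_nonneg: "0 \<le> weighted_residual N x"
  using residual_nonneg \<rho>_ge(3) by (simp add: weighted_residual_def)

lemma weighted_residual_bound:
  assumes x: "x \<in> D" and f: "f \<in> H" "\<And>j. j \<in> {1..N} \<Longrightarrow> ip f (e j) = 0"
  shows "(cmod (weighted \<rho> f x))\<^sup>2 \<le> nsq f * weighted_residual N x"
proof (cases "\<rho> x = 0")
  case False
  have "(cmod (f x))\<^sup>2 / \<rho> x \<le> nsq f * residual_kernel {1..N} e x / \<rho> x"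
    using residual_eval_bound[OF on_atMost[of N] _ x f] \<rho>_ge(3)[OF x]
    by (intro divide_right_mono) auto
  then show ?thesis using x False by (simp add: sum_weighted_sq weighted_residual_def)
qed (simp add: weighted_def weighted_residual_def)

lemma weighted_residual_measurable: "weighted_residual N \<in> borel_measurable \<mu>"
proof -
  have [measurable]: "\<rho> \<in> borel_measurable M" "residual_kernel {1..N} e \<in> borel_measurable M"
    using \<rho>_measurable borel_measurable_integrable[OF integrable_residual_kernel] by auto
  have "(\<lambda>x. if \<rho> x \<noteq> 0 then residual_kernel {1..N} e x / \<rho> x else 0) \<in> borel_measurable M" by measurable
  then have "weighted_residual N \<in> borel_measurable M"
    by (rule subst[OF measurable_cong, rotated]) (simp add: weighted_residual_def space_M)
  then show ?thesis by (rule measurable_\<mu>)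
qed

lemma nn_integral_weighted_residual:
  "(\<integral>\<^sup>+x. ennreal (weighted_residual N x) \<partial>\<mu>) \<le> ennreal (tr - sum lam {1..N})"
proof -
  have "(\<integral>\<^sup>+x. ennreal (weighted_residual N x) \<partial>\<mu>) =
      (\<integral>\<^sup>+x. ennreal (\<rho> x) * ennreal (weighted_residual N x) \<partial>M)"
    unfolding \<mu>_def using \<rho>_measurable weighted_residual_measurable
    by (intro nn_integral_density) (auto simp: \<mu>_def)
  also have "\<dots> \<le> (\<integral>\<^sup>+x. ennreal (residual_kernel {1..N} e x) \<partial>M)"
  proof (intro nn_integral_mono)
    fix x assume "x \<in> space M"
    then have x: "x \<in> D" by (simp add: space_M)
    show "ennreal (\<rho> x) * ennreal (weighted_residual N x) \<le> ennreal (residual_kernel {1..N} e x)"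
      using \<rho>_ge(3)[OF x] residual_nonneg[OF x, of N] x
      by (simp add: weighted_residual_def flip: ennreal_mult)
  qed
  also have "\<dots> = ennreal (tr - sum lam {1..N})"
    using integral_residual_kernel integrable_residual_kernel residual_nonneg space_M
    by (subst nn_integral_eq_integral) auto
  finally show ?thesis .
qed

text \<open>A first-moment bound is enough, because \<open>N\<close> is chosen after
  \<open>\<epsilon>\<close> and \<open>\<delta>\<close> and the expectation tends to 0.\<close>

lemma tail_event:
  assumes \<epsilon>: "0 < \<epsilon>" and \<delta>: "0 < \<delta>"
  shows "\<exists>N\<ge>m. \<exists>B\<in>sets Q. measure Q B \<le> \<delta> \<and>
    (\<forall>X\<in>space Q - B. (\<Sum>l\<in>{1..n}. weighted_residual N (X l)) \<le> real n * \<epsilon>)"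
proof -
  have "\<forall>\<^sub>F N in sequentially. tr - sum lam {1..N} < \<epsilon> * \<delta>"
    using order_tendstoD(2)[OF residual_trace_tendsto] \<epsilon> \<delta> by simp
  then obtain N0 where "\<And>N. N0 \<le> N \<Longrightarrow> tr - sum lam {1..N} < \<epsilon> * \<delta>"
    by (auto simp: eventually_sequentially)
  then obtain N where N: "m \<le> N" "tr - sum lam {1..N} < \<epsilon> * \<delta>" by (meson max.cobounded1 max.cobounded2)
  have z: "0 \<le> tr - sum lam {1..N}" using sum_lam_le[of "{1..N}"] by auto
  let ?f = "\<lambda>k X. \<Sum>l\<in>{1..k}. weighted_residual N (X l)"
  have f0: "0 \<le> ?f k X" for k X by (intro sum_nonneg weighted_residual_nonneg)
  have meas: "?f k \<in> borel_measurable (PiM {1..k} (\<lambda>_. \<mu>))" for k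
  proof (intro borel_measurable_sum)
    fix l assume "l \<in> {1..k}"
    then show "(\<lambda>X. weighted_residual N (X l)) \<in> borel_measurable (PiM {1..k} (\<lambda>_. \<mu>))"
      using measurable_compose[OF measurable_component_singleton[of l "{1..k}" "\<lambda>_. \<mu>"] weighted_residual_measurable]
      by simp
  qed
  have "(\<integral>\<^sup>+X. ennreal (?f n X) \<partial>Q) \<le> 1 ^ n * 0 + (\<Sum>i<n. 1 ^ i) * ennreal (tr - sum lam {1..N})"
  proof (rule nn_integral_PiM_recursion[OF prob_space_\<mu>])
    show "(\<lambda>X. ennreal (?f k X)) \<in> borel_measurable (PiM {1..k} (\<lambda>_. \<mu>))" for k
      using meas[of k] by measurable
    fix k X
    have "{1..Suc k} = insert (Suc k) {1..k}" by auto
    then have "?f (Suc k) (X(Suc k := x)) = ?f k X + weighted_residual N x" for x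
      by (simp add: add.commute)
    then have "(\<integral>\<^sup>+x. ennreal (?f (Suc k) (X(Suc k := x))) \<partial>\<mu>) =
        (\<integral>\<^sup>+x. ennreal (?f k X) + ennreal (weighted_residual N x) \<partial>\<mu>)"
      by (simp only: ennreal_plus[OF f0 weighted_residual_nonneg])
    also have "\<dots> = ennreal (?f k X) + (\<integral>\<^sup>+x. ennreal (weighted_residual N x) \<partial>\<mu>)"
      using weighted_residual_measurable by (subst nn_integral_add) (auto simp: low.emeasure_space_1)
    finally show "(\<integral>\<^sup>+x. ennreal (?f (Suc k) (X(Suc k := x))) \<partial>\<mu>) \<le>
        1 * ennreal (?f k X) + ennreal (tr - sum lam {1..N})"
      using nn_integral_weighted_residual[of N] by (simp add: add_left_mono)
  qed simp
  also have "\<dots> = ennreal (real n * (tr - sum lam {1..N}))" using z by (simp add: ennreal_mult ennreal_of_nat_eq_real_of_nat)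
  finally have int: "(\<integral>\<^sup>+X. ennreal (?f n X) \<partial>Q) \<le> ennreal (real n * (tr - sum lam {1..N}))" .
  have "measure Q {X \<in> space Q. real n * \<epsilon> \<le> ?f n X} \<le> (real n * (tr - sum lam {1..N})) / (real n * \<epsilon>)"
    by (rule markov_sublevel[OF low.prob_space_P meas f0 int]) (use z \<epsilon> n1 in auto)
  also have "\<dots> \<le> \<delta>" using N(2) \<epsilon> n1 by (simp add: divide_le_eq mult.commute)
  finally have "measure Q {X \<in> space Q. real n * \<epsilon> \<le> ?f n X} \<le> \<delta>" .
  moreover have "{X \<in> space Q. real n * \<epsilon> \<le> ?f n X} \<in> sets Q" using meas[of n] by measurable
  ultimately show ?thesis using N(1)
    by (intro exI[of _ N] conjI bexI[of _ "{X \<in> space Q. real n * \<epsilon> \<le> ?f n X}"]) auto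
qed

lemma l2_\<eta>: "f \<in> H \<Longrightarrow> 1 \<le> k \<Longrightarrow> l2_inner M f (\<eta> k) = of_real (sqrt (lam k)) * ip f (e k)"
proof -
  assume f: "f \<in> H" and k: "1 \<le> k"
  have "l2_inner M f (\<eta> k) = cnj (of_real (inverse (sqrt (lam k))) * l2_inner M (e k) f)"
    unfolding \<eta>_def by (subst l2_cnj) (simp add: l2_scale)
  also have "\<dots> = of_real (inverse (sqrt (lam k))) * l2_inner M f (e k)"
    using l2_cnj[of f "e k"] by simp
  also have "\<dots> = of_real (inverse (sqrt (lam k)) * lam k) * ip f (e k)"
    using f k by (simp add: l2_e_right)
  also have "inverse (sqrt (lam k)) * lam k = sqrt (lam k)"
    using lam_pos[OF k] by (simp add: real_sqrt_divide[symmetric] field_simps)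
  finally show ?thesis .
qed

lemma proj_\<eta>:
  assumes "f \<in> H"
  shows "proj {1..m - 1} e f = (\<Sum>k\<in>{1..m - 1}. fscale (l2_inner M f (\<eta> k)) (\<eta> k))"
  unfolding proj_def
proof (intro sum.cong refl)
  fix k assume "k \<in> {1..m - 1}"
  then have k: "1 \<le> k" by simp
  have "sqrt (lam k) * inverse (sqrt (lam k)) = 1" using lam_pos[OF k] by simp
  then have "complex_of_real (sqrt (lam k)) * of_real (inverse (sqrt (lam k))) = 1"
    by (metis of_real_1 of_real_mult)
  then have "l2_inner M f (\<eta> k) * of_real (inverse (sqrt (lam k))) = ip f (e k)"
    unfolding l2_\<eta>[OF assms k] by (metis mult.assoc mult.commute mult_1_right)
  then show "fscale (ip f (e k)) (e k) = fscale (l2_inner M f (\<eta> k)) (\<eta> k)"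
    by (simp add: \<eta>_def fscale_def fun_eq_iff flip: mult.assoc)
qed

text \<open>Pythagoras: the approximant lies in the span of the orthonormal \<open>\<eta> k\<close>,
  so the error splits into projection error and coefficient error. The second identity expresses the
  former by Fourier coefficients, as used in \<open>error_form\<close>.\<close>

lemma error_formula:
  assumes f: "f \<in> H"
  shows "l2_norm_sq M (f - (\<Sum>k\<in>{1..m - 1}. fscale (c k) (\<eta> k))) =
      ennreal (q (f - proj {1..m - 1} e f) + (\<Sum>k\<in>{1..m - 1}. (cmod (l2_inner M f (\<eta> k) - c k))\<^sup>2))"
    and "q (f - proj {1..m - 1} e f) = q f - (\<Sum>k\<in>{1..m - 1}. (cmod (l2_inner M f (\<eta> k)))\<^sup>2)"
proof -
  let ?I = "{1..m - 1}"
  let ?g = "f - proj ?I e f"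
  have \<eta>H: "\<eta> k \<in> H" if "k \<in> ?I" for k using that by (simp add: \<eta>_mem)
  have g: "?g \<in> H" using f proj_mem[OF on_atMost] by simp
  have g_orth: "l2_inner M ?g (\<eta> k) = 0" if "k \<in> ?I" for k
    using that l2_\<eta>[OF g, of k] ip_diff_proj_basis[OF on_atMost _ f that] by simp
  have \<eta>_orth: "l2_inner M (\<eta> i) (\<eta> k) = (if i = k then 1 else 0)" if "i \<in> ?I" "k \<in> ?I" for i k
    using low.v_cov[OF that] weighted_cov[OF \<eta>H \<eta>H] that by simp
  have pyth: "q (?g + (\<Sum>k\<in>?I. fscale (d k) (\<eta> k))) = q ?g + (\<Sum>k\<in>?I. (cmod (d k))\<^sup>2)" for d
  proof -
    let ?h = "\<Sum>k\<in>?I. fscale (d k) (\<eta> k)"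
    have h: "?h \<in> H" using \<eta>H by (intro H_sum) auto
    have hg: "l2_inner M ?h ?g = 0"
    proof -
      have "l2_inner M (\<eta> k) ?g = 0" if "k \<in> ?I" for k using l2_cnj[of "\<eta> k" ?g] g_orth[OF that] by simp
      moreover have "l2_inner M ?h ?g = (\<Sum>k\<in>?I. d k * l2_inner M (\<eta> k) ?g)"
        using \<eta>H g by (intro l2_sum_left) auto
      ultimately show ?thesis by simp
    qed
    have hk: "l2_inner M ?h (\<eta> k) = d k" if "k \<in> ?I" for k
    proof -
      have "l2_inner M ?h (\<eta> k) = (\<Sum>i\<in>?I. d i * l2_inner M (\<eta> i) (\<eta> k))"
        using \<eta>H that by (intro l2_sum_left) auto
      also have "\<dots> = (\<Sum>i\<in>?I. d i * (if i = k then 1 else 0))"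
        using that by (intro sum.cong refl) (simp only: \<eta>_orth)
      also have "\<dots> = (\<Sum>i\<in>?I. if i = k then d i else 0)" by (intro sum.cong) auto
      finally show ?thesis using that by (simp only: sum.delta finite_atLeastAtMost if_True)
    qed
    have "l2_inner M ?h ?h = (\<Sum>k\<in>?I. d k * l2_inner M (\<eta> k) ?h)"
      using \<eta>H h by (intro l2_sum_left) auto
    also have "\<dots> = (\<Sum>k\<in>?I. of_real ((cmod (d k))\<^sup>2))"
    proof (intro sum.cong refl)
      fix k assume "k \<in> ?I"
      then have "l2_inner M (\<eta> k) ?h = cnj (d k)" using l2_cnj[of "\<eta> k" ?h] hk by simp
      then show "d k * l2_inner M (\<eta> k) ?h = of_real ((cmod (d k))\<^sup>2)"
        by (simp only: complex_norm_square)
    qed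
    finally have qh: "q ?h = (\<Sum>k\<in>?I. (cmod (d k))\<^sup>2)"
      by (simp only: of_real_sum[symmetric] Re_complex_of_real)
    show ?thesis unfolding q_add_orthogonal[OF g h hg] qh ..
  qed
  have dec: "f - (\<Sum>k\<in>?I. fscale (c k) (\<eta> k)) = ?g + (\<Sum>k\<in>?I. fscale (l2_inner M f (\<eta> k) - c k) (\<eta> k))"
  proof -
    have "(\<Sum>k\<in>?I. fscale (l2_inner M f (\<eta> k) - c k) (\<eta> k)) =
      proj ?I e f - (\<Sum>k\<in>?I. fscale (c k) (\<eta> k))"
      unfolding proj_\<eta>[OF f] by (simp only: cfun.scale_left_diff_distrib sum_subtractf)
    then show ?thesis by (simp only: add_diff_eq diff_add_cancel)
  qed
  have mem: "f - (\<Sum>k\<in>?I. fscale (c k) (\<eta> k)) \<in> H"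
    by (rule H_diff[OF f H_sum]) (rule H_scale[OF \<eta>H])
  show "l2_norm_sq M (f - (\<Sum>k\<in>?I. fscale (c k) (\<eta> k))) =
      ennreal (q ?g + (\<Sum>k\<in>?I. (cmod (l2_inner M f (\<eta> k) - c k))\<^sup>2))"
    unfolding l2_norm_sq_eq[OF mem] unfolding dec pyth ..
  have "?g + (\<Sum>k\<in>?I. fscale (l2_inner M f (\<eta> k)) (\<eta> k)) = f"
    unfolding proj_\<eta>[OF f, symmetric] by (simp only: diff_add_cancel)
  with pyth[of "\<lambda>k. l2_inner M f (\<eta> k)"] show
    "q ?g = q f - (\<Sum>k\<in>?I. (cmod (l2_inner M f (\<eta> k)))\<^sup>2)" by (simp only:)
qed

end

section \<open>The error of the sampled operator\<close>

text \<open>Young's inequality weighted by \<open>s' / s\<close>. As the two parts share a unit of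
  squared norm, the bounds add up to \<open>s + s'\<close>, where equal weights would give twice the
  larger one.\<close>

lemma sum_cmod_add_sq_le:
  fixes a b :: "'i \<Rightarrow> complex" and s s' \<alpha> \<beta> :: real
  assumes s: "0 < s" "0 < s'" and a: "(\<Sum>l\<in>J. (cmod (a l))\<^sup>2) \<le> s * \<alpha>"
    and b: "(\<Sum>l\<in>J. (cmod (b l))\<^sup>2) \<le> s' * \<beta>" and ab: "\<alpha> + \<beta> \<le> 1"
  shows "(\<Sum>l\<in>J. (cmod (a l + b l))\<^sup>2) \<le> s + s'"
proof -
  have le: "(cmod (x + y))\<^sup>2 \<le> (1 + s' / s) * (cmod x)\<^sup>2 + (1 + s / s') * (cmod y)\<^sup>2" for x y
  proof -
    have "0 \<le> (cmod x * s' - cmod y * s)\<^sup>2 / (s * s')" using s by simp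
    also have "\<dots> = s' / s * (cmod x)\<^sup>2 - 2 * (cmod x * cmod y) + s / s' * (cmod y)\<^sup>2"
      using s by (simp add: power2_eq_square field_simps)
    finally have "2 * (cmod x * cmod y) \<le> s' / s * (cmod x)\<^sup>2 + s / s' * (cmod y)\<^sup>2" by linarith
    moreover have "(cmod (x + y))\<^sup>2 \<le> (cmod x + cmod y)\<^sup>2"
      by (intro power_mono norm_triangle_ineq) simp
    ultimately show ?thesis by (simp add: power2_sum algebra_simps)
  qed
  have "(\<Sum>l\<in>J. (cmod (a l + b l))\<^sup>2) \<le> (\<Sum>l\<in>J. (1 + s' / s) * (cmod (a l))\<^sup>2 + (1 + s / s') * (cmod (b l))\<^sup>2)"
    by (intro sum_mono le)
  also have "\<dots> = (1 + s' / s) * (\<Sum>l\<in>J. (cmod (a l))\<^sup>2) + (1 + s / s') * (\<Sum>l\<in>J. (cmod (b l))\<^sup>2)"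
    by (simp only: sum.distrib sum_distrib_left)
  also have "\<dots> \<le> (1 + s' / s) * (s * \<alpha>) + (1 + s / s') * (s' * \<beta>)"
    using s a b by (intro add_mono mult_left_mono) auto
  also have "\<dots> = (s + s') * (\<alpha> + \<beta>)" using s by (simp add: field_simps)
  also have "\<dots> \<le> (s + s') * 1" using s ab by (intro mult_left_mono) auto
  finally show ?thesis by simp
qed

context wls_sampling
begin

lemma space_Q: "X \<in> space Q \<Longrightarrow> l \<in> {1..n} \<Longrightarrow> X l \<in> D"
  by (auto simp: space_PiM space_\<mu>)

text \<open>The residual \<open>?g\<close> is cut at \<open>N\<close>: \<open>upper\<close> handles
  the coordinates from \<open>m\<close> to \<open>N\<close>, and \<open>rest\<close> the remainder.
  Stability with the constant \<open>n / 4\<close> gives the factor \<open>4 / n\<close>, and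
  \<open>lam m\<close> is the projection error.\<close>

lemma error_bound:
  assumes X: "X \<in> space Q" and N: "m \<le> N" and s: "0 < s" and \<epsilon>: "0 < \<epsilon>"
    and lower: "\<And>c. real n / 4 * (\<Sum>i\<in>{1..m - 1}. (cmod (c i))\<^sup>2) \<le>
      (\<Sum>l\<in>{1..n}. (cmod (inner_on {1..m - 1} c (\<lambda>i. weighted \<rho> (\<eta> i) (X l))))\<^sup>2)"
    and upper: "\<And>c. (\<Sum>l\<in>{1..n}. (cmod (inner_on {m..N} c (\<lambda>i. weighted \<rho> (e i) (X l))))\<^sup>2)
      \<le> s * (\<Sum>i\<in>{m..N}. (cmod (c i))\<^sup>2)"
    and rest: "(\<Sum>l\<in>{1..n}. weighted_residual N (X l)) \<le> real n * \<epsilon>"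
    and f: "f \<in> H" "nsq f \<le> 1"
  shows "l2_norm_sq M (f - wls_operator \<eta> \<rho> n m X f) \<le> ennreal (lam m + 4 / real n * (s + real n * \<epsilon>))"
proof -
  have npos: "0 < real n" using n1 by simp
  let ?I = "{1..m - 1}" and ?a = "\<lambda>k. l2_inner M f (\<eta> k)" and ?w = "\<lambda>f x. weighted \<rho> f x"
  let ?p = "proj ?I e f"
  let ?g = "f - ?p"
  have gH: "?g \<in> H" using f proj_mem[OF on_atMost] by simp
  have stab: "wls_defined \<eta> \<rho> n m X"
    "real n / 4 * (\<Sum>k\<in>?I. (cmod (wls_coeffs \<eta> \<rho> n m X ?g $ (k - 1)))\<^sup>2) \<le> (\<Sum>l\<in>{1..n}. (cmod (?w ?g (X l)))\<^sup>2)"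
    using wls_stability[OF _ lower] npos by auto
  have "?g + (\<Sum>k\<in>?I. fscale (?a k) (\<eta> k)) = f"
    unfolding proj_\<eta>[OF f(1), symmetric] by (simp only: diff_add_cancel)
  then have coeff: "wls_coeffs \<eta> \<rho> n m X f $ (k - 1) = wls_coeffs \<eta> \<rho> n m X ?g $ (k - 1) + ?a k" if "k \<in> ?I" for k
    using wls_coeffs_add_comb[OF stab(1) that, of ?g ?a] by simp
  have g_orth: "ip ?g (e j) = 0" if "j \<in> ?I" for j
    by (rule ip_diff_proj_basis[OF on_atMost _ f(1) that]) simp
  have nsq_g: "nsq ?g \<le> 1"
    using nsq_diff_proj[OF on_atMost _ f(1), of "m - 1"] f(2)
      sum_nonneg[of ?I "\<lambda>i. (cmod (ip f (e i)))\<^sup>2"] by simp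
  have "q ?g \<le> lam m * nsq ?g"
  proof (rule q_tail_le[OF _ gH])
    show "ip ?g (e j) = 0" if "j \<in> {1..<m}" for j using that by (intro g_orth) auto
  qed (use m2 in simp)
  also have "\<dots> \<le> lam m * 1" using nsq_g lam_m_pos by (intro mult_left_mono) auto
  finally have qg: "q ?g \<le> lam m" by simp
  let ?u = "\<Sum>i\<in>{m..N}. fscale (ip f (e i)) (e i)" and ?h = "f - proj {1..N} e f"
  have split: "{1..N} = ?I \<union> {m..N}" "?I \<inter> {m..N} = {}" using N m2 by auto
  have g_eq: "?g = ?u + ?h"
    unfolding proj_def split(1) using split(2) by (subst sum.union_disjoint) auto
  let ?\<alpha> = "\<Sum>i\<in>{m..N}. (cmod (ip f (e i)))\<^sup>2"
  have hH: "?h \<in> H" using f proj_mem[OF on_atMost] by simp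
  have "nsq ?h = nsq f - (\<Sum>i\<in>{1..N}. (cmod (ip f (e i)))\<^sup>2)"
    by (rule nsq_diff_proj[OF on_atMost _ f(1)]) simp
  moreover have "?\<alpha> \<le> (\<Sum>i\<in>{1..N}. (cmod (ip f (e i)))\<^sup>2)"
    using split(1) by (intro sum_mono2) auto
  ultimately have \<alpha>\<beta>: "?\<alpha> + nsq ?h \<le> 1" using f(2) by linarith
  have "(\<Sum>l\<in>{1..n}. (cmod (?w ?u (X l) + ?w ?h (X l)))\<^sup>2) \<le> s + real n * \<epsilon>"
  proof (rule sum_cmod_add_sq_le[OF s _ _ _ \<alpha>\<beta>])
    have "cmod (?w ?u (X l)) = cmod (inner_on {m..N} (\<lambda>i. cnj (ip f (e i))) (\<lambda>i. ?w (e i) (X l)))" for l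
    proof -
      have "?w ?u (X l) = cnj (inner_on {m..N} (\<lambda>i. cnj (ip f (e i))) (\<lambda>i. ?w (e i) (X l)))"
        by (simp add: weighted_comb inner_on_def)
      then show ?thesis by (simp only: complex_mod_cnj)
    qed
    then show "(\<Sum>l\<in>{1..n}. (cmod (?w ?u (X l)))\<^sup>2) \<le> s * ?\<alpha>"
      using upper[of "\<lambda>i. cnj (ip f (e i))"] by simp
    have "(\<Sum>l\<in>{1..n}. (cmod (?w ?h (X l)))\<^sup>2) \<le> (\<Sum>l\<in>{1..n}. nsq ?h * weighted_residual N (X l))"
    proof (intro sum_mono weighted_residual_bound[OF _ hH])
      show "ip ?h (e j) = 0" if "j \<in> {1..N}" for j
        by (rule ip_diff_proj_basis[OF on_atMost _ f(1) that]) simp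
    qed (rule space_Q[OF X])
    also have "\<dots> = nsq ?h * (\<Sum>l\<in>{1..n}. weighted_residual N (X l))" by (rule sum_distrib_left[symmetric])
    also have "\<dots> \<le> nsq ?h * (real n * \<epsilon>)" using rest ip_nonneg[OF hH] by (rule mult_left_mono)
    finally show "(\<Sum>l\<in>{1..n}. (cmod (?w ?h (X l)))\<^sup>2) \<le> real n * \<epsilon> * nsq ?h" by (simp only: mult.commute)
  qed (use npos \<epsilon> in simp)
  then have wg: "(\<Sum>l\<in>{1..n}. (cmod (?w ?g (X l)))\<^sup>2) \<le> s + real n * \<epsilon>"
    unfolding g_eq weighted_add .
  let ?c = "\<Sum>k\<in>?I. (cmod (wls_coeffs \<eta> \<rho> n m X ?g $ (k - 1)))\<^sup>2"
  have "?c = 4 / real n * (real n / 4 * ?c)" using npos by simp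
  also have "\<dots> \<le> 4 / real n * (s + real n * \<epsilon>)"
    using order_trans[OF stab(2) wg] npos by (intro mult_left_mono) auto
  finally have cg: "?c \<le> 4 / real n * (s + real n * \<epsilon>)" .
  have "l2_norm_sq M (f - wls_operator \<eta> \<rho> n m X f) =
      ennreal (q ?g + (\<Sum>k\<in>?I. (cmod (?a k - wls_coeffs \<eta> \<rho> n m X f $ (k - 1)))\<^sup>2))"
    unfolding wls_operator_def by (rule error_formula(1)[OF f(1)])
  also have "(\<Sum>k\<in>?I. (cmod (?a k - wls_coeffs \<eta> \<rho> n m X f $ (k - 1)))\<^sup>2) =
      (\<Sum>k\<in>?I. (cmod (wls_coeffs \<eta> \<rho> n m X ?g $ (k - 1)))\<^sup>2)"
  proof (intro sum.cong refl)
    fix k assume k: "k \<in> ?I"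
    have "y - (x + y) = - x" for x y :: complex by simp
    then have "?a k - wls_coeffs \<eta> \<rho> n m X f $ (k - 1) = - wls_coeffs \<eta> \<rho> n m X ?g $ (k - 1)"
      unfolding coeff[OF k] .
    then show "(cmod (?a k - wls_coeffs \<eta> \<rho> n m X f $ (k - 1)))\<^sup>2 =
        (cmod (wls_coeffs \<eta> \<rho> n m X ?g $ (k - 1)))\<^sup>2" by (simp only: norm_minus_cancel)
  qed
  finally show ?thesis using qg cg by (simp only: ennreal_leI add_mono)
qed

section \<open>Measurability of the success event\<close>

definition error_form :: "(nat \<Rightarrow> 'a) \<Rightarrow> ('a \<Rightarrow> complex) \<Rightarrow> real" where
  "error_form X f = q f - (\<Sum>k\<in>{1..m - 1}. (cmod (l2_inner M f (\<eta> k)))\<^sup>2) +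
     (\<Sum>k\<in>{1..m - 1}. (cmod (l2_inner M f (\<eta> k) - coeff_formula \<eta> \<rho> n m X f k))\<^sup>2)"

lemma error_form_eq:
  assumes "wls_defined \<eta> \<rho> n m X" "f \<in> H"
  shows "l2_norm_sq M (f - wls_operator \<eta> \<rho> n m X f) = ennreal (error_form X f)"
proof -
  have "(\<Sum>k\<in>{1..m - 1}. (cmod (l2_inner M f (\<eta> k) - wls_coeffs \<eta> \<rho> n m X f $ (k - 1)))\<^sup>2) =
     (\<Sum>k\<in>{1..m - 1}. (cmod (l2_inner M f (\<eta> k) - coeff_formula \<eta> \<rho> n m X f k))\<^sup>2)"
    by (intro sum.cong refl) (simp only: wls_coeffs_formula[OF assms(1)])
  then show ?thesis
    unfolding wls_operator_def error_form_def error_formula(1)[OF assms(2)] error_formula(2)[OF assms(2)]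
    by (simp only:)
qed

lemma weighted_component_measurable:
  assumes "f \<in> H" "l \<in> {1..n}"
  shows "(\<lambda>X. weighted \<rho> f (X l)) \<in> borel_measurable Q"
  using measurable_compose[OF measurable_component_singleton[of l "{1..n}" "\<lambda>_. \<mu>"] weighted_measurable[OF assms(1)]]
    assms(2) by simp

lemma Bmat_measurable:
  assumes "i < m - 1" "k < m - 1"
  shows "(\<lambda>X. (mat_adjoint (wls_matrix \<eta> \<rho> n m X) * wls_matrix \<eta> \<rho> n m X) $$ (i, k)) \<in> borel_measurable Q"
proof -
  have "(mat_adjoint (wls_matrix \<eta> \<rho> n m X) * wls_matrix \<eta> \<rho> n m X) $$ (i, k) =
     (\<Sum>j<n. cnj (weighted \<rho> (\<eta> (Suc i)) (X (Suc j))) * weighted \<rho> (\<eta> (Suc k)) (X (Suc j)))" for X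
    unfolding gram_mat_index[OF Lmat_carrier assms] using assms by (intro sum.cong refl) (simp add: Lmat_index)
  then show ?thesis
    by (simp only:) (intro borel_measurable_sum borel_measurable_times borel_measurable_cnj
        weighted_component_measurable \<eta>_mem, auto)
qed

lemma det_Bmat_measurable:
  "(\<lambda>X. det (mat_adjoint (wls_matrix \<eta> \<rho> n m X) * wls_matrix \<eta> \<rho> n m X)) \<in> borel_measurable Q"
  by (rule det_measurable[OF Bmat_carrier Bmat_measurable])

lemma coeff_formula_measurable:
  assumes f: "f \<in> H" and k: "k \<in> {1..m - 1}"
  shows "(\<lambda>X. coeff_formula \<eta> \<rho> n m X f k) \<in> borel_measurable Q"
  unfolding coeff_formula_def
proof (intro borel_measurable_sum borel_measurable_times borel_measurable_divide borel_measurable_cnj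
      det_Bmat_measurable adj_mat_measurable[OF Bmat_carrier Bmat_measurable])
  show "k - 1 < m - 1" using k by auto
  show "l < m - 1" if "l \<in> {..<m - 1}" for l using that by simp
  fix j assume "j \<in> {..<n}"
  then have j: "Suc j \<in> {1..n}" by auto
  show "(\<lambda>X. weighted \<rho> (\<eta> (Suc l)) (X (Suc j))) \<in> borel_measurable Q" for l
    using j by (intro weighted_component_measurable \<eta>_mem) simp
  show "(\<lambda>X. weighted \<rho> f (X (Suc j))) \<in> borel_measurable Q"
    using f j by (rule weighted_component_measurable)
qed

text \<open>The nodes enter only through \<open>coeff_formula\<close>; everything else depends on
  \<open>f\<close> alone.\<close>

lemma error_form_measurable:
  assumes f: "f \<in> H"
  shows "(\<lambda>X. error_form X f) \<in> borel_measurable Q"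
  unfolding error_form_def
proof (intro borel_measurable_add borel_measurable_const borel_measurable_sum)
  fix k assume "k \<in> {1..m - 1}"
  with f have "(\<lambda>X. coeff_formula \<eta> \<rho> n m X f k) \<in> borel_measurable Q" by (rule coeff_formula_measurable)
  then show "(\<lambda>X. (cmod (l2_inner M f (\<eta> k) - coeff_formula \<eta> \<rho> n m X f k))\<^sup>2) \<in> borel_measurable Q"
    by measurable
qed

text \<open>For fixed nodes every ingredient is continuous along norm convergence in
  \<open>H\<close>: inner products, point values, and the L2 form. A bound on a dense subset of the
  unit ball therefore holds on the whole ball.\<close>

lemma error_form_closed:
  assumes X: "X \<in> space Q" and S: "S \<subseteq> {f \<in> H. nsq f \<le> 1}"
    and dense: "\<And>f \<epsilon>. f \<in> {f \<in> H. nsq f \<le> 1} \<Longrightarrow> \<epsilon> > 0 \<Longrightarrow> \<exists>g\<in>S. hnorm ip (f - g) < \<epsilon>"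
    and le: "\<And>g. g \<in> S \<Longrightarrow> error_form X g \<le> C"
    and f: "f \<in> H" "nsq f \<le> 1"
  shows "error_form X f \<le> C"
proof -
  have "\<forall>i. \<exists>g. g \<in> S \<and> hnorm ip (f - g) < inverse (real (Suc i))"
    using dense[of f] f by (metis (mono_tags, lifting) inverse_positive_iff_positive mem_Collect_eq of_nat_0_less_iff zero_less_Suc)
  from choice[OF this] obtain F where F: "\<And>i. F i \<in> S" "\<And>i. hnorm ip (f - F i) < inverse (real (Suc i))" by blast
  have FH: "F i \<in> H" and F1: "nsq (F i) \<le> 1" for i using F(1)[of i] S by auto
  have sym: "hnorm ip (F i - f) = hnorm ip (f - F i)" for i
    by (rule hnorm_minus_commute[OF FH f(1)])
  have conv: "(\<lambda>i. hnorm ip (F i - f)) \<longlonglongrightarrow> 0"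
  proof (rule tendsto_sandwich[OF _ _ tendsto_const LIMSEQ_inverse_real_of_nat])
    show "\<forall>\<^sub>F i in sequentially. 0 \<le> hnorm ip (F i - f)"
      using FH f by (intro always_eventually allI hnorm_nonneg) auto
    show "\<forall>\<^sub>F i in sequentially. hnorm ip (F i - f) \<le> inverse (real (Suc i))"
      unfolding sym using F(2) by (intro always_eventually allI less_imp_le)
  qed
  have ipl: "(\<lambda>i. ip (F i) g) \<longlonglongrightarrow> ip f g" if "g \<in> H" for g
    by (rule convergent_seq_ip_left[OF FH f(1) conv that])
  have pt: "(\<lambda>i. F i x) \<longlonglongrightarrow> f x" if "x \<in> D" for x
    using ipl[OF section_mem[OF that]] FH f(1) that by (simp flip: reproducing)
  have wpt: "(\<lambda>i. weighted \<rho> (F i) x) \<longlonglongrightarrow> weighted \<rho> f x" if "x \<in> D" for x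
  proof (cases "\<rho> x = 0")
    case False
    have "weighted \<rho> g x = g x / complex_of_real (sqrt (\<rho> x))" for g
      using False by (simp add: weighted_def)
    then show ?thesis using False by (simp only:) (intro tendsto_divide pt that tendsto_const, simp)
  qed (simp add: weighted_def)
  have l2: "(\<lambda>i. l2_inner M (F i) (\<eta> k)) \<longlonglongrightarrow> l2_inner M f (\<eta> k)" if "k \<in> {1..m - 1}" for k
  proof -
    have k: "1 \<le> k" using that by simp
    show ?thesis unfolding l2_\<eta>[OF FH k] l2_\<eta>[OF f(1) k] by (intro tendsto_mult tendsto_const ipl e_mem k)
  qed
  have cf: "(\<lambda>i. coeff_formula \<eta> \<rho> n m X (F i) k) \<longlonglongrightarrow> coeff_formula \<eta> \<rho> n m X f k" for k
    unfolding coeff_formula_def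
    by (intro tendsto_sum tendsto_mult tendsto_const wpt space_Q[OF X]) auto
  have "(\<lambda>i. q (F i)) \<longlonglongrightarrow> q f"
    by (rule q_weakly_continuous[OF FH F1 f(1)]) (rule convergent_seq_ip[OF FH f(1) conv])
  then have "(\<lambda>i. error_form X (F i)) \<longlonglongrightarrow> error_form X f"
    unfolding error_form_def by (intro tendsto_add tendsto_diff tendsto_sum tendsto_power tendsto_norm l2 cf)
  moreover have "error_form X (F i) \<le> C" for i by (rule le[OF F(1)])
  ultimately show ?thesis by (meson LIMSEQ_le_const2)
qed

definition success :: "real \<Rightarrow> (nat \<Rightarrow> 'a) set" where
  "success C = {X \<in> space Q. wls_defined \<eta> \<rho> n m X \<and>
     (SUP f\<in>{f \<in> H. hnorm ip f \<le> 1}. l2_norm_sq M (f - wls_operator \<eta> \<rho> n m X f)) \<le> ennreal C}"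

text \<open>A nonmeasurable set would have \<open>measure\<close> 0 by convention, so a lower bound
  on the probability depends on this.\<close>

lemma success_measurable:
  assumes C: "0 \<le> C"
  shows "success C \<in> sets Q"
proof -
  have "{f \<in> H. nsq f \<le> 1} \<subseteq> H" by blast
  then obtain S where S: "countable S" "S \<subseteq> {f \<in> H. nsq f \<le> 1}"
    and dense: "\<And>f \<epsilon>. f \<in> {f \<in> H. nsq f \<le> 1} \<Longrightarrow> \<epsilon> > 0 \<Longrightarrow> \<exists>g\<in>S. hnorm ip (f - g) < \<epsilon>"
    by (rule separable_subset[OF separable]) blast
  let ?B = "\<lambda>X. mat_adjoint (wls_matrix \<eta> \<rho> n m X) * wls_matrix \<eta> \<rho> n m X"
  have "success C = {X \<in> space Q. det (?B X) \<noteq> 0} \<inter> {X \<in> space Q. \<forall>g\<in>S. error_form X g \<le> C}"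
  proof (rule equalityI; rule subsetI)
    fix X assume "X \<in> success C"
    then have X: "X \<in> space Q" "wls_defined \<eta> \<rho> n m X"
      "\<And>f. f \<in> H \<Longrightarrow> nsq f \<le> 1 \<Longrightarrow> l2_norm_sq M (f - wls_operator \<eta> \<rho> n m X f) \<le> ennreal C"
      unfolding success_def SUP_le_iff hnorm_le_1_iff by blast+
    have "error_form X g \<le> C" if "g \<in> S" for g
    proof -
      have g: "g \<in> H" "nsq g \<le> 1" using that S by auto
      show ?thesis using X(3)[OF g] unfolding error_form_eq[OF X(2) g(1)] using C by (simp only: ennreal_le_iff)
    qed
    then show "X \<in> {X \<in> space Q. det (?B X) \<noteq> 0} \<inter> {X \<in> space Q. \<forall>g\<in>S. error_form X g \<le> C}"
      using X(1,2) unfolding wls_defined_iff by blast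
  next
    fix X assume "X \<in> {X \<in> space Q. det (?B X) \<noteq> 0} \<inter> {X \<in> space Q. \<forall>g\<in>S. error_form X g \<le> C}"
    then have X: "X \<in> space Q" "wls_defined \<eta> \<rho> n m X" and le: "\<And>g. g \<in> S \<Longrightarrow> error_form X g \<le> C"
      unfolding wls_defined_iff by blast+
    have "l2_norm_sq M (f - wls_operator \<eta> \<rho> n m X f) \<le> ennreal C" if f: "f \<in> H" "nsq f \<le> 1" for f
      unfolding error_form_eq[OF X(2) f(1)]
      by (rule ennreal_leI, rule error_form_closed[OF X(1) S(2) dense le f])
    then show "X \<in> success C"
      unfolding success_def SUP_le_iff hnorm_le_1_iff using X by blast
  qed
  moreover have "{X \<in> space Q. det (?B X) \<noteq> 0} \<in> sets Q"
    using det_Bmat_measurable by measurable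
  moreover have "{X \<in> space Q. \<forall>g\<in>S. error_form X g \<le> C} \<in> sets Q"
  proof -
    have "{X \<in> space Q. C < error_form X g} \<in> sets Q" if "g \<in> S" for g
    proof -
      have "(\<lambda>X. error_form X g) \<in> borel_measurable Q"
        using that S by (intro error_form_measurable) auto
      then show ?thesis by measurable
    qed
    then have "(\<Union>g\<in>S. {X \<in> space Q. C < error_form X g}) \<in> sets Q"
      by (rule sets.countable_UN''[OF S(1)])
    moreover have "{X \<in> space Q. \<forall>g\<in>S. error_form X g \<le> C} =
        space Q - (\<Union>g\<in>S. {X \<in> space Q. C < error_form X g})"
      by (auto simp: not_less)
    ultimately show ?thesis by (simp only: sets.compl_sets)
  qed
  ultimately show ?thesis by (simp only: sets.Int)
qed

text \<open>The lower tail is used at a quarter of the mean with exponent \<open>t * R = 1/2\<close>, the upper tail with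
  \<open>t * R = 1/3\<close>. Since \<open>exp (-1/2) \<ge> 4/7\<close> and \<open>exp (1/3) \<le> 3/2\<close>, each of the three exceptional
  events has probability at most \<open>n * exp (-\<kappa>)\<close>.\<close>

theorem success_probability:
  assumes \<kappa>: "1 \<le> \<kappa>" and m: "14 * \<kappa> * real m \<le> real n"
    and C: "7 * lam m + (96 / 14 + 8) * tail / real m \<le> C"
  shows "1 - 3 * (real n * exp (- \<kappa>)) \<le> measure Q (success C)"
proof -
  have npos: "0 < real n" using n1 by simp
  have mpos: "0 < real m" using m2 by simp
  have m1pos: "1 \<le> real (m - 1)" using m2 by simp
  define \<delta> where "\<delta> = real n * exp (- \<kappa>)"
  have \<delta>: "0 < \<delta>" using npos by (simp add: \<delta>_def)
  have e3: "exp (1 :: real) \<le> 3" by (rule exp_le)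
  have half: "4 / 7 \<le> exp (- (1 / 2) :: real)"
  proof -
    have "exp (1 / 2 :: real) ^ 2 = exp 1" by (simp flip: exp_of_nat_mult)
    then have "exp (1 / 2 :: real) ^ 2 \<le> (7 / 4) ^ 2" using e3 by (simp add: power2_eq_square)
    then have "exp (1 / 2 :: real) \<le> 7 / 4" by (rule power2_le_imp_le) simp
    then have "1 / (7 / 4) \<le> 1 / exp (1 / 2 :: real)" by (intro divide_left_mono) auto
    then show ?thesis by (simp add: exp_minus inverse_eq_divide)
  qed
  have third: "exp (1 / 3 :: real) \<le> 3 / 2"
  proof -
    have "exp (1 / 3 :: real) ^ 3 = exp 1" by (simp flip: exp_of_nat_mult)
    then have "exp (1 / 3 :: real) ^ Suc 2 \<le> (3 / 2) ^ Suc 2" using e3 by (simp add: eval_nat_numeral)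
    then show ?thesis by (rule power_le_imp_le_base) simp
  qed
  obtain B1 where B1: "B1 \<in> sets Q" "measure Q B1 \<le> \<delta>"
    "\<And>X c. X \<in> space Q - B1 \<Longrightarrow> real n / 4 * (\<Sum>i\<in>{1..m - 1}. (cmod (c i))\<^sup>2) \<le>
      (\<Sum>l\<in>{1..n}. (cmod (inner_on {1..m - 1} c (\<lambda>i. weighted \<rho> (\<eta> i) (X l))))\<^sup>2)"
  proof -
    let ?t = "1 / (4 * real (m - 1))" and ?R = "2 * real (m - 1)"
    have tR: "?t * ?R = 1 / 2" using m1pos by simp
    have "\<exists>B\<in>sets Q. measure Q B \<le> 4 * real (card {1..m - 1}) * exp (?t * (real n / 4) - real n * (?t * exp (- (?t * ?R)))) \<and>
      (\<forall>X\<in>space Q - B. \<forall>c. real n / 4 * (\<Sum>i\<in>{1..m - 1}. (cmod (c i))\<^sup>2) \<le>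
        (\<Sum>l\<in>{1..n}. (cmod (inner_on {1..m - 1} c (\<lambda>i. weighted \<rho> (\<eta> i) (X l))))\<^sup>2))"
    proof (rule low.lower_tail)
      show "?t \<le> 1" using m1pos by (simp add: divide_le_eq)
      show "0 < ?t" using m1pos by simp
    qed (use m2 in auto)
    then obtain B where B: "B \<in> sets Q"
      "measure Q B \<le> 4 * real (m - 1) * exp (?t * (real n / 4) - real n * (?t * exp (- (1 / 2))))"
      "\<And>X c. X \<in> space Q - B \<Longrightarrow> real n / 4 * (\<Sum>i\<in>{1..m - 1}. (cmod (c i))\<^sup>2) \<le>
        (\<Sum>l\<in>{1..n}. (cmod (inner_on {1..m - 1} c (\<lambda>i. weighted \<rho> (\<eta> i) (X l))))\<^sup>2)"
      unfolding tR card_atLeastAtMost diff_add_inverse2 Suc_eq_plus1 by blast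
    \<comment> \<open>From 14 \<kappa> (m - 1) <= n and \<open>?t\<close> = 1 / (4 (m - 1)).\<close>
    have nt: "7 / 2 * \<kappa> \<le> real n * ?t"
    proof -
      have "14 * \<kappa> * real (m - 1) \<le> 14 * \<kappa> * real m" using \<kappa> by (intro mult_left_mono) auto
      then have "14 * \<kappa> * real (m - 1) \<le> real n" using m by linarith
      then show ?thesis using m1pos by (simp add: field_simps)
    qed
    have "?t * (real n / 4) - real n * (?t * exp (- (1 / 2))) = - (real n * ?t * (exp (- (1 / 2)) - 1 / 4))"
      by (simp add: algebra_simps)
    \<comment> \<open>The product of 7/2 and 4/7 - 1/4 = 9/28 is 9/8, just enough for the exponent
      -\<kappa>. The prefactor 4 (m - 1) is absorbed by \<open>n\<close> since 14 m <= n.\<close>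
    also have "\<dots> \<le> - (7 / 2 * \<kappa> * (4 / 7 - 1 / 4))"
    proof (rule le_imp_neg_le, rule mult_mono[OF nt])
      show "4 / 7 - 1 / 4 \<le> exp (- (1 / 2)) - 1 / (4 :: real)" using half by simp
    qed (use nt \<kappa> in auto)
    also have "\<dots> \<le> - \<kappa>" using \<kappa> by simp
    finally have "exp (?t * (real n / 4) - real n * (?t * exp (- (1 / 2)))) \<le> exp (- \<kappa>)" by simp
    moreover have "4 * real (m - 1) \<le> real n"
    proof -
      have "14 * 1 * real m \<le> 14 * \<kappa> * real m" using \<kappa> by (intro mult_right_mono mult_left_mono) auto
      then have "14 * real m \<le> real n" using m by linarith
      then show ?thesis using m2 by (simp add: of_nat_diff)
    qed
    ultimately have "4 * real (m - 1) * exp (?t * (real n / 4) - real n * (?t * exp (- (1 / 2)))) \<le> real n * exp (- \<kappa>)"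
      by (intro mult_mono) auto
    with B(2) have "measure Q B \<le> \<delta>" unfolding \<delta>_def by (rule order_trans)
    then show ?thesis using B(1,3) that by blast
  qed
  \<comment> \<open>The far tail adds 4 \<epsilon> = 8 tail / m to the error, a part of the budget
    of 15 tail / m.\<close>
  define \<epsilon> where "\<epsilon> = 2 * tail / real m"
  have \<epsilon>: "0 < \<epsilon>" using tail_pos mpos by (simp add: \<epsilon>_def)
  obtain N B3 where N: "m \<le> N" and B3: "B3 \<in> sets Q" "measure Q B3 \<le> \<delta>"
    "\<And>X. X \<in> space Q - B3 \<Longrightarrow> (\<Sum>l\<in>{1..n}. weighted_residual N (X l)) \<le> real n * \<epsilon>"
    using tail_event[OF \<epsilon> \<delta>] by blast
  \<comment> \<open>With t = 1 / (6 tail), the first summand of t s cancels the part of the growth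
    rate due to \<open>lam m\<close>, and the second is 4 \<kappa>. The exponent left over is at
    most 1/4 - 4 \<kappa> <= -2 - \<kappa>, and exp (-2) <= 1/2 absorbs the prefactor 2.\<close>
  define s where "s = 3 / 2 * real n * lam m + 24 * tail * \<kappa>"
  have s: "0 < s"
    unfolding s_def using npos lam_m_pos tail_pos \<kappa> by (intro add_pos_pos mult_pos_pos) auto
  obtain B2 where B2: "B2 \<in> sets Q" "measure Q B2 \<le> \<delta>"
    "\<And>X c. X \<in> space Q - B2 \<Longrightarrow> (\<Sum>l\<in>{1..n}. (cmod (inner_on {m..N} c (\<lambda>i. weighted \<rho> (e i) (X l))))\<^sup>2)
      \<le> s * (\<Sum>i\<in>{m..N}. (cmod (c i))\<^sup>2)"
  proof -
    let ?t = "1 / (6 * tail)"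
    let ?a = "?t * exp (?t * (2 * tail)) * (lam m + tail / real n)"
    interpret up: random_vector \<mu> "{m..N}" "\<lambda>x i. weighted \<rho> (e i) x" "2 * tail" lam
      by (rule random_vector_up)
    have "\<exists>B\<in>sets Q. measure Q B \<le> 2 * real n * exp (real n * ?a - ?t * s) \<and>
      (\<forall>X\<in>space Q - B. \<forall>c. (\<Sum>l\<in>{1..n}. (cmod (inner_on {m..N} c (\<lambda>i. weighted \<rho> (e i) (X l))))\<^sup>2)
        \<le> s * (\<Sum>i\<in>{m..N}. (cmod (c i))\<^sup>2))"
    proof (rule up.upper_tail[where L = "lam m" and S = tail])
      show "0 \<le> lam i" if "i \<in> {m..N}" for i using lam_pos[of i] that m2 by auto
      show "lam i \<le> lam m" if "i \<in> {m..N}" for i using lam_mono[of m i] that m2 by auto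
      show "sum lam {m..N} \<le> tail" using N by (intro sum_lam_tail_le) auto
    qed (use lam_m_pos n1 tail_pos s in auto)
    then obtain B where B: "B \<in> sets Q" "measure Q B \<le> 2 * real n * exp (real n * ?a - ?t * s)"
      "\<And>X c. X \<in> space Q - B \<Longrightarrow> (\<Sum>l\<in>{1..n}. (cmod (inner_on {m..N} c (\<lambda>i. weighted \<rho> (e i) (X l))))\<^sup>2)
        \<le> s * (\<Sum>i\<in>{m..N}. (cmod (c i))\<^sup>2)" by blast
    have "?t * (2 * tail) = 1 / 3" using tail_pos by simp
    then have "real n * ?a = ?t * (real n * lam m + tail) * exp (1 / 3)"
      using npos by (simp add: field_simps)
    also have "\<dots> \<le> ?t * (real n * lam m + tail) * (3 / 2)"
      using third tail_pos lam_m_pos npos by (intro mult_left_mono) auto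
    also have "\<dots> = ?t * s + 1 / 4 - 4 * \<kappa>"
      using tail_pos by (simp add: s_def field_simps)
    finally have "real n * ?a - ?t * s \<le> 1 / 4 - 4 * \<kappa>" by simp
    also have "\<dots> \<le> - 2 - \<kappa>" using \<kappa> by simp
    finally have "exp (real n * ?a - ?t * s) \<le> exp (- 2 - \<kappa>)" by simp
    also have "\<dots> = exp (- 2) * exp (- \<kappa>)" by (simp flip: exp_add)
    also have "\<dots> \<le> 1 / 2 * exp (- \<kappa>)"
    proof (rule mult_right_mono)
      have "2 \<le> exp (2 :: real)" using exp_ge_add_one_self[of "2 :: real"] by simp
      then have "inverse (exp 2) \<le> inverse (2 :: real)" by (intro le_imp_inverse_le) auto
      then show "exp (- 2 :: real) \<le> 1 / 2" by (simp add: exp_minus)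
    qed simp
    finally have "2 * real n * exp (real n * ?a - ?t * s) \<le> 2 * real n * (1 / 2 * exp (- \<kappa>))"
      using npos by (intro mult_left_mono) auto
    then have "measure Q B \<le> \<delta>" using B(2) unfolding \<delta>_def by simp
    then show ?thesis using B(1,3) that by blast
  qed
  \<comment> \<open>4 s / n consists of 6 \<open>lam m\<close>, which the projection error raises to
    7, and of 96 tail \<kappa> / n, where \<kappa> / n <= 1 / (14 m).\<close>
  have bound: "lam m + 4 / real n * (s + real n * \<epsilon>) \<le> C"
  proof -
    have "4 / real n * (s + real n * \<epsilon>) = 6 * lam m + 96 * tail * (\<kappa> / real n) + 8 * tail / real m"
      using npos by (simp add: s_def \<epsilon>_def field_simps)
    moreover have "96 * tail * (\<kappa> / real n) \<le> 96 * tail * (1 / (14 * real m))"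
    proof (rule mult_left_mono)
      show "\<kappa> / real n \<le> 1 / (14 * real m)" using m npos mpos by (simp add: field_simps)
    qed (use tail_pos in simp)
    moreover have "96 * tail * (1 / (14 * real m)) + 8 * tail / real m = (96 / 14 + 8) * tail / real m"
      using mpos by (simp add: field_simps)
    ultimately show ?thesis using C by linarith
  qed
  have C0: "0 \<le> C"
  proof -
    have "0 \<le> 7 * lam m + (96 / 14 + 8) * tail / real m"
      using lam_m_pos tail_pos mpos by (intro add_nonneg_nonneg divide_nonneg_nonneg mult_nonneg_nonneg) auto
    then show ?thesis using C by (rule order_trans)
  qed
  interpret Qp: prob_space Q by (rule low.prob_space_P)
  let ?B = "B1 \<union> B2 \<union> B3"
  have Bs: "?B \<in> sets Q" using B1(1) B2(1) B3(1) by blast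
  have sub: "space Q - ?B \<subseteq> success C"
  proof
    fix X assume X: "X \<in> space Q - ?B"
    then have X': "X \<in> space Q" "X \<in> space Q - B1" "X \<in> space Q - B2" "X \<in> space Q - B3" by auto
    have "wls_defined \<eta> \<rho> n m X"
      using wls_stability(1)[OF _ B1(3)[OF X'(2)]] npos by simp
    moreover have "l2_norm_sq M (f - wls_operator \<eta> \<rho> n m X f) \<le> ennreal C" if f: "f \<in> H" "nsq f \<le> 1" for f
      using error_bound[OF X'(1) N s \<epsilon> B1(3)[OF X'(2)] B2(3)[OF X'(3)] B3(3)[OF X'(4)] f] ennreal_leI[OF bound]
      by (rule order_trans)
    ultimately show "X \<in> success C"
      unfolding success_def SUP_le_iff hnorm_le_1_iff using X'(1) by blast
  qed
  have "measure Q ?B \<le> measure Q (B1 \<union> B2) + measure Q B3"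
    using B1(1) B2(1) B3(1) by (intro measure_Un_le) auto
  also have "measure Q (B1 \<union> B2) \<le> measure Q B1 + measure Q B2"
    using B1(1) B2(1) by (intro measure_Un_le) auto
  finally have "measure Q ?B \<le> 3 * \<delta>" using B1(2) B2(2) B3(2) by linarith
  then have "1 - 3 * \<delta> \<le> measure Q (space Q - ?B)" using Qp.prob_compl[OF Bs] by simp
  also have "\<dots> \<le> measure Q (success C)"
    using sub success_measurable[OF C0] by (intro Qp.finite_measure_mono)
  finally show ?thesis unfolding \<delta>_def .
qed

end

section \<open>From eigenvalue bounds to singular numbers and explicit constants\<close>

theorem theorem1p3:
  fixes D :: "(real ^ 'd) set"
    and K :: "real ^ 'd \<Rightarrow> real ^ 'd \<Rightarrow> complex"
    and H :: "(real ^ 'd \<Rightarrow> complex) set"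
    and ip :: "(real ^ 'd \<Rightarrow> complex) \<Rightarrow> (real ^ 'd \<Rightarrow> complex) \<Rightarrow> complex"
    and \<rho>D :: "(real ^ 'd) measure"
    and lam \<sigma> :: "nat \<Rightarrow> real"
    and e \<eta> :: "nat \<Rightarrow> real ^ 'd \<Rightarrow> complex"
    and r :: real and n m :: nat
    and \<rho> :: "real ^ 'd \<Rightarrow> real"
    and P :: "(nat \<Rightarrow> real ^ 'd) measure"
  assumes kernel: "pos_def_kernel D K"
    and HK: "rkhs D K H ip"
    and separable: "separable_hilbert H ip"
    and inf_dim: "infinite_dimensional H"
    and space: "space \<rho>D = D"
    and measurable: "\<And>f. f \<in> H \<Longrightarrow> f \<in> borel_measurable \<rho>D"
    and finite_trace: "integrable \<rho>D (\<lambda>x. Re (K x x))"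
    and eigenvalues: "positive_eigenvalue_sequence H (embedding_gram H ip \<rho>D) lam"
    and eigenvectors: "orthonormal_eigenvectors H ip (embedding_gram H ip \<rho>D) lam e"
    and sigma: "\<And>j. \<sigma> j = sqrt (lam j)"
    and eta: "\<And>j. \<eta> j = fscale (complex_of_real (inverse (\<sigma> j))) (e j)"
    and r: "r > 1"
    and n: "n \<ge> 3"
    and m: "m = nat \<lfloor>real n / (14 * r * ln (real n))\<rfloor>"
    and m2: "m \<ge> 2"
    and density: "\<rho> = sampling_density \<rho>D K lam e \<eta> m"
    and product: "P = PiM {1..n} (\<lambda>_. density \<rho>D (\<lambda>x. ennreal (\<rho> x)))"
  shows "measure P {X \<in> space P. wls_defined \<eta> \<rho> n m X \<and>
           (SUP f\<in>{f \<in> H. hnorm ip f \<le> 1}. l2_norm_sq \<rho>D (f - wls_operator \<eta> \<rho> n m X f))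
             \<le> ennreal (15 / real m * (\<Sum>j. (\<sigma> (m div 2 + j))\<^sup>2))}
         \<ge> 1 - 3 * real n powr (1 - r)"
proof -
  interpret rkhs D K H ip by (rule HK)
  interpret S: wls_sampling D K H ip \<rho>D lam e m n
    by unfold_locales (use separable space measurable finite_trace eigenvalues eigenvectors m2 n in auto)
  have \<eta>_eq: "\<eta> = S.\<eta>" unfolding S.\<eta>_def[abs_def] eta[abs_def] sigma ..
  have \<rho>_eq: "\<rho> = S.\<rho>" unfolding density S.\<rho>_def[abs_def] \<eta>_eq ..
  have P_eq: "P = S.Q" unfolding product S.\<mu>_def \<rho>_eq ..
  let ?k = "m div 2" and ?C = "15 / real m * (\<Sum>j. (\<sigma> (m div 2 + j))\<^sup>2)"
  have k1: "1 \<le> ?k" using m2 by simp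
  have mpos: "0 < real m" using m2 by simp
  \<comment> \<open>The trace formula starts at \<open>lam 1\<close>, so \<open>?k - 1\<close> terms
    are removed. Since \<open>m \<ge> 2\<close> gives \<open>?k \<ge> 1\<close>, the irrelevant
    value at index 0 never enters.\<close>
  have "(\<lambda>j. lam (Suc (j + (?k - 1)))) sums (S.tr - (\<Sum>j<?k - 1. lam (Suc j)))"
    by (rule sums_split_initial_segment[OF S.trace_formula])
  moreover have "lam (Suc (j + (?k - 1))) = (\<sigma> (?k + j))\<^sup>2" for j
  proof -
    have "Suc (j + (?k - 1)) = ?k + j" using k1 by simp
    moreover have "0 \<le> lam (?k + j)" using S.lam_pos[of "?k + j"] k1 by simp
    ultimately show ?thesis unfolding sigma by (simp only: real_sqrt_pow2)
  qed
  moreover have "(\<Sum>j<?k - 1. lam (Suc j)) = sum lam {1..?k - 1}"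
    by (rule sum.reindex_bij_witness[of _ "\<lambda>k. k - 1" Suc]) auto
  ultimately have "(\<lambda>j. (\<sigma> (?k + j))\<^sup>2) sums (S.tr - sum lam {1..?k - 1})" by simp
  then have suminf: "(\<Sum>j. (\<sigma> (?k + j))\<^sup>2) = S.tr - sum lam {1..?k - 1}" by (rule sums_unique[symmetric])
  have split: "{1..m - 1} = {1..?k - 1} \<union> {?k..m - 1}" "{1..?k - 1} \<inter> {?k..m - 1} = {}"
    using k1 by auto
  have "sum lam {1..m - 1} = sum lam {1..?k - 1} + sum lam {?k..m - 1}"
    unfolding split(1) using split(2) by (intro sum.union_disjoint) auto
  then have total: "(\<Sum>j. (\<sigma> (?k + j))\<^sup>2) = S.tail + sum lam {?k..m - 1}"
    unfolding suminf S.tail_def by simp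
  \<comment> \<open>There are m - (m div 2) >= m / 2 indices from \<open>?k\<close> to
    \<open>m - 1\<close>, each with an eigenvalue of at least \<open>lam m\<close>. This is the
    purpose of starting the series at half of \<open>m\<close>.\<close>
  have "real m / 2 * lam m \<le> real (card {?k..m - 1}) * lam m"
    using S.lam_m_pos by (intro mult_right_mono) (auto simp: of_nat_diff)
  also have "\<dots> \<le> sum lam {?k..m - 1}"
    using k1 S.lam_mono by (intro sum_bounded_below) auto
  finally have head: "real m / 2 * lam m \<le> sum lam {?k..m - 1}" .
  \<comment> \<open>The part of the series below \<open>m\<close> pays for 7 \<open>lam m\<close> at
    the rate 14 / m, and the part from \<open>m\<close> on for the tail at the rate 96/14 + 8 =
    104/7; both rates are below 15.\<close>
  have C: "7 * lam m + (96 / 14 + 8) * S.tail / real m \<le> ?C"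
  proof -
    have "7 * lam m = 14 / real m * (real m / 2 * lam m)" using mpos by simp
    also have "\<dots> \<le> 14 / real m * sum lam {?k..m - 1}" using head mpos by (intro mult_left_mono) auto
    also have "\<dots> \<le> 15 / real m * sum lam {?k..m - 1}"
    proof (rule mult_right_mono)
      have "0 \<le> real m / 2 * lam m" using S.lam_m_pos by simp
      then show "0 \<le> sum lam {?k..m - 1}" using head by (rule order_trans)
    qed (use mpos in \<open>simp add: divide_right_mono\<close>)
    finally have "7 * lam m \<le> 15 / real m * sum lam {?k..m - 1}" .
    moreover have "(96 / 14 + 8) * S.tail / real m \<le> 15 / real m * S.tail"
      using S.tail_pos mpos by (simp add: field_simps)
    ultimately show ?thesis unfolding total by (simp only: distrib_left add.commute add_mono)
  qed
  \<comment> \<open>\<open>n \<ge> 3\<close> exceeds e, so \<kappa> = r ln n is at least 1, as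
    \<open>success_probability\<close> demands.\<close>
  have ln1: "1 \<le> ln (real n)"
  proof -
    have "exp 1 \<le> real n" using exp_le n by simp
    then show ?thesis using n by (simp add: ln_ge_iff)
  qed
  let ?\<kappa> = "r * ln (real n)"
  have \<kappa>: "1 \<le> ?\<kappa>" using mult_mono[of 1 r 1 "ln (real n)"] r ln1 by simp
  have mle: "14 * ?\<kappa> * real m \<le> real n"
  proof -
    have pos: "0 < 14 * r * ln (real n)" using r ln1 by simp
    have "real m \<le> real n / (14 * r * ln (real n))"
      unfolding m using pos by (intro of_nat_floor) simp
    then show ?thesis using pos by (simp add: pos_le_divide_eq mult_ac)
  qed
  have "real n powr (1 - r) = exp (ln (real n) + - ?\<kappa>)"
    using n by (simp add: powr_def algebra_simps)
  also have "\<dots> = real n * exp (- ?\<kappa>)" unfolding exp_add using n by simp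
  finally have "real n * exp (- ?\<kappa>) = real n powr (1 - r)" by (rule sym)
  then have "1 - 3 * real n powr (1 - r) \<le> measure S.Q (S.success ?C)"
    using S.success_probability[OF \<kappa> mle C] by (simp only:)
  then show ?thesis unfolding S.success_def P_eq \<eta>_eq \<rho>_eq .
qed

end
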